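(* Let $\alpha>3$, and let $u$ be the solution (defined up to its hitting time $\tau$ of $0$, as described in the context) of the stochastic wave equation with singular drift $$\partial_t^2u(t,x)=\Delta u(t,x)+u(t,x)^{-\alpha}+g(u(t,x))\dot W(t,x),\qquad u(0,x)=u_0(x),\quad \partial_tu(0,x)=u_1(x),$$ for $t\ge 0$ and $x$ in the circle $\mathbf{I}=[0,J]$ with endpoints identified. Then $\mathbf{P}(\tau<\infty)=0$; that is, almost surely $u$ never hits $0$.
   Context: Fix $J>0$ and let $\mathbf{I}=[0,J]$ with endpoints identified (the circle $\mathbf{R}/J\mathbf{Z}$); arithmetic in the space variable is modulo $J$. $\dot W$ is a two-parameter (space-time) white noise on $[0,\infty)\times\mathbf{I}$, with filtration $\mathcal{F}_t=\sigma(W(A):A\subset[0,t]\times\mathbf{I})$; stochastic integrals are Walsh integrals. Assumptions: (i) $u_0$ is Hölder continuous of order $1/2$ on $\mathbf{I}$; (ii) there are constants $0<c_0<C_0<\infty$ with $c_0\le u_0(x)\le C_0$ for all $x$; (iii) $u_1$ is Hölder continuous of order $1/2$ on $\mathbf{I}$; (iv) there are constants $0<c_g<C_g<\infty$ with $c_g\le g(y)\le C_g$ for all $y\in\mathbf{R}$, and $g$ is Lipschitz. Wave kernels: $S(t,x)=\frac12\mathbf{1}(|x|\le t)$ and $S_{\mathbf{I}}(t,x)=\sum_{n\in\mathbf{Z}}S(t,x+nJ)$. Let $w(t,x)=\frac12\big(u_0(x+t)+u_0(x-t)\big)+\int_0^J S_{\mathbf{I}}(t,x-y)u_1(y)\,dy$.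 For $N=1,2,\dots$ let $u_N$ be the unique strong solution (valid for all $t\ge0$) of $$u_N(t,x)=w(t,x)+\int_0^t\int_0^J S_{\mathbf{I}}(t-s,x-y)\big[u_N(s,y)\vee(1/N)\big]^{-\alpha}dy\,ds+\int_0^t\int_0^J S_{\mathbf{I}}(t-s,x-y)g(u_N(s,y))W(dy\,ds).$$ Let $\tau_N=\inf\{t>0:\inf_{x\in\mathbf{I}}u_N(t,x)\le 1/N\}$ and $\tau=\sup_N\tau_N$ (possibly $\infty$). For $t<\tau$, $u(t,x)=\lim_N u_N(t,x)$ (the sequence is eventually constant), so $u$ satisfies the mild equation with drift $u^{-\alpha}$ for $t<\tau$; $\tau$ is the first time $u$ hits $0$. *)

theory Defs
  imports "HOL-Probability.Probability"
begin

text \<open>Periodised wave kernel on the circle R/JZ: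
  S_I(t,x) = sum over n of (1/2) 1(|x + nJ| <= t).\<close>
definition SI :: "real \<Rightarrow> real \<Rightarrow> real \<Rightarrow> real" where
  "SI J t x = real (card {n::int. \<bar>x + of_int n * J\<bar> \<le> t}) / 2"

definition holder_half_periodic :: "real \<Rightarrow> (real \<Rightarrow> real) \<Rightarrow> bool" where
  "holder_half_periodic J f \<longleftrightarrow> (\<forall>x. f (x + J) = f x) \<and>
     (\<exists>C. \<forall>x y. \<bar>f x - f y\<bar> \<le> C * sqrt \<bar>x - y\<bar>)"

definition wave_init :: "real \<Rightarrow> (real \<Rightarrow> real) \<Rightarrow> (real \<Rightarrow> real) \<Rightarrow> real \<Rightarrow> real \<Rightarrow> real" where
  "wave_init J u0 u1 t x = (u0 (x + t) + u0 (x - t)) / 2 + (LINT y:{0..J}|lborel. SI J t (x - y) * u1 y)"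

definition wn_set :: "real \<Rightarrow> (real \<times> real) set \<Rightarrow> bool" where
  "wn_set J A \<longleftrightarrow> A \<in> sets lborel \<and> A \<subseteq> {0..} \<times> {0..<J} \<and> emeasure lborel A < \<infinity>"

definition white_noise :: "'a measure \<Rightarrow> real \<Rightarrow> ((real \<times> real) set \<Rightarrow> 'a \<Rightarrow> real) \<Rightarrow> bool" where
  "white_noise M J W \<longleftrightarrow>
     (\<forall>A. wn_set J A \<longrightarrow> W A \<in> borel_measurable M \<and>
        (measure lborel A = 0 \<longrightarrow> (AE \<omega> in M. W A \<omega> = 0)) \<and>
        (measure lborel A > 0 \<longrightarrow> distributed M lborel (W A) (normal_density 0 (sqrt (measure lborel A))))) \<and>
     (\<forall>A B. wn_set J A \<and> wn_set J B \<and> A \<inter> B = {} \<longrightarrow> (AE \<omega> in M. W (A \<union> B) \<omega> = W A \<omega> + W B \<omega>)) \<and>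
     (\<forall>(n::nat) A. (\<forall>i<n. wn_set J (A i)) \<and> disjoint_family_on A {..<n} \<longrightarrow>
        prob_space.indep_vars M (\<lambda>_. borel) (\<lambda>i. W (A i)) {..<n})"

definition wn_filtration :: "'a measure \<Rightarrow> real \<Rightarrow> ((real \<times> real) set \<Rightarrow> 'a \<Rightarrow> real) \<Rightarrow> real \<Rightarrow> 'a measure" where
  "wn_filtration M J W t = sigma (space M)
     {W A -` B \<inter> space M | A B. wn_set J A \<and> A \<subseteq> {0..t} \<times> {0..<J} \<and> B \<in> sets borel}"

definition simple_pred :: "'a measure \<Rightarrow> real \<Rightarrow> ((real \<times> real) set \<Rightarrow> 'a \<Rightarrow> real) \<Rightarrow>
    nat \<Rightarrow> (nat \<Rightarrow> real) \<Rightarrow> (nat \<Rightarrow> real) \<Rightarrow> (nat \<Rightarrow> real set) \<Rightarrow> (nat \<Rightarrow> 'a \<Rightarrow> real) \<Rightarrow> bool" where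
  "simple_pred M J W n a b B X \<longleftrightarrow> (\<forall>i<n. 0 \<le> a i \<and> a i < b i \<and> B i \<in> sets lborel \<and> B i \<subseteq> {0..<J} \<and>
      X i \<in> borel_measurable (wn_filtration M J W (a i)) \<and> (\<exists>C. \<forall>\<omega>\<in>space M. \<bar>X i \<omega>\<bar> \<le> C))"

definition simple_fun :: "nat \<Rightarrow> (nat \<Rightarrow> real) \<Rightarrow> (nat \<Rightarrow> real) \<Rightarrow> (nat \<Rightarrow> real set) \<Rightarrow> (nat \<Rightarrow> 'a \<Rightarrow> real)
    \<Rightarrow> real \<times> real \<Rightarrow> 'a \<Rightarrow> real" where
  "simple_fun n a b B X z \<omega> = (\<Sum>i<n. X i \<omega> * indicator {a i<..b i} (fst z) * indicator (B i) (snd z))"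

definition simple_int :: "((real \<times> real) set \<Rightarrow> 'a \<Rightarrow> real) \<Rightarrow> nat \<Rightarrow> (nat \<Rightarrow> real) \<Rightarrow> (nat \<Rightarrow> real) \<Rightarrow>
    (nat \<Rightarrow> real set) \<Rightarrow> (nat \<Rightarrow> 'a \<Rightarrow> real) \<Rightarrow> 'a \<Rightarrow> real" where
  "simple_int W n a b B X \<omega> = (\<Sum>i<n. X i \<omega> * W ({a i<..b i} \<times> B i) \<omega>)"

definition walsh_integral :: "'a measure \<Rightarrow> real \<Rightarrow> ((real \<times> real) set \<Rightarrow> 'a \<Rightarrow> real) \<Rightarrow>
    (real \<times> real \<Rightarrow> 'a \<Rightarrow> real) \<Rightarrow> ('a \<Rightarrow> real) \<Rightarrow> bool" where
  "walsh_integral M J W f I \<longleftrightarrow>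
     (\<lambda>(z, \<omega>). f z \<omega>) \<in> borel_measurable (lborel \<Otimes>\<^sub>M M) \<and> I \<in> borel_measurable M \<and>
     (\<exists>n a b B X. (\<forall>k. simple_pred M J W (n k) (a k) (b k) (B k) (X k)) \<and>
        ((\<lambda>k. \<integral>\<^sup>+ \<omega>. (\<integral>\<^sup>+ z\<in>{0..} \<times> {0..<J}.
            ennreal ((f z \<omega> - simple_fun (n k) (a k) (b k) (B k) (X k) z \<omega>)\<^sup>2) \<partial>lborel) \<partial>M)
          \<longlonglongrightarrow> 0) \<and>
        ((\<lambda>k. \<integral>\<^sup>+ \<omega>. ennreal ((I \<omega> - simple_int W (n k) (a k) (b k) (B k) (X k) \<omega>)\<^sup>2) \<partial>M)
          \<longlonglongrightarrow> 0))"

definition strong_solution :: "'a measure \<Rightarrow> real \<Rightarrow> ((real \<times> real) set \<Rightarrow> 'a \<Rightarrow> real) \<Rightarrow> real \<Rightarrow>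
    (real \<Rightarrow> real) \<Rightarrow> (real \<Rightarrow> real) \<Rightarrow> (real \<Rightarrow> real) \<Rightarrow> nat \<Rightarrow> (real \<Rightarrow> real \<Rightarrow> 'a \<Rightarrow> real) \<Rightarrow> bool" where
  "strong_solution M J W \<alpha> u0 u1 g N v \<longleftrightarrow>
     (\<forall>t\<ge>0. \<forall>x\<in>{0..J}. v t x \<in> borel_measurable (wn_filtration M J W t)) \<and>
     (AE \<omega> in M. continuous_on ({0..} \<times> {0..J}) (\<lambda>(t, x). v t x \<omega>)) \<and>
     (\<forall>t\<ge>0. \<forall>x\<in>{0..J}. \<exists>I.
        walsh_integral M J W (\<lambda>(s, y) \<omega>. if s < t then SI J (t - s) (x - y) * g (v s y \<omega>) else 0) I \<and>
        (AE \<omega> in M. v t x \<omega> = wave_init J u0 u1 t x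
            + (LINT z:{0..t} \<times> {0..J}|lborel.
                 SI J (t - fst z) (x - snd z) * (max (v (fst z) (snd z) \<omega>) (1 / real N)) powr (- \<alpha>))
            + I \<omega>))"

text \<open>tau_N = inf{t>0 : inf_x u_N(t,x) <= 1/N} (inf of the empty set = oo).\<close>
definition hit_time :: "real \<Rightarrow> (real \<Rightarrow> real \<Rightarrow> 'a \<Rightarrow> real) \<Rightarrow> nat \<Rightarrow> 'a \<Rightarrow> ereal" where
  "hit_time J v N \<omega> = Inf {ereal t | t. t > 0 \<and> (INF x\<in>{0..J}. v t x \<omega>) \<le> 1 / real N}"

end

theory Submission
  imports Defs
begin

text \<open>
Fix a time horizon and a level k, and take N = 2^k. Only the regularity of the stochastic convolution
matters, with bounds uniform in N; no comparison between the different u_N is needed. Because g is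
bounded, increments of the Walsh integral are sub-Gaussian with variance proxy of the order of the
distance of the two space-time points, so dyadic chaining bounds the oscillation at scale 2^(-k) by
a = C q^k, off an event whose probability tends to 0; here q = 2^(-h) for any h < 1/2.

Suppose off that event u_N reaches 1/N, and consider the first such point (t, x). The drift part D is
increasing along forward light cones, so u_N is of order at most a in the backward light cone of (t, x) at
scale r = 2^(-k). Hence D(t, x) - D(t - r, x) is at least of order r^2 a^(-alpha), and
u_N(t - r, x) is bounded by a constant times a minus that quantity. For alpha > 3 one may choose h < 1/2 with
h (alpha + 1) > 2; then r^2 a^(-alpha) dominates a and u_N(t - r, x) < 0, which is absurd.
\<close>

section \<open>White noise and its atoms\<close>

text \<open>Two quantifiers shape the proof. First, the supremum of the hitting times exceeds a
  horizon as soon as one N, possibly depending on the path, keeps u_N above 1/N. The bad events for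
  different N concern unrelated fields, but at grid level j they share the bound \<open>b j\<close>
  with \<open>b\<close> summable; hence the event that every k fails lies, for each k, in a set of
  probability at most the tail of \<open>b\<close> from k on. Second, the mild equation holds almost
  surely only for each fixed point. It is therefore used on the countable dyadic grid, and the path
  minus its initial and drift parts, a continuous function, carries the oscillation bound to all
  points. The drift is bounded by a power of N; that bound serves continuity alone, while the
  estimates use only its monotonicity and a lower bound for its growth.

  The sub-Gaussian bound rests on the identity E exp(c I - c^2 Q / 2) = 1 for simple integrals I
  with quadratic variation Q. The rectangles of a simple integrand may overlap, so their noises need
  not be independent; this is why finite families of sets are cut into atoms.\<close>

lemma Int_stable_vimages: "Int_stable {f -` B \<inter> \<Omega> | B. B \<in> sets N}"
proof (rule Int_stableI, safe)
  fix B B' assume "B \<in> sets N" "B' \<in> sets N"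
  then show "\<exists>B''. f -` B \<inter> \<Omega> \<inter> (f -` B' \<inter> \<Omega>) = f -` B'' \<inter> \<Omega> \<and> B'' \<in> sets N"
    by (intro exI[of _ "B \<inter> B'"]) auto
qed

locale white_noise_space = prob_space M for M :: "'a measure" +
  fixes J :: real and W :: "(real \<times> real) set \<Rightarrow> 'a \<Rightarrow> real"
  assumes white_noise: "white_noise M J W"
begin

definition noise_events :: "(real \<times> real) set \<Rightarrow> 'a set set" where
  "noise_events C = {W A -` B \<inter> space M | A B. wn_set J A \<and> A \<subseteq> C \<and> B \<in> sets borel}"

definition noise_algebra :: "(real \<times> real) set \<Rightarrow> 'a measure" where
  "noise_algebra C = sigma (space M) (noise_events C)"

lemma W_measurable [measurable]: "wn_set J A \<Longrightarrow> W A \<in> borel_measurable M"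
  using white_noise unfolding white_noise_def by blast

lemma W_null: "wn_set J A \<Longrightarrow> measure lborel A = 0 \<Longrightarrow> AE \<omega> in M. W A \<omega> = 0"
  using white_noise unfolding white_noise_def by blast

lemma W_distributed: "wn_set J A \<Longrightarrow> measure lborel A > 0 \<Longrightarrow>
    distributed M lborel (W A) (normal_density 0 (sqrt (measure lborel A)))"
  using white_noise unfolding white_noise_def by blast

lemma W_Un: "wn_set J A \<Longrightarrow> wn_set J B \<Longrightarrow> A \<inter> B = {} \<Longrightarrow>
    AE \<omega> in M. W (A \<union> B) \<omega> = W A \<omega> + W B \<omega>"
  using white_noise unfolding white_noise_def by blast

lemma wn_set_empty [simp]: "wn_set J {}"
  by (simp add: wn_set_def)

lemma wn_set_Un: "wn_set J A \<Longrightarrow> wn_set J B \<Longrightarrow> wn_set J (A \<union> B)"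
  using emeasure_subadditive[of A lborel B]
  by (auto simp: wn_set_def intro: le_less_trans)

lemma wn_set_subset: "wn_set J A \<Longrightarrow> B \<in> sets lborel \<Longrightarrow> B \<subseteq> A \<Longrightarrow> wn_set J B"
  using emeasure_mono[of B A lborel] by (auto simp: wn_set_def intro: le_less_trans)

lemma wn_set_UN: "finite I \<Longrightarrow> (\<And>i. i \<in> I \<Longrightarrow> wn_set J (A i)) \<Longrightarrow> wn_set J (\<Union>i\<in>I. A i)"
  by (induction I rule: finite_induct) (auto intro: wn_set_Un)

lemma wn_set_rectangle:
  assumes "0 \<le> a" "B \<in> sets lborel" "B \<subseteq> {0..<J}"
  shows "wn_set J ({a<..b} \<times> B)"
proof -
  have "{a<..b} \<times> B \<in> sets (borel \<Otimes>\<^sub>M borel)" using assms by auto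
  then have meas: "{a<..b} \<times> B \<in> sets lborel" by (simp add: borel_prod[symmetric])
  have "{a<..b} \<times> B \<subseteq> cbox (a, 0) (b, J)" using assms by (auto simp: cbox_Pair_eq subset_iff)
  then have "emeasure lborel ({a<..b} \<times> B) \<le> emeasure lborel (cbox (a, 0) (b, J))"
    by (intro emeasure_mono) auto
  also have "\<dots> < \<infinity>" by (simp add: emeasure_lborel_cbox_eq)
  finally show ?thesis using meas assms by (auto simp: wn_set_def)
qed

lemma W_UN:
  assumes "finite I" "\<And>i. i \<in> I \<Longrightarrow> wn_set J (A i)" "disjoint_family_on A I"
  shows "AE \<omega> in M. W (\<Union>i\<in>I. A i) \<omega> = (\<Sum>i\<in>I. W (A i) \<omega>)"
  using assms
proof (induction I rule: finite_induct)
  case empty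
  then show ?case using W_null[of "{}"] by simp
next
  case (insert i I)
  have "A i \<inter> (\<Union>j\<in>I. A j) = {}"
    using insert.prems(2) insert.hyps(2) by (fastforce simp: disjoint_family_on_def)
  then have "AE \<omega> in M. W (A i \<union> (\<Union>j\<in>I. A j)) \<omega> = W (A i) \<omega> + W (\<Union>j\<in>I. A j) \<omega>"
    using insert by (intro W_Un wn_set_UN) auto
  moreover have "AE \<omega> in M. W (\<Union>i\<in>I. A i) \<omega> = (\<Sum>i\<in>I. W (A i) \<omega>)"
    using insert by (intro insert.IH) (auto simp: disjoint_family_on_def)
  ultimately show ?case
    by eventually_elim (use insert.hyps in simp)
qed

text \<open>White noise is defined through families indexed by \<open>{..<n}\<close>, whereas atoms
  are indexed by sets of indices; independence is transported along a bijection.\<close>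

lemma W_indep_vars:
  assumes "finite I" "\<And>i. i \<in> I \<Longrightarrow> wn_set J (A i)" "disjoint_family_on A I"
  shows "indep_vars (\<lambda>_. borel) (\<lambda>i. W (A i)) I"
proof -
  obtain h where h: "bij_betw h I {..<card I}"
    using ex_bij_betw_finite_nat[OF assms(1)] by (auto simp: atLeast0LessThan)
  define A' where "A' = (\<lambda>k. A (inv_into I h k))"
  have inv: "inv_into I h (h i) = i" if "i \<in> I" for i
    using h that by (simp add: bij_betw_def)
  have mem: "inv_into I h k \<in> I" if "k < card I" for k
    using h that by (metis bij_betw_def inv_into_into lessThan_iff)
  have inj: "inj_on (inv_into I h) {..<card I}"
    using h by (metis bij_betw_def inj_on_inv_into subset_refl)
  have "disjoint_family_on A' {..<card I}"
    unfolding disjoint_family_on_def A'_def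
  proof safe
    fix m n x assume mn: "m < card I" "n < card I" "m \<noteq> n"
      and x: "x \<in> A (inv_into I h m)" "x \<in> A (inv_into I h n)"
    have "inv_into I h m \<noteq> inv_into I h n" using inj mn by (auto dest: inj_onD)
    with x mem mn assms(3) show "x \<in> {}" by (fastforce simp: disjoint_family_on_def)
  qed
  moreover have "\<forall>k<card I. wn_set J (A' k)" using mem assms(2) by (auto simp: A'_def)
  ultimately have "indep_vars (\<lambda>_. borel) (\<lambda>k. W (A' k)) (h ` I)"
    using white_noise bij_betw_imp_surj_on[OF h] unfolding white_noise_def by auto
  then have ind: "indep_sets (\<lambda>k. {W (A' k) -` B \<inter> space M | B. B \<in> sets borel}) (h ` I)"
    unfolding indep_vars_def2 by simp
  have "indep_sets (\<lambda>i. {W (A i) -` B \<inter> space M | B. B \<in> sets borel}) I"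
  proof (rule indep_setsI)
    show "{W (A i) -` B \<inter> space M | B. B \<in> sets borel} \<subseteq> events" if "i \<in> I" for i
      using assms(2)[OF that] by auto
    fix E K assume K: "K \<noteq> {}" "K \<subseteq> I" "finite K"
      and E: "\<forall>i\<in>K. E i \<in> {W (A i) -` B \<inter> space M | B. B \<in> sets borel}"
    let ?E = "\<lambda>k. E (inv_into I h k)"
    have inv_K: "inv_into I h (h i) = i" if "i \<in> K" for i using that K inv by auto
    have "prob (\<Inter>k\<in>h ` K. ?E k) = (\<Prod>k\<in>h ` K. prob (?E k))"
      by (rule indep_setsD[OF ind]) (use K E in \<open>auto simp: A'_def inv_K\<close>)
    moreover have "inj_on h K" using h K by (auto simp: bij_betw_def intro: inj_on_subset)
    ultimately show "prob (\<Inter>i\<in>K. E i) = (\<Prod>i\<in>K. prob (E i))"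
      by (simp add: prod.reindex inv_K cong: INF_cong)
  qed
  then show ?thesis unfolding indep_vars_def2 using assms(2) by auto
qed

text \<open>The cells of the Venn diagram of the family, indexed by the members that contain the
  cell. The cell of \<open>{}\<close> is the complement of the union and leaves the domain of the
  noise, so the noise is evaluated only on cells of nonempty \<open>S\<close>.\<close>

definition atom :: "'i set \<Rightarrow> ('i \<Rightarrow> (real \<times> real) set) \<Rightarrow> 'i set \<Rightarrow> (real \<times> real) set" where
  "atom I A S = {z. {i \<in> I. z \<in> A i} = S}"

lemma atom_props:
  assumes "finite I" "\<forall>i\<in>I. wn_set J (A i)"
  shows "disjoint_family_on (atom I A) F"
    and "S \<subseteq> I \<Longrightarrow> S \<noteq> {} \<Longrightarrow> wn_set J (atom I A S)"
    and "i \<in> I \<Longrightarrow> A i = (\<Union>S\<in>{S. S \<subseteq> I \<and> i \<in> S}. atom I A S)"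
    and "i \<in> S \<Longrightarrow> atom I A S \<subseteq> A i"
proof -
  show "disjoint_family_on (atom I A) F" by (auto simp: disjoint_family_on_def atom_def)
  show sub: "atom I A S \<subseteq> A i" if "i \<in> S" for i S using that by (auto simp: atom_def)
  show "A i = (\<Union>S\<in>{S. S \<subseteq> I \<and> i \<in> S}. atom I A S)" if "i \<in> I"
    using that by (auto simp: atom_def)
  show "wn_set J (atom I A S)" if S: "S \<subseteq> I" "S \<noteq> {}"
  proof -
    obtain i where i: "i \<in> S" using S by auto
    have "atom I A S = (\<Inter>i\<in>S. A i) - (\<Union>i\<in>I - S. A i)"
      using S by (auto simp: atom_def)
    moreover have "(\<Inter>i\<in>S. A i) \<in> sets lborel"
      using S assms by (intro sets.finite_INT) (auto simp: wn_set_def intro: finite_subset)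
    moreover have "(\<Union>i\<in>I - S. A i) \<in> sets lborel"
      using S assms by (intro sets.finite_UN) (auto simp: wn_set_def)
    ultimately have "atom I A S \<in> sets lborel" by auto
    then show ?thesis using wn_set_subset[of "A i"] sub[OF i] i S assms(2) by auto
  qed
qed

lemma W_atoms:
  assumes "finite I" "\<forall>i\<in>I. wn_set J (A i)"
  shows "AE \<omega> in M. \<forall>i\<in>I. W (A i) \<omega> = (\<Sum>S | S \<subseteq> I \<and> i \<in> S. W (atom I A S) \<omega>)"
proof (rule AE_finite_allI[OF assms(1)])
  fix i assume i: "i \<in> I"
  have "AE \<omega> in M. W (\<Union>S\<in>{S. S \<subseteq> I \<and> i \<in> S}. atom I A S) \<omega> = (\<Sum>S | S \<subseteq> I \<and> i \<in> S. W (atom I A S) \<omega>)"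
    using assms by (intro W_UN atom_props(1)[OF assms] atom_props(2)[OF assms]) auto
  then show "AE \<omega> in M. W (A i) \<omega> = (\<Sum>S | S \<subseteq> I \<and> i \<in> S. W (atom I A S) \<omega>)"
    using atom_props(3)[OF assms i] by simp
qed

section \<open>Sigma-algebras generated by the noise on a region\<close>

lemma noise_events_sub: "noise_events C \<subseteq> Pow (space M)"
  by (auto simp: noise_events_def)

lemma space_noise_algebra [simp]: "space (noise_algebra C) = space M"
  by (simp add: noise_algebra_def noise_events_sub)

lemma sets_noise_algebra: "sets (noise_algebra C) = sigma_sets (space M) (noise_events C)"
  by (simp add: noise_algebra_def noise_events_sub)

lemma noise_algebra_mono: "C \<subseteq> D \<Longrightarrow> sets (noise_algebra C) \<subseteq> sets (noise_algebra D)"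
  unfolding sets_noise_algebra
  by (rule sigma_sets_mono') (auto simp: noise_events_def)

lemma noise_algebra_sub: "sets (noise_algebra C) \<subseteq> sets M"
  unfolding sets_noise_algebra
  by (rule sets.sigma_sets_subset) (auto simp: noise_events_def)

lemma measurable_noise_algebra_mono:
  "f \<in> measurable (noise_algebra C) N \<Longrightarrow> C \<subseteq> D \<Longrightarrow> f \<in> measurable (noise_algebra D) N"
  using noise_algebra_mono[of C D] by (auto simp: measurable_def)

lemma measurable_noise_algebra:
  "f \<in> measurable (noise_algebra C) N \<Longrightarrow> f \<in> measurable M N"
  using noise_algebra_sub[of C] by (auto simp: measurable_def)

lemma W_measurable_noise_algebra:
  assumes "wn_set J A" "A \<subseteq> C"
  shows "W A \<in> borel_measurable (noise_algebra C)"
proof (rule measurableI)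
  fix B :: "real set" assume "B \<in> sets borel"
  then show "W A -` B \<inter> space (noise_algebra C) \<in> sets (noise_algebra C)"
    using assms unfolding sets_noise_algebra space_noise_algebra
    by (intro sigma_sets.Basic) (auto simp: noise_events_def)
qed simp

lemma wn_filtration_eq: "wn_filtration M J W t = noise_algebra ({0..t} \<times> {0..<J})"
  by (simp add: wn_filtration_def noise_algebra_def noise_events_def)

text \<open>The generator of the algebra is not stable under intersection, so independence is shown
  for finite intersections; the atoms of the sets involved reduce this to disjoint sets.\<close>

lemma indep_noise_algebra:
  assumes R: "wn_set J R" "R \<inter> C = {}"
  shows "indep_set (sets (noise_algebra C)) {W R -` B \<inter> space M | B. B \<in> sets borel}"
proof -
  define P where "P = {space M \<inter> (\<Inter>i\<in>{..<n::nat}. W (A i) -` B i) | n A B.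
      \<forall>i<n. wn_set J (A i) \<and> A i \<subseteq> C \<and> B i \<in> sets borel}"
  have P_sets: "P \<subseteq> sets M"
  proof
    fix E assume "E \<in> P"
    then obtain n :: nat and A B where E: "E = space M \<inter> (\<Inter>i\<in>{..<n}. W (A i) -` B i)"
      and AB: "\<forall>i<n. wn_set J (A i) \<and> A i \<subseteq> C \<and> B i \<in> sets borel" by (auto simp: P_def)
    have "E = {\<omega> \<in> space M. \<forall>i\<in>{..<n}. W (A i) \<omega> \<in> B i}" by (auto simp: E)
    also have "\<dots> \<in> sets M"
    proof (intro sets.sets_Collect_finite_All)
      fix i assume "i \<in> {..<n}"
      then have "W (A i) -` B i \<inter> space M \<in> sets M" using AB by (intro measurable_sets[of _ M borel]) auto
      then show "{\<omega> \<in> space M. W (A i) \<omega> \<in> B i} \<in> sets M" by (simp add: vimage_def Int_def conj_commute)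
    qed simp
    finally show "E \<in> sets M" .
  qed
  have P_stable: "Int_stable P"
  proof (rule Int_stableI)
    fix E F assume "E \<in> P" "F \<in> P"
    then obtain n :: nat and A B and m :: nat and A' B' where
      E: "E = space M \<inter> (\<Inter>i\<in>{..<n}. W (A i) -` B i)" "\<forall>i<n. wn_set J (A i) \<and> A i \<subseteq> C \<and> B i \<in> sets borel"
      and F: "F = space M \<inter> (\<Inter>i\<in>{..<m}. W (A' i) -` B' i)" "\<forall>i<m. wn_set J (A' i) \<and> A' i \<subseteq> C \<and> B' i \<in> sets borel"
      unfolding P_def by blast
    define A'' where "A'' i = (if i < n then A i else A' (i - n))" for i
    define B'' where "B'' i = (if i < n then B i else B' (i - n))" for i
    have "(\<Inter>i\<in>{..<n+m}. W (A'' i) -` B'' i) = (\<Inter>i\<in>{..<n}. W (A i) -` B i) \<inter> (\<Inter>i\<in>{..<m}. W (A' i) -` B' i)"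
    proof (intro equalityI subsetI)
      fix z assume z: "z \<in> (\<Inter>i\<in>{..<n+m}. W (A'' i) -` B'' i)"
      have "z \<in> W (A i) -` B i" if "i < n" for i
        using INT_D[OF z, of i] that by (simp add: A''_def B''_def)
      moreover have "z \<in> W (A' i) -` B' i" if "i < m" for i
        using INT_D[OF z, of "n + i"] that by (simp add: A''_def B''_def)
      ultimately show "z \<in> (\<Inter>i\<in>{..<n}. W (A i) -` B i) \<inter> (\<Inter>i\<in>{..<m}. W (A' i) -` B' i)" by auto
    qed (auto simp: A''_def B''_def)
    moreover have "\<forall>i<n+m. wn_set J (A'' i) \<and> A'' i \<subseteq> C \<and> B'' i \<in> sets borel"
      using E(2) F(2) by (auto simp: A''_def B''_def)
    moreover have "E \<inter> F = space M \<inter> ((\<Inter>i\<in>{..<n}. W (A i) -` B i) \<inter> (\<Inter>i\<in>{..<m}. W (A' i) -` B' i))"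
      using E(1) F(1) by auto
    ultimately show "E \<inter> F \<in> P" unfolding P_def
      by (intro CollectI exI[of _ "n + m"] exI[of _ A''] exI[of _ B'']) simp
  qed
  define V where "V = {W R -` B \<inter> space M | B. B \<in> sets borel}"
  have V_stable: "Int_stable V"
    unfolding V_def by (rule Int_stable_vimages)
  have "indep_set P V"
  proof (rule indep_setI)
    show "P \<subseteq> events" by (fact P_sets)
    show "V \<subseteq> events" using R by (auto simp: V_def)
    fix E F assume "E \<in> P" "F \<in> V"
    then obtain n :: nat and A B and D where
      E: "E = space M \<inter> (\<Inter>i\<in>{..<n}. W (A i) -` B i)"
      and AB: "\<And>i. i < n \<Longrightarrow> wn_set J (A i)" "\<And>i. i < n \<Longrightarrow> A i \<subseteq> C" "\<And>i. i < n \<Longrightarrow> B i \<in> sets borel"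
      and F: "F = W R -` D \<inter> space M" and D: "D \<in> sets borel"
      unfolding P_def V_def by blast
    define I where "I = {..<n}"
    define Q where "Q = Pow I - {{}}"
    \<comment> \<open>The index \<open>{}\<close> is free because \<open>Q\<close> omits it. Giving
      it to \<open>R\<close> puts \<open>R\<close> and the atoms into one disjoint family.\<close>
    define T where "T S = (if S = {} then R else atom I A S)" for S
    have fin: "finite I" "finite Q" by (auto simp: I_def Q_def)
    have AI: "\<forall>i\<in>I. wn_set J (A i)" by (auto simp: I_def AB)
    note atom = atom_props[OF fin(1) AI]
    have "atom I A S \<inter> R = {}" if "S \<in> Q" for S
    proof -
      have "S \<noteq> {}" using that by (simp add: Q_def)
      then obtain i where "i \<in> S" by blast
      then have "i < n" using that by (auto simp: Q_def I_def)
      then show ?thesis using \<open>i \<in> S\<close> atom(4)[of i S] AB(2)[of i] R(2) by blast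
    qed
    then have disj: "disjoint_family_on T (insert {} Q)"
      using atom(1)[of Q] by (auto simp: disjoint_family_on_def T_def)
    have "indep_vars (\<lambda>_. borel) (\<lambda>S. W (T S)) (insert {} Q)"
      using R(1) fin(2) atom(2) by (intro W_indep_vars disj) (auto simp: T_def Q_def)
    then have "indep_var (PiM Q (\<lambda>_. borel)) (\<lambda>\<omega>. restrict (\<lambda>S. W (T S) \<omega>) Q)
        (PiM {{}} (\<lambda>_. borel)) (\<lambda>\<omega>. restrict (\<lambda>S. W (T S) \<omega>) {{}})"
      by (rule indep_var_restrict) (auto simp: Q_def)
    then have ind: "prob ((\<lambda>\<omega>. restrict (\<lambda>S. W (T S) \<omega>) Q) -` X \<inter> space M \<inter>
         ((\<lambda>\<omega>. restrict (\<lambda>S. W (T S) \<omega>) {{}}) -` Y \<inter> space M)) =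
        prob ((\<lambda>\<omega>. restrict (\<lambda>S. W (T S) \<omega>) Q) -` X \<inter> space M) *
        prob ((\<lambda>\<omega>. restrict (\<lambda>S. W (T S) \<omega>) {{}}) -` Y \<inter> space M)"
      if "X \<in> sets (PiM Q (\<lambda>_. borel))" "Y \<in> sets (PiM {{}} (\<lambda>_. borel))" for X Y
      using that unfolding indep_var_eq
      by (blast intro!: indep_setD sigma_sets.Basic)
    \<comment> \<open>\<open>W (A i)\<close> is the sum over its atoms only up to a null set, so
      \<open>E\<close> is exchanged for an event in terms of the atoms that has the same
      probability.\<close>
    define X where "X = {w \<in> space (PiM Q (\<lambda>_. borel :: real measure)). \<forall>i\<in>I. (\<Sum>S | S \<subseteq> I \<and> i \<in> S. w S) \<in> B i}"
    define Y where "Y = {w \<in> space (PiM {{} :: nat set} (\<lambda>_. borel :: real measure)). w {} \<in> D}"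
    have X: "X \<in> sets (PiM Q (\<lambda>_. borel))"
      unfolding X_def
    proof (intro sets.sets_Collect_finite_All fin(1))
      fix i assume "i \<in> I"
      have "(\<lambda>w. \<Sum>S | S \<subseteq> I \<and> i \<in> S. w S) \<in> borel_measurable (PiM Q (\<lambda>_. borel :: real measure))"
        by (intro borel_measurable_sum measurable_component_singleton) (auto simp: Q_def)
      from measurable_sets[OF this AB(3)[of i]] \<open>i \<in> I\<close>
      show "{w \<in> space (PiM Q (\<lambda>_. borel :: real measure)). (\<Sum>S | S \<subseteq> I \<and> i \<in> S. w S) \<in> B i} \<in> sets (PiM Q (\<lambda>_. borel))"
        by (simp add: I_def vimage_def Int_def conj_commute)
    qed
    have Y: "Y \<in> sets (PiM {{}} (\<lambda>_. borel))"
    proof -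
      have "(\<lambda>w. w {}) \<in> borel_measurable (PiM {{} :: nat set} (\<lambda>_. borel :: real measure))"
        by (intro measurable_component_singleton) auto
      from measurable_sets[OF this D] show ?thesis
        by (simp add: Y_def vimage_def Int_def conj_commute)
    qed
    let ?E' = "(\<lambda>\<omega>. restrict (\<lambda>S. W (T S) \<omega>) Q) -` X \<inter> space M"
    have F': "(\<lambda>\<omega>. restrict (\<lambda>S. W (T S) \<omega>) {{}}) -` Y \<inter> space M = F"
      by (auto simp: Y_def F T_def space_PiM)
    have E'_iff: "\<omega> \<in> ?E' \<longleftrightarrow> (\<forall>i\<in>I. (\<Sum>S | S \<subseteq> I \<and> i \<in> S. W (atom I A S) \<omega>) \<in> B i)"
      if "\<omega> \<in> space M" for \<omega>
    proof -
      have "(\<Sum>S | S \<subseteq> I \<and> i \<in> S. restrict (\<lambda>S. W (T S) \<omega>) Q S) = (\<Sum>S | S \<subseteq> I \<and> i \<in> S. W (atom I A S) \<omega>)"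
        if "i \<in> I" for i
        by (intro sum.cong) (auto simp: T_def Q_def)
      then show ?thesis using that by (auto simp: X_def space_PiM)
    qed
    have rv: "(\<lambda>\<omega>. restrict (\<lambda>S. W (T S) \<omega>) Q) \<in> measurable M (PiM Q (\<lambda>_. borel))"
      using atom(2) by (intro measurable_restrict) (auto simp: T_def Q_def)
    have E'_sets: "?E' \<in> sets M" using measurable_sets[OF rv X] .
    have ae: "AE \<omega> in M. \<omega> \<in> E \<longleftrightarrow> \<omega> \<in> ?E'"
      using W_atoms[OF fin(1) AI] AE_space
    proof eventually_elim
      case (elim \<omega>)
      then show ?case using E'_iff[of \<omega>] by (auto simp: E I_def)
    qed
    have "E \<in> sets M" "F \<in> sets M" using \<open>E \<in> P\<close> P_sets \<open>F \<in> V\<close> R by (auto simp: V_def)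
    have "prob E = prob ?E'"
      using ae \<open>E \<in> sets M\<close> E'_sets by (intro finite_measure_eq_AE) auto
    moreover have "prob (E \<inter> F) = prob (?E' \<inter> F)"
      using ae \<open>E \<in> sets M\<close> \<open>F \<in> sets M\<close> E'_sets by (intro finite_measure_eq_AE) auto
    ultimately show "prob (E \<inter> F) = prob E * prob F"
      using ind[OF X Y] unfolding F' by simp
  qed
  then have ind: "indep_set (sigma_sets (space M) P) (sigma_sets (space M) V)"
    by (rule indep_set_sigma_sets) (fact P_stable V_stable)+
  have "noise_events C \<subseteq> P"
  proof
    fix E assume "E \<in> noise_events C"
    then obtain A B where "E = W A -` B \<inter> space M" "wn_set J A" "A \<subseteq> C" "B \<in> sets borel"
      by (auto simp: noise_events_def)
    then show "E \<in> P" unfolding P_def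
      by (intro CollectI exI[of _ "Suc 0"] exI[of _ "\<lambda>_. A"] exI[of _ "\<lambda>_. B"]) auto
  qed
  then have sub: "sets (noise_algebra C) \<subseteq> sigma_sets (space M) P"
    unfolding sets_noise_algebra by (rule sigma_sets_mono')
  have "V \<subseteq> sigma_sets (space M) V" by auto
  with ind sub show ?thesis
    unfolding indep_set_def V_def[symmetric]
    by (elim indep_sets_mono_sets) (auto split: bool.split)
qed

end

section \<open>Exponential moments of simple integrals\<close>

text \<open>Completing the square: the exponential factor turns the centred density into the normal
  density with mean \<open>c * \<sigma>\<^sup>2\<close>.\<close>

lemma nn_integral_normal_mgf:
  assumes "\<sigma> > 0"
  shows "(\<integral>\<^sup>+x. ennreal (normal_density 0 \<sigma> x) * ennreal (exp (c * x - c\<^sup>2 * \<sigma>\<^sup>2 / 2)) \<partial>lborel) = 1"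
proof -
  have eq: "normal_density 0 \<sigma> x * exp (c * x - c\<^sup>2 * \<sigma>\<^sup>2 / 2) = normal_density (c * \<sigma>\<^sup>2) \<sigma> x" for x
  proof -
    have "- (x\<^sup>2) / (2 * \<sigma>\<^sup>2) + (c * x - c\<^sup>2 * \<sigma>\<^sup>2 / 2) = - (x - c * \<sigma>\<^sup>2)\<^sup>2 / (2 * \<sigma>\<^sup>2)"
      using assms by (simp add: field_simps power2_eq_square)
    then show ?thesis by (simp add: normal_density_def exp_add[symmetric])
  qed
  have "(\<integral>\<^sup>+x. ennreal (normal_density 0 \<sigma> x) * ennreal (exp (c * x - c\<^sup>2 * \<sigma>\<^sup>2 / 2)) \<partial>lborel)
      = (\<integral>\<^sup>+x. ennreal (normal_density (c * \<sigma>\<^sup>2) \<sigma> x) \<partial>lborel)"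
    using assms by (simp add: ennreal_mult[symmetric] eq)
  also have "\<dots> = ennreal (\<integral>x. normal_density (c * \<sigma>\<^sup>2) \<sigma> x \<partial>lborel)"
    using assms by (intro nn_integral_eq_integral integrable_normal_density) auto
  finally show ?thesis using assms by simp
qed

context white_noise_space
begin

lemma W_mgf:
  assumes R: "wn_set J R"
  shows "(\<integral>\<^sup>+\<omega>. ennreal (exp (c * W R \<omega> - c\<^sup>2 * measure lborel R / 2)) \<partial>M) = 1"
proof (cases "measure lborel R = 0")
  case True
  have "(\<integral>\<^sup>+\<omega>. ennreal (exp (c * W R \<omega> - c\<^sup>2 * measure lborel R / 2)) \<partial>M) = (\<integral>\<^sup>+\<omega>. 1 \<partial>M)"
    by (rule nn_integral_cong_AE) (use W_null[OF R True] True in auto)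
  then show ?thesis by (simp add: emeasure_space_1)
next
  case False
  then have pos: "measure lborel R > 0" by (simp add: less_le)
  define \<sigma> where "\<sigma> = sqrt (measure lborel R)"
  have \<sigma>: "\<sigma> > 0" "\<sigma>\<^sup>2 = measure lborel R" using pos by (auto simp: \<sigma>_def)
  have "(\<integral>\<^sup>+x. ennreal (normal_density 0 \<sigma> x) * ennreal (exp (c * x - c\<^sup>2 * \<sigma>\<^sup>2 / 2)) \<partial>lborel)
    = (\<integral>\<^sup>+\<omega>. ennreal (exp (c * W R \<omega> - c\<^sup>2 * \<sigma>\<^sup>2 / 2)) \<partial>M)"
    using W_distributed[OF R pos] by (intro distributed_nn_integral) (auto simp: \<sigma>_def)
  then show ?thesis using nn_integral_normal_mgf[OF \<sigma>(1)] by (simp add: \<sigma>)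
qed

text \<open>One conditioning step. \<open>Z\<close> and \<open>Y\<close> are determined by the noise
  on \<open>C\<close> and \<open>W R\<close> is independent of it, so integrating out
  \<open>W R\<close> first, with the other two frozen, leaves a factor 1. With nonnegative
  integrands this is Tonelli, even for unbounded \<open>Y\<close>.\<close>

lemma exp_noise_step:
  assumes R: "wn_set J R" "R \<inter> C = {}"
    and Z: "Z \<in> borel_measurable (noise_algebra C)" "\<And>\<omega>. Z \<omega> \<ge> 0"
    and Y: "Y \<in> borel_measurable (noise_algebra C)"
  shows "(\<integral>\<^sup>+\<omega>. ennreal (Z \<omega> * exp (Y \<omega> * W R \<omega> - (Y \<omega>)\<^sup>2 * measure lborel R / 2)) \<partial>M) = (\<integral>\<^sup>+\<omega>. ennreal (Z \<omega>) \<partial>M)"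
proof -
  define m where "m = measure lborel R"
  define X where "X = (\<lambda>\<omega>. (Z \<omega>, Y \<omega>))"
  \<comment> \<open>\<open>indep_var\<close> requires both variables to take values in one type; the
    second coordinate is a dummy.\<close>
  define V where "V = (\<lambda>\<omega>. (W R \<omega>, 0::real))"
  define \<Phi> :: "(real \<times> real) \<times> (real \<times> real) \<Rightarrow> ennreal"
    where "\<Phi> = (\<lambda>(x, v). ennreal (fst x) * ennreal (exp (snd x * fst v - (snd x)\<^sup>2 * m / 2)))"
  have XC: "X \<in> borel_measurable (noise_algebra C)" unfolding X_def using Z Y by measurable
  have X[measurable]: "X \<in> borel_measurable M" by (rule measurable_noise_algebra[OF XC])
  have WR[measurable]: "W R \<in> borel_measurable M" using R by simp
  have V[measurable]: "V \<in> borel_measurable M" unfolding V_def by measurable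
  have indep: "indep_set (sigma_sets (space M) (sets (noise_algebra C)))
      (sigma_sets (space M) {W R -` B \<inter> space M | B. B \<in> sets borel})"
  proof (rule indep_set_sigma_sets[OF indep_noise_algebra[OF R]])
    show "Int_stable (sets (noise_algebra C))" by (rule sets.Int_stable)
    show "Int_stable {W R -` B \<inter> space M | B. B \<in> sets borel}" by (rule Int_stable_vimages)
  qed
  have "indep_var borel X borel V"
    unfolding indep_var_eq
  proof (intro conjI X V)
    have "{X -` A \<inter> space M | A. A \<in> sets borel} \<subseteq> sets (noise_algebra C)"
      using measurable_sets[OF XC] by auto
    moreover have "{V -` A \<inter> space M | A. A \<in> sets borel} \<subseteq> {W R -` B \<inter> space M | B. B \<in> sets borel}"
    proof safe
      fix A :: "(real \<times> real) set" assume "A \<in> sets borel"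
      moreover have "(\<lambda>w. (w, 0::real)) \<in> borel_measurable (borel :: real measure)" by measurable
      ultimately have "(\<lambda>w. (w, 0::real)) -` A \<in> sets (borel :: real measure)"
        using measurable_sets[of "\<lambda>w. (w, 0::real)" borel borel A] by simp
      then show "\<exists>B. V -` A \<inter> space M = W R -` B \<inter> space M \<and> B \<in> sets borel"
        by (intro exI[of _ "(\<lambda>w. (w, 0::real)) -` A"]) (auto simp: V_def)
    qed
    ultimately show "indep_set (sigma_sets (space M) {X -` A \<inter> space M | A. A \<in> sets borel})
       (sigma_sets (space M) {V -` A \<inter> space M | A. A \<in> sets borel})"
      using indep sigma_sets_mono'[of "{X -` A \<inter> space M | A. A \<in> sets borel}"]
        sigma_sets_mono'[of "{V -` A \<inter> space M | A. A \<in> sets borel}"]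
      unfolding indep_set_def by (elim indep_sets_mono_sets) (auto split: bool.split)
  qed
  then have prod: "distr M borel X \<Otimes>\<^sub>M distr M borel V = distr M (borel \<Otimes>\<^sub>M borel) (\<lambda>\<omega>. (X \<omega>, V \<omega>))"
    by (simp add: indep_var_distribution_eq)
  have \<Phi>[measurable]: "\<Phi> \<in> borel_measurable (borel \<Otimes>\<^sub>M borel)"
    unfolding \<Phi>_def split_beta borel_prod[symmetric] by measurable
  have fst_m: "fst \<in> borel_measurable (borel :: (real \<times> real) measure)"
    by (simp add: borel_prod[symmetric])
  interpret V: prob_space "distr M borel V" by (rule prob_space_distr) simp
  have inner: "(\<integral>\<^sup>+\<omega>. \<Phi> (x, V \<omega>) \<partial>M) = ennreal (fst x)" for x
  proof -
    have "(\<integral>\<^sup>+\<omega>. \<Phi> (x, V \<omega>) \<partial>M) = ennreal (fst x) * (\<integral>\<^sup>+\<omega>. ennreal (exp (snd x * W R \<omega> - (snd x)\<^sup>2 * m / 2)) \<partial>M)"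
      unfolding \<Phi>_def V_def by (simp add: nn_integral_cmult)
    then show ?thesis using W_mgf[OF R(1)] by (simp add: m_def)
  qed
  have "(\<integral>\<^sup>+\<omega>. ennreal (Z \<omega> * exp (Y \<omega> * W R \<omega> - (Y \<omega>)\<^sup>2 * m / 2)) \<partial>M) = (\<integral>\<^sup>+\<omega>. \<Phi> (X \<omega>, V \<omega>) \<partial>M)"
    by (simp add: \<Phi>_def X_def V_def ennreal_mult Z)
  also have "\<dots> = (\<integral>\<^sup>+p. \<Phi> p \<partial>(distr M borel X \<Otimes>\<^sub>M distr M borel V))"
    unfolding prod by (subst nn_integral_distr) auto
  also have "\<dots> = (\<integral>\<^sup>+x. \<integral>\<^sup>+v. \<Phi> (x, v) \<partial>distr M borel V \<partial>distr M borel X)"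
    by (subst V.nn_integral_fst) (auto simp: measurable_distr_eq1 cong: measurable_cong_sets)
  also have "\<dots> = (\<integral>\<^sup>+x. ennreal (fst x) \<partial>distr M borel X)"
    by (subst nn_integral_distr) (auto simp: inner)
  also have "\<dots> = (\<integral>\<^sup>+\<omega>. ennreal (Z \<omega>) \<partial>M)"
    using fst_m by (subst nn_integral_distr[OF X]) (auto simp: X_def)
  finally show ?thesis by (simp add: m_def)
qed

text \<open>The index with the largest \<open>\<tau>\<close> is peeled off. All other factors are
  measurable for the noise on \<open>C\<close>, the strip up to that time together with the other
  regions. Those regions may reach past that time, so the strip alone would not do;
  \<open>R i\<close> avoids them by disjointness.\<close>

lemma exp_noise_sum:
  fixes \<tau> :: "'i \<Rightarrow> real"
  assumes "finite I" and R: "\<And>i. i \<in> I \<Longrightarrow> wn_set J (R i)" "disjoint_family_on R I"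
    and fut: "\<And>i. i \<in> I \<Longrightarrow> R i \<inter> ({0..\<tau> i} \<times> {0..<J}) = {}"
    and Y: "\<And>i. i \<in> I \<Longrightarrow> Y i \<in> borel_measurable (wn_filtration M J W (\<tau> i))"
  shows "(\<integral>\<^sup>+\<omega>. ennreal (exp ((\<Sum>i\<in>I. Y i \<omega> * W (R i) \<omega>) - (\<Sum>i\<in>I. (Y i \<omega>)\<^sup>2 * measure lborel (R i)) / 2)) \<partial>M) = 1"
  using assms
proof (induction I rule: finite_ranking_induct[where f = \<tau>])
  case empty
  then show ?case by (simp add: emeasure_space_1)
next
  case (insert i I)
  show ?case
  proof (cases "i \<in> I")
    case True
    then show ?thesis using insert by (simp add: insert_absorb)
  next
    case False
    define C where "C = {0..\<tau> i} \<times> {0..<J} \<union> (\<Union>j\<in>I. R j)"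
    define Z where "Z \<omega> = exp ((\<Sum>i\<in>I. Y i \<omega> * W (R i) \<omega>) - (\<Sum>i\<in>I. (Y i \<omega>)\<^sup>2 * measure lborel (R i)) / 2)" for \<omega>
    have "R i \<inter> (\<Union>j\<in>I. R j) = {}"
      using insert.prems(2) False by (fastforce simp: disjoint_family_on_def)
    then have RC: "R i \<inter> C = {}" using insert.prems(3)[of i] by (auto simp: C_def)
    have Ym: "Y j \<in> borel_measurable (noise_algebra C)" if "j \<in> insert i I" for j
    proof -
      have "{0..\<tau> j} \<times> {0..<J} \<subseteq> C" using insert.hyps(2) that by (fastforce simp: C_def)
      then show ?thesis
        using insert.prems(4)[OF that] unfolding wn_filtration_eq by (rule measurable_noise_algebra_mono[rotated])
    qed
    have Wm: "W (R j) \<in> borel_measurable (noise_algebra C)" if "j \<in> I" for j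
      using insert.prems(1) that by (intro W_measurable_noise_algebra) (auto simp: C_def)
    have Zm: "Z \<in> borel_measurable (noise_algebra C)"
      unfolding Z_def using Ym Wm
      by (intro measurable_compose[OF _ borel_measurable_exp] borel_measurable_diff borel_measurable_sum
          borel_measurable_times borel_measurable_divide borel_measurable_power) auto
    have "(\<integral>\<^sup>+\<omega>. ennreal (exp ((\<Sum>i\<in>insert i I. Y i \<omega> * W (R i) \<omega>) - (\<Sum>i\<in>insert i I. (Y i \<omega>)\<^sup>2 * measure lborel (R i)) / 2)) \<partial>M)
      = (\<integral>\<^sup>+\<omega>. ennreal (Z \<omega> * exp (Y i \<omega> * W (R i) \<omega> - (Y i \<omega>)\<^sup>2 * measure lborel (R i) / 2)) \<partial>M)"
      using insert.hyps(1) False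
      by (intro nn_integral_cong) (simp add: Z_def exp_add[symmetric] add_divide_distrib algebra_simps)
    also have "\<dots> = (\<integral>\<^sup>+\<omega>. ennreal (Z \<omega>) \<partial>M)"
      by (rule exp_noise_step[OF _ RC Zm]) (use insert.prems(1) Ym in \<open>auto simp: Z_def\<close>)
    also have "\<dots> = 1"
      unfolding Z_def using insert.prems by (intro insert.IH) (auto simp: disjoint_family_on_def)
    finally show ?thesis .
  qed
qed

text \<open>On the atom \<open>D S\<close> the integrand equals the random constant
  \<open>Y S\<close>, known at the latest left endpoint \<open>\<tau> S\<close>, and the atom lies
  strictly after that time. This reduces overlapping rectangles to the disjoint case.
  \<open>Q\<close> is the quadratic variation of the simple integral.\<close>

lemma exp_simple_int:
  assumes simple: "simple_pred M J W n a b B X"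
  obtains Q where "Q \<in> borel_measurable M" "\<And>\<omega>. Q \<omega> \<ge> 0"
    "\<And>\<omega>. (\<integral>\<^sup>+z\<in>{0..} \<times> {0..<J}. ennreal ((simple_fun n a b B X z \<omega>)\<^sup>2) \<partial>lborel) = ennreal (Q \<omega>)"
    "\<And>c. (\<integral>\<^sup>+\<omega>. ennreal (exp (c * simple_int W n a b B X \<omega> - c\<^sup>2 * Q \<omega> / 2)) \<partial>M) = 1"
proof -
  define I where "I = {..<n}"
  define R where "R i = {a i<..b i} \<times> B i" for i
  define F where "F = Pow I - {{}}"
  define D where "D = atom I R"
  define Y where "Y S \<omega> = (\<Sum>i\<in>S. X i \<omega>)" for S \<omega>
  define \<tau> where "\<tau> S = Max (a ` S)" for S
  define Q where "Q \<omega> = (\<Sum>S\<in>F. (Y S \<omega>)\<^sup>2 * measure lborel (D S))" for \<omega>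
  have fin: "finite I" "finite F" by (auto simp: I_def F_def)
  have X: "X i \<in> borel_measurable (wn_filtration M J W (a i))" if "i \<in> I" for i
    using simple that by (auto simp: simple_pred_def I_def)
  have RI: "\<forall>i\<in>I. wn_set J (R i)"
    using simple by (auto simp: simple_pred_def I_def R_def intro!: wn_set_rectangle)
  note atom = atom_props[OF fin(1) RI, folded D_def]
  have D: "wn_set J (D S)" if "S \<in> F" for S using that atom(2) by (auto simp: F_def)
  have finS: "finite S" if "S \<in> F" for S using that fin by (auto simp: F_def intro: finite_subset)
  have Ym: "Y S \<in> borel_measurable (wn_filtration M J W (\<tau> S))" if S: "S \<in> F" for S
    unfolding Y_def wn_filtration_eq
  proof (intro borel_measurable_sum)
    fix i assume i: "i \<in> S"
    then have "a i \<le> \<tau> S" using finS[OF S] by (auto simp: \<tau>_def)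
    moreover have "X i \<in> borel_measurable (noise_algebra ({0..a i} \<times> {0..<J}))"
      using X S i by (auto simp: F_def wn_filtration_eq)
    ultimately show "X i \<in> borel_measurable (noise_algebra ({0..\<tau> S} \<times> {0..<J}))"
      by (elim measurable_noise_algebra_mono) auto
  qed
  have fut: "D S \<inter> ({0..\<tau> S} \<times> {0..<J}) = {}" if S: "S \<in> F" for S
  proof -
    \<comment> \<open>The maximum is attained at some \<open>i\<close> in \<open>S\<close>; the atom
      lies in \<open>R i\<close>, whose time interval excludes its left endpoint, so it misses the
      closed strip.\<close>
    have "\<tau> S \<in> a ` S" unfolding \<tau>_def using S finS[OF S] by (intro Max_in) (auto simp: F_def)
    then obtain i where i: "i \<in> S" "\<tau> S = a i" by auto
    then show ?thesis using atom(4)[of i S] by (auto simp: R_def)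
  qed
  have swap: "(\<Sum>i\<in>I. \<Sum>S | S \<subseteq> I \<and> i \<in> S. f i S) = (\<Sum>S\<in>F. \<Sum>i\<in>S. f i S)" for f :: "nat \<Rightarrow> nat set \<Rightarrow> real"
  proof -
    have "(\<Sum>i\<in>I. \<Sum>S | S \<subseteq> I \<and> i \<in> S. f i S) = (\<Sum>i\<in>I. \<Sum>S | S \<in> F \<and> i \<in> S. f i S)"
      by (intro sum.cong) (auto simp: F_def)
    also have "\<dots> = (\<Sum>S\<in>F. \<Sum>i | i \<in> I \<and> i \<in> S. f i S)"
      by (rule sum.swap_restrict[OF fin])
    also have "\<dots> = (\<Sum>S\<in>F. \<Sum>i\<in>S. f i S)" by (intro sum.cong) (auto simp: F_def)
    finally show ?thesis .
  qed
  have indD: "indicator (R i) z = (\<Sum>S | S \<subseteq> I \<and> i \<in> S. indicator (D S) z :: real)" if "i \<in> I" for i z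
  proof -
    have *: "R i = (\<Union>S\<in>{S. S \<subseteq> I \<and> i \<in> S}. D S)" by (rule atom(3)) (use that in auto)
    show ?thesis unfolding *
      by (rule indicator_UN_disjoint) (use fin atom(1) in \<open>auto simp: atom(1)\<close>)
  qed
  have sf: "simple_fun n a b B X z \<omega> = (\<Sum>S\<in>F. Y S \<omega> * indicator (D S) z)" for z \<omega>
  proof -
    have "simple_fun n a b B X z \<omega> = (\<Sum>i\<in>I. X i \<omega> * indicator (R i) z)"
      unfolding simple_fun_def I_def R_def
      by (intro sum.cong) (auto simp: indicator_def mem_Times_iff)
    also have "\<dots> = (\<Sum>i\<in>I. \<Sum>S | S \<subseteq> I \<and> i \<in> S. X i \<omega> * indicator (D S) z)"
      by (intro sum.cong) (auto simp: indD sum_distrib_left)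
    finally show ?thesis unfolding swap by (simp add: Y_def sum_distrib_right)
  qed
  have sq: "(simple_fun n a b B X z \<omega>)\<^sup>2 = (\<Sum>S\<in>F. (Y S \<omega>)\<^sup>2 * indicator (D S) z)" for z \<omega>
  proof (cases "\<exists>S\<in>F. z \<in> D S")
    case True
    then obtain S where S: "S \<in> F" "z \<in> D S" by auto
    have other: "z \<notin> D S'" if "S' \<in> F" "S' \<noteq> S" for S' using that S atom(1)[of F] by (auto simp: disjoint_family_on_def)
    have "(\<Sum>S\<in>F. g S * indicator (D S) z) = g S" for g :: "nat set \<Rightarrow> real"
      using S other fin(2) by (subst sum.remove[OF fin(2) S(1)]) (auto intro!: sum.neutral)
    then show ?thesis by (simp add: sf)
  next
    case False
    then show ?thesis by (simp add: sf)
  qed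
  have strip: "D S \<subseteq> {0..} \<times> {0..<J}" if "S \<in> F" for S using D[OF that] by (simp add: wn_set_def)
  show thesis
  proof (rule that[of Q])
    show "Q \<in> borel_measurable M"
      unfolding Q_def
      by (intro borel_measurable_sum borel_measurable_times borel_measurable_power borel_measurable_const
          measurable_noise_algebra[OF Ym[unfolded wn_filtration_eq]])
    show "Q \<omega> \<ge> 0" for \<omega> unfolding Q_def by (intro sum_nonneg) auto
    show "(\<integral>\<^sup>+z\<in>{0..} \<times> {0..<J}. ennreal ((simple_fun n a b B X z \<omega>)\<^sup>2) \<partial>lborel) = ennreal (Q \<omega>)" for \<omega>
    proof -
      have "ennreal ((simple_fun n a b B X z \<omega>)\<^sup>2) * indicator ({0..} \<times> {0..<J}) z
          = (\<Sum>S\<in>F. ennreal ((Y S \<omega>)\<^sup>2) * indicator (D S) z)" for z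
      proof -
        have "ennreal ((simple_fun n a b B X z \<omega>)\<^sup>2) * indicator ({0..} \<times> {0..<J}) z
          = (\<Sum>S\<in>F. ennreal ((Y S \<omega>)\<^sup>2 * indicator (D S) z)) * indicator ({0..} \<times> {0..<J}) z"
          unfolding sq by (subst sum_ennreal) auto
        also have "\<dots> = (\<Sum>S\<in>F. ennreal ((Y S \<omega>)\<^sup>2) * indicator (D S) z)"
          unfolding sum_distrib_right
          by (intro sum.cong) (use strip in \<open>auto simp: indicator_def\<close>)
        finally show ?thesis .
      qed
      moreover have DS: "D S \<in> sets borel"
        "(\<lambda>z. ennreal r * indicator (D S) z) \<in> borel_measurable borel" if "S \<in> F" for S r
      proof -
        show [measurable]: "D S \<in> sets borel" using D[OF that] by (simp add: wn_set_def)
        show "(\<lambda>z. ennreal r * indicator (D S) z) \<in> borel_measurable borel" by measurable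
      qed
      ultimately have "(\<integral>\<^sup>+z\<in>{0..} \<times> {0..<J}. ennreal ((simple_fun n a b B X z \<omega>)\<^sup>2) \<partial>lborel)
         = (\<Sum>S\<in>F. ennreal ((Y S \<omega>)\<^sup>2) * emeasure lborel (D S))"
        using DS by (simp, subst nn_integral_sum) (auto simp: nn_integral_cmult_indicator)
      also have "\<dots> = (\<Sum>S\<in>F. ennreal ((Y S \<omega>)\<^sup>2 * measure lborel (D S)))"
      proof (intro sum.cong refl)
        fix S assume "S \<in> F"
        then have "emeasure lborel (D S) = ennreal (measure lborel (D S))"
          using D[OF \<open>S \<in> F\<close>] by (intro emeasure_eq_ennreal_measure) (auto simp: wn_set_def)
        then show "ennreal ((Y S \<omega>)\<^sup>2) * emeasure lborel (D S) = ennreal ((Y S \<omega>)\<^sup>2 * measure lborel (D S))"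
          by (simp add: ennreal_mult)
      qed
      finally show ?thesis unfolding Q_def by (subst (asm) sum_ennreal) auto
    qed
    fix c :: real
    have "(\<integral>\<^sup>+\<omega>. ennreal (exp (c * simple_int W n a b B X \<omega> - c\<^sup>2 * Q \<omega> / 2)) \<partial>M)
      = (\<integral>\<^sup>+\<omega>. ennreal (exp ((\<Sum>S\<in>F. (c * Y S \<omega>) * W (D S) \<omega>) - (\<Sum>S\<in>F. (c * Y S \<omega>)\<^sup>2 * measure lborel (D S)) / 2)) \<partial>M)"
    proof (rule nn_integral_cong_AE)
      have "AE \<omega> in M. \<forall>i\<in>I. W (R i) \<omega> = (\<Sum>S | S \<subseteq> I \<and> i \<in> S. W (D S) \<omega>)"
        unfolding D_def by (rule W_atoms[OF fin(1) RI])
      then show "AE \<omega> in M. ennreal (exp (c * simple_int W n a b B X \<omega> - c\<^sup>2 * Q \<omega> / 2)) =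
         ennreal (exp ((\<Sum>S\<in>F. (c * Y S \<omega>) * W (D S) \<omega>) - (\<Sum>S\<in>F. (c * Y S \<omega>)\<^sup>2 * measure lborel (D S)) / 2))"
      proof eventually_elim
        case (elim \<omega>)
        have "simple_int W n a b B X \<omega> = (\<Sum>i\<in>I. \<Sum>S | S \<subseteq> I \<and> i \<in> S. X i \<omega> * W (D S) \<omega>)"
          unfolding simple_int_def using elim by (auto simp: I_def R_def sum_distrib_left)
        also have "\<dots> = (\<Sum>S\<in>F. Y S \<omega> * W (D S) \<omega>)"
          unfolding swap by (simp add: Y_def sum_distrib_right)
        finally show ?case
          by (simp add: Q_def sum_distrib_left power_mult_distrib mult.assoc)
      qed
    qed
    also have "\<dots> = 1"
    proof (rule exp_noise_sum[OF fin(2) D atom(1) fut])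
      show "(\<lambda>\<omega>. c * Y S \<omega>) \<in> borel_measurable (wn_filtration M J W (\<tau> S))" if "S \<in> F" for S
        using Ym[OF that] by measurable
    qed
    finally show "(\<integral>\<^sup>+\<omega>. ennreal (exp (c * simple_int W n a b B X \<omega> - c\<^sup>2 * Q \<omega> / 2)) \<partial>M) = 1" .
  qed
qed

end

section \<open>Sub-Gaussian tails of Walsh integrals\<close>

text \<open>Integrals below \<open>(1/2)^n\<close> along a subsequence make the sum of the functions
  integrable, hence finite almost everywhere, and the terms of a convergent series tend to
  0.\<close>

lemma nn_integral_tendsto_0_AE_subseq:
  assumes [measurable]: "\<And>k. g k \<in> borel_measurable M"
    and lim: "(\<lambda>k::nat. \<integral>\<^sup>+x. g k x \<partial>M) \<longlonglongrightarrow> 0"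
  obtains r :: "nat \<Rightarrow> nat" where "strict_mono r" "AE x in M. (\<lambda>k. g (r k) x) \<longlonglongrightarrow> 0"
proof -
  have ev: "\<exists>K. \<forall>k\<ge>K. (\<integral>\<^sup>+x. g k x \<partial>M) < ennreal ((1/2)^n)" for n
    using order_tendstoD(2)[OF lim, of "ennreal ((1/2)^n)"] by (auto simp: eventually_sequentially)
  have "\<exists>r. \<forall>n. (\<integral>\<^sup>+x. g (r n) x \<partial>M) < ennreal ((1/2)^n) \<and> r n < r (Suc n)"
  proof (rule dependent_nat_choice)
    show "\<exists>k. (\<integral>\<^sup>+x. g k x \<partial>M) < ennreal ((1/2)^0)" using ev[of 0] by auto
    show "\<exists>l. (\<integral>\<^sup>+x. g l x \<partial>M) < ennreal ((1/2)^Suc n) \<and> k < l" for k n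
    proof -
      obtain K where "\<forall>k\<ge>K. (\<integral>\<^sup>+x. g k x \<partial>M) < ennreal ((1/2)^Suc n)" using ev[of "Suc n"] by auto
      then show ?thesis by (intro exI[of _ "max K (Suc k)"]) auto
    qed
  qed
  then obtain r where r: "\<And>n. (\<integral>\<^sup>+x. g (r n) x \<partial>M) < ennreal ((1/2)^n)" "\<And>n. r n < r (Suc n)" by blast
  have "(\<integral>\<^sup>+x. (\<Sum>k. g (r k) x) \<partial>M) = (\<Sum>k. \<integral>\<^sup>+x. g (r k) x \<partial>M)"
    by (rule nn_integral_suminf) simp
  also have "\<dots> \<le> (\<Sum>k. ennreal ((1/2)^k))"
    by (intro suminf_le less_imp_le r) auto
  also have "\<dots> < \<infinity>"
    by (subst suminf_ennreal_eq[OF _ geometric_sums]) auto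
  finally have "AE x in M. (\<Sum>k. g (r k) x) \<noteq> \<infinity>"
    by (intro nn_integral_PInf_AE) auto
  then have "AE x in M. (\<lambda>k. g (r k) x) \<longlonglongrightarrow> 0"
  proof eventually_elim
    case (elim x)
    have fin: "g (r k) x \<noteq> top" for k
      using elim ennreal_suminf_lessD[of "\<lambda>k. g (r k) x" top k] by (auto simp: less_top)
    then have eq: "ennreal (enn2real (g (r k) x)) = g (r k) x" for k by (simp add: less_top)
    have "summable (\<lambda>k. enn2real (g (r k) x))"
      by (rule summable_suminf_not_top) (use elim eq in auto)
    then have "(\<lambda>k. ennreal (enn2real (g (r k) x))) \<longlonglongrightarrow> ennreal 0"
      by (intro tendsto_ennrealI summable_LIMSEQ_zero)
    then show ?case by (simp add: eq)
  qed
  moreover have "strict_mono r" using r(2) by (simp add: strict_mono_Suc_iff)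
  ultimately show thesis using that by blast
qed

lemma sum_lessThan_add_split:
  "(\<Sum>i<n + m. h i) = (\<Sum>i<n. h i) + (\<Sum>i<m. h (n + i) :: real)" for n m :: nat
  by (induction m) (auto simp: algebra_simps)

lemma square_diff_le: "(x - y)\<^sup>2 \<le> 2 * x\<^sup>2 + 2 * y\<^sup>2" for x y :: real
  using sum_squares_bound[of x "- y"] by (simp add: power2_diff)

lemma ennreal_square_diff_le:
  "ennreal ((x - y)\<^sup>2) \<le> 2 * ennreal (x\<^sup>2) + 2 * ennreal (y\<^sup>2)"
proof -
  have "ennreal ((x - y)\<^sup>2) \<le> ennreal (2 * x\<^sup>2 + 2 * y\<^sup>2)"
    by (intro ennreal_leI square_diff_le)
  also have "\<dots> = 2 * ennreal (x\<^sup>2) + 2 * ennreal (y\<^sup>2)"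
    by (simp add: ennreal_plus ennreal_mult)
  finally show ?thesis .
qed

context white_noise_space
begin

lemma simple_fun_measurable:
  assumes "simple_pred M J W n a b B X"
  shows "(\<lambda>p. simple_fun n a b B X (fst p) (snd p)) \<in> borel_measurable (lborel \<Otimes>\<^sub>M M)"
  unfolding simple_fun_def
proof (intro borel_measurable_sum borel_measurable_times)
  fix i assume "i \<in> {..<n}"
  then have X: "X i \<in> borel_measurable M" and B[measurable]: "B i \<in> sets borel"
    using assms by (auto simp: simple_pred_def wn_filtration_eq intro: measurable_noise_algebra)
  show "(\<lambda>p. X i (snd p)) \<in> borel_measurable ((lborel :: (real \<times> real) measure) \<Otimes>\<^sub>M M)"
    by (rule measurable_compose[OF measurable_snd X])
  have p: "fst \<in> measurable ((lborel :: (real \<times> real) measure) \<Otimes>\<^sub>M M) (borel \<Otimes>\<^sub>M borel)"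
    using measurable_fst[of "lborel :: (real \<times> real) measure" M] by (simp add: borel_prod)
  show "(\<lambda>p. indicator {a i<..b i} (fst (fst p)) :: real) \<in> borel_measurable ((lborel :: (real \<times> real) measure) \<Otimes>\<^sub>M M)"
    by (rule measurable_compose[OF p]) measurable
  show "(\<lambda>p. indicator (B i) (snd (fst p)) :: real) \<in> borel_measurable ((lborel :: (real \<times> real) measure) \<Otimes>\<^sub>M M)"
    by (rule measurable_compose[OF p]) measurable
qed

lemma simple_int_measurable:
  assumes "simple_pred M J W n a b B X"
  shows "simple_int W n a b B X \<in> borel_measurable M"
  unfolding simple_int_def
proof (intro borel_measurable_sum borel_measurable_times)
  fix i assume i: "i \<in> {..<n}"
  then show "X i \<in> borel_measurable M"
    using assms by (auto simp: simple_pred_def wn_filtration_eq intro: measurable_noise_algebra)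
  have "wn_set J ({a i<..b i} \<times> B i)"
    using assms i by (intro wn_set_rectangle) (auto simp: simple_pred_def)
  then show "W ({a i<..b i} \<times> B i) \<in> borel_measurable M" by simp
qed

lemma strip_error_measurable:
  fixes f :: "real \<times> real \<Rightarrow> 'a \<Rightarrow> real"
  assumes f: "(\<lambda>(z, \<omega>). f z \<omega>) \<in> borel_measurable (lborel \<Otimes>\<^sub>M M)"
  shows "(\<lambda>\<omega>. \<integral>\<^sup>+z\<in>{0..} \<times> {0..<J}. ennreal ((f z \<omega>)\<^sup>2) \<partial>lborel) \<in> borel_measurable M"
proof -
  have fst_m: "fst \<in> measurable ((lborel :: (real \<times> real) measure) \<Otimes>\<^sub>M M) borel"
    using measurable_fst[of "lborel :: (real \<times> real) measure" M] by simp
  have S: "{0..} \<times> {0..<J} \<in> sets (borel :: (real \<times> real) measure)"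
    by (simp add: borel_prod[symmetric])
  have "(\<lambda>p. ennreal ((f (fst p) (snd p))\<^sup>2) * indicator ({0..} \<times> {0..<J}) (fst p)) \<in> borel_measurable (lborel \<Otimes>\<^sub>M M)"
  proof (rule borel_measurable_times_ennreal)
    have "(\<lambda>p. f (fst p) (snd p)) \<in> borel_measurable (lborel \<Otimes>\<^sub>M M)" using f by (simp add: split_beta)
    then show "(\<lambda>p. ennreal ((f (fst p) (snd p))\<^sup>2)) \<in> borel_measurable (lborel \<Otimes>\<^sub>M M)" by measurable
    show "(\<lambda>p. indicator ({0..} \<times> {0..<J}) (fst p :: real \<times> real) :: ennreal) \<in> borel_measurable (lborel \<Otimes>\<^sub>M M)"
      by (rule measurable_compose[OF fst_m borel_measurable_indicator[OF S]])
  qed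
  then have "(\<lambda>p. ennreal ((f (snd p) (fst p))\<^sup>2) * indicator ({0..} \<times> {0..<J}) (snd p)) \<in> borel_measurable (M \<Otimes>\<^sub>M lborel)"
    by (subst measurable_pair_swap_iff) (simp add: split_beta)
  from lborel.borel_measurable_nn_integral_fst[OF this] show ?thesis by simp
qed

text \<open>Fatou's lemma along an almost surely convergent subsequence carries the exponential
  identity from simple integrals to the limit. The exponent is \<open>c\<^sup>2 * K\<close>, twice
  the Gaussian value, because quadratic variations of the approximations are bounded only up to a
  factor 2.\<close>

lemma walsh_integral_subgaussian:
  assumes walsh: "walsh_integral M J W f I"
    and K: "K \<ge> 0" "\<And>\<omega>. \<omega> \<in> space M \<Longrightarrow> (\<integral>\<^sup>+z\<in>{0..} \<times> {0..<J}. ennreal ((f z \<omega>)\<^sup>2) \<partial>lborel) \<le> ennreal K"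
  shows "(\<integral>\<^sup>+\<omega>. ennreal (exp (c * I \<omega>)) \<partial>M) \<le> ennreal (exp (c\<^sup>2 * K))"
proof -
  from walsh obtain n a b B X where
    f: "(\<lambda>(z, \<omega>). f z \<omega>) \<in> borel_measurable (lborel \<Otimes>\<^sub>M M)" and I[measurable]: "I \<in> borel_measurable M"
    and simple: "\<And>k. simple_pred M J W (n k) (a k) (b k) (B k) (X k)"
    and lim1: "(\<lambda>k. \<integral>\<^sup>+ \<omega>. (\<integral>\<^sup>+ z\<in>{0..} \<times> {0..<J}.
            ennreal ((f z \<omega> - simple_fun (n k) (a k) (b k) (B k) (X k) z \<omega>)\<^sup>2) \<partial>lborel) \<partial>M) \<longlonglongrightarrow> 0"
    and lim2: "(\<lambda>k. \<integral>\<^sup>+ \<omega>. ennreal ((I \<omega> - simple_int W (n k) (a k) (b k) (B k) (X k) \<omega>)\<^sup>2) \<partial>M) \<longlonglongrightarrow> 0"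
    unfolding walsh_integral_def by blast
  define \<phi> where "\<phi> k z \<omega> = simple_fun (n k) (a k) (b k) (B k) (X k) z \<omega>" for k z \<omega>
  define S where "S k = simple_int W (n k) (a k) (b k) (B k) (X k)" for k
  have S_m[measurable]: "S k \<in> borel_measurable M" for k
    unfolding S_def by (rule simple_int_measurable[OF simple])
  define d1 where "d1 k \<omega> = (\<integral>\<^sup>+ z\<in>{0..} \<times> {0..<J}. ennreal ((f z \<omega> - \<phi> k z \<omega>)\<^sup>2) \<partial>lborel)" for k \<omega>
  define d2 where "d2 k \<omega> = ennreal ((I \<omega> - S k \<omega>)\<^sup>2)" for k \<omega>
  have d1_m[measurable]: "d1 k \<in> borel_measurable M" for k
    unfolding d1_def using f simple_fun_measurable[OF simple, of k]
    by (intro strip_error_measurable) (simp add: split_beta \<phi>_def)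
  have d2_m[measurable]: "d2 k \<in> borel_measurable M" for k unfolding d2_def by measurable
  \<comment> \<open>One subsequence has to serve both the integrands and the integrals, so their
    errors are added before it is chosen.\<close>
  have "(\<lambda>k. \<integral>\<^sup>+ \<omega>. d1 k \<omega> + d2 k \<omega> \<partial>M) \<longlonglongrightarrow> 0"
    using tendsto_add[OF lim1 lim2] by (simp add: nn_integral_add d1_def[symmetric] d2_def[symmetric] \<phi>_def[symmetric] S_def[symmetric])
  then obtain r :: "nat \<Rightarrow> nat" where r: "strict_mono r" "AE \<omega> in M. (\<lambda>k. d1 (r k) \<omega> + d2 (r k) \<omega>) \<longlonglongrightarrow> 0"
    by (rule nn_integral_tendsto_0_AE_subseq[rotated]) auto
  have "\<forall>k. \<exists>Q. Q \<in> borel_measurable M \<and> (\<forall>\<omega>. Q \<omega> \<ge> 0) \<and>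
    (\<forall>\<omega>. (\<integral>\<^sup>+z\<in>{0..} \<times> {0..<J}. ennreal ((\<phi> k z \<omega>)\<^sup>2) \<partial>lborel) = ennreal (Q \<omega>)) \<and>
    (\<forall>c. (\<integral>\<^sup>+\<omega>. ennreal (exp (c * S k \<omega> - c\<^sup>2 * Q \<omega> / 2)) \<partial>M) = 1)"
  proof
    fix k
    show "\<exists>Q. Q \<in> borel_measurable M \<and> (\<forall>\<omega>. Q \<omega> \<ge> 0) \<and>
      (\<forall>\<omega>. (\<integral>\<^sup>+z\<in>{0..} \<times> {0..<J}. ennreal ((\<phi> k z \<omega>)\<^sup>2) \<partial>lborel) = ennreal (Q \<omega>)) \<and>
      (\<forall>c. (\<integral>\<^sup>+\<omega>. ennreal (exp (c * S k \<omega> - c\<^sup>2 * Q \<omega> / 2)) \<partial>M) = 1)"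
      unfolding \<phi>_def S_def by (rule exp_simple_int[OF simple[of k]]) blast
  qed
  then obtain Q where "\<forall>k. Q k \<in> borel_measurable M \<and> (\<forall>\<omega>. Q k \<omega> \<ge> 0) \<and>
    (\<forall>\<omega>. (\<integral>\<^sup>+z\<in>{0..} \<times> {0..<J}. ennreal ((\<phi> k z \<omega>)\<^sup>2) \<partial>lborel) = ennreal (Q k \<omega>)) \<and>
    (\<forall>c. (\<integral>\<^sup>+\<omega>. ennreal (exp (c * S k \<omega> - c\<^sup>2 * Q k \<omega> / 2)) \<partial>M) = 1)"
    unfolding choice_iff by blast
  then have Q[measurable]: "\<And>k. Q k \<in> borel_measurable M"
    and Q_eq: "\<And>k \<omega>. (\<integral>\<^sup>+z\<in>{0..} \<times> {0..<J}. ennreal ((\<phi> k z \<omega>)\<^sup>2) \<partial>lborel) = ennreal (Q k \<omega>)"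
    and Q_exp: "\<And>k c. (\<integral>\<^sup>+\<omega>. ennreal (exp (c * S k \<omega> - c\<^sup>2 * Q k \<omega> / 2)) \<partial>M) = 1"
    by simp_all
  \<comment> \<open>The random quadratic variation is replaced by a deterministic bound plus an
    error that vanishes along the subsequence.\<close>
  have Q_le: "ennreal (Q k \<omega>) \<le> 2 * ennreal K + 2 * d1 k \<omega>" if \<omega>: "\<omega> \<in> space M" for k \<omega>
  proof -
    have st: "{0..} \<times> {0..<J} \<in> sets (borel :: (real \<times> real) measure)"
      by (simp add: borel_prod[symmetric])
    have fm[measurable]: "(\<lambda>z. f z \<omega>) \<in> borel_measurable borel"
      using measurable_Pair1'[OF \<omega>, of lborel] measurable_compose[OF _ f, of "\<lambda>z. (z, \<omega>)" lborel] \<omega> by simp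
    have gm[measurable]: "(\<lambda>z. \<phi> k z \<omega>) \<in> borel_measurable borel"
      using measurable_compose[OF _ simple_fun_measurable[OF simple], of "\<lambda>z. (z, \<omega>)" lborel k] \<omega> by (simp add: \<phi>_def)
    have im[measurable]: "(\<lambda>z :: real \<times> real. indicator ({0..} \<times> {0..<J}) z :: ennreal) \<in> borel_measurable borel"
      using st by (rule borel_measurable_indicator)
    have "ennreal (Q k \<omega>) \<le> (\<integral>\<^sup>+z. 2 * (ennreal ((f z \<omega>)\<^sup>2) * indicator ({0..} \<times> {0..<J}) z)
        + 2 * (ennreal ((f z \<omega> - \<phi> k z \<omega>)\<^sup>2) * indicator ({0..} \<times> {0..<J}) z) \<partial>lborel)"
      unfolding Q_eq[symmetric]
    proof (intro nn_integral_mono)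
      fix z
      show "ennreal ((\<phi> k z \<omega>)\<^sup>2) * indicator ({0..} \<times> {0..<J}) z
        \<le> 2 * (ennreal ((f z \<omega>)\<^sup>2) * indicator ({0..} \<times> {0..<J}) z)
        + 2 * (ennreal ((f z \<omega> - \<phi> k z \<omega>)\<^sup>2) * indicator ({0..} \<times> {0..<J}) z)"
        using ennreal_square_diff_le[of "f z \<omega>" "f z \<omega> - \<phi> k z \<omega>"] by (auto simp: indicator_def)
    qed
    also have "\<dots> = 2 * (\<integral>\<^sup>+z\<in>{0..} \<times> {0..<J}. ennreal ((f z \<omega>)\<^sup>2) \<partial>lborel) + 2 * d1 k \<omega>"
      unfolding d1_def by (subst nn_integral_add) (auto simp: nn_integral_cmult)
    also have "\<dots> \<le> 2 * ennreal K + 2 * d1 k \<omega>" using K(2)[OF \<omega>] by (intro add_right_mono mult_left_mono) auto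
    finally show ?thesis .
  qed
  define g where "g k \<omega> = ennreal (exp (c * S k \<omega> - c\<^sup>2 * Q k \<omega> / 2))" for k \<omega>
  have "AE \<omega> in M. ennreal (exp (c * I \<omega> - c\<^sup>2 * K)) \<le> liminf (\<lambda>k. g (r k) \<omega>)"
    using r(2) AE_space
  proof eventually_elim
    case (elim \<omega>)
    have l1: "(\<lambda>k. d1 (r k) \<omega>) \<longlonglongrightarrow> 0" and l2: "(\<lambda>k. d2 (r k) \<omega>) \<longlonglongrightarrow> 0"
      by (rule tendsto_sandwich[OF _ _ tendsto_const elim(1)]; simp)+
    define e where "e k = enn2real (d1 (r k) \<omega>)" for k
    have e: "e \<longlonglongrightarrow> 0" unfolding e_def using tendsto_enn2real[of "\<lambda>k. d1 (r k) \<omega>" 0] l1 by simp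
    have "(\<lambda>k. sqrt (enn2real (d2 (r k) \<omega>))) \<longlonglongrightarrow> sqrt 0"
      using tendsto_enn2real[of "\<lambda>k. d2 (r k) \<omega>" 0] l2 by (intro tendsto_real_sqrt) simp
    then have "(\<lambda>k. \<bar>I \<omega> - S (r k) \<omega>\<bar>) \<longlonglongrightarrow> 0" by (simp add: d2_def)
    then have "(\<lambda>k. I \<omega> - S (r k) \<omega>) \<longlonglongrightarrow> 0" by (simp add: tendsto_rabs_zero_iff)
    from tendsto_diff[OF tendsto_const[of "I \<omega>"] this] have S: "(\<lambda>k. S (r k) \<omega>) \<longlonglongrightarrow> I \<omega>" by simp
    have "(\<lambda>k. ennreal (exp (c * S (r k) \<omega> - c\<^sup>2 * (2 * K + 2 * e k) / 2))) \<longlonglongrightarrow> ennreal (exp (c * I \<omega> - c\<^sup>2 * (2 * K + 2 * 0) / 2))"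
      by (intro tendsto_ennrealI tendsto_intros S e) simp
    then have lim_eq: "liminf (\<lambda>k. ennreal (exp (c * S (r k) \<omega> - c\<^sup>2 * (2 * K + 2 * e k) / 2))) = ennreal (exp (c * I \<omega> - c\<^sup>2 * K))"
      by (intro lim_imp_Liminf) auto
    \<comment> \<open>\<open>enn2real\<close> sends infinity to 0, so \<open>e k\<close> represents
      \<open>d1\<close> only where \<open>d1\<close> is finite, which holds eventually.\<close>
    have "\<forall>\<^sub>F k in sequentially. ennreal (exp (c * S (r k) \<omega> - c\<^sup>2 * (2 * K + 2 * e k) / 2)) \<le> g (r k) \<omega>"
      using order_tendstoD(2)[OF l1 zero_less_one]
    proof eventually_elim
      case (elim k)
      then have "ennreal (e k) = d1 (r k) \<omega>"
        unfolding e_def by (intro ennreal_enn2real) (erule less_trans, simp)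
      then have "ennreal (Q (r k) \<omega>) \<le> 2 * ennreal K + 2 * ennreal (e k)" using Q_le \<open>\<omega> \<in> space M\<close> by simp
      also have "\<dots> = ennreal (2 * K + 2 * e k)" using K by (simp add: ennreal_plus ennreal_mult e_def)
      finally have "Q (r k) \<omega> \<le> 2 * K + 2 * e k"
        using K by (subst (asm) ennreal_le_iff) (auto simp: e_def)
      then have "c\<^sup>2 * Q (r k) \<omega> \<le> c\<^sup>2 * (2 * K + 2 * e k)" by (intro mult_left_mono) auto
      then show ?case unfolding g_def by (intro ennreal_leI) (simp add: divide_right_mono)
    qed
    from Liminf_mono[OF this] show ?case unfolding lim_eq .
  qed
  then have "(\<integral>\<^sup>+\<omega>. ennreal (exp (c * I \<omega> - c\<^sup>2 * K)) \<partial>M) \<le> (\<integral>\<^sup>+\<omega>. liminf (\<lambda>k. g (r k) \<omega>) \<partial>M)"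
    by (rule nn_integral_mono_AE)
  also have "\<dots> \<le> liminf (\<lambda>k. \<integral>\<^sup>+\<omega>. g (r k) \<omega> \<partial>M)"
    by (rule nn_integral_liminf) (simp add: g_def)
  also have "\<dots> = 1" unfolding g_def Q_exp by (simp add: Liminf_const)
  finally have le1: "(\<integral>\<^sup>+\<omega>. ennreal (exp (c * I \<omega> - c\<^sup>2 * K)) \<partial>M) \<le> 1" .
  have "(\<integral>\<^sup>+\<omega>. ennreal (exp (c * I \<omega>)) \<partial>M) = (\<integral>\<^sup>+\<omega>. ennreal (exp (c\<^sup>2 * K)) * ennreal (exp (c * I \<omega> - c\<^sup>2 * K)) \<partial>M)"
    by (simp add: ennreal_mult[symmetric] exp_add[symmetric])
  also have "\<dots> = ennreal (exp (c\<^sup>2 * K)) * (\<integral>\<^sup>+\<omega>. ennreal (exp (c * I \<omega> - c\<^sup>2 * K)) \<partial>M)"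
    by (rule nn_integral_cmult) measurable
  also have "\<dots> \<le> ennreal (exp (c\<^sup>2 * K)) * 1" by (intro mult_left_mono le1) auto
  finally show ?thesis by simp
qed

lemma walsh_integral_tail:
  assumes walsh: "walsh_integral M J W f I"
    and K: "K > 0" "\<And>\<omega>. \<omega> \<in> space M \<Longrightarrow> (\<integral>\<^sup>+z\<in>{0..} \<times> {0..<J}. ennreal ((f z \<omega>)\<^sup>2) \<partial>lborel) \<le> ennreal K"
    and e: "e \<ge> 0"
  shows "prob {\<omega> \<in> space M. \<bar>I \<omega>\<bar> \<ge> e} \<le> 2 * exp (- (e\<^sup>2) / (4 * K))"
proof -
  have I[measurable]: "I \<in> borel_measurable M" using walsh by (simp add: walsh_integral_def)
  have one: "prob {\<omega> \<in> space M. s * I \<omega> \<ge> e} \<le> exp (- (e\<^sup>2) / (4 * K))" if s: "s\<^sup>2 = 1" for s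
  proof -
    \<comment> \<open>This value minimises \<open>- c * e + c\<^sup>2 * K\<close>. The sign
      \<open>s\<close> is 1 or -1, for the two tails.\<close>
    define c where "c = e / (2 * K)"
    have c: "c \<ge> 0" using e K by (simp add: c_def)
    have "emeasure M {\<omega> \<in> space M. s * I \<omega> \<ge> e} = (\<integral>\<^sup>+\<omega>. indicator {\<omega> \<in> space M. s * I \<omega> \<ge> e} \<omega> \<partial>M)"
      by (simp add: nn_integral_indicator)
    also have "\<dots> \<le> (\<integral>\<^sup>+\<omega>. ennreal (exp (- c * e)) * ennreal (exp (c * s * I \<omega>)) \<partial>M)"
    proof (intro nn_integral_mono)
      fix \<omega> show "indicator {\<omega> \<in> space M. s * I \<omega> \<ge> e} \<omega> \<le> ennreal (exp (- c * e)) * ennreal (exp (c * s * I \<omega>))"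
      proof (cases "s * I \<omega> \<ge> e")
        case True
        then have "c * e \<le> c * s * I \<omega>" using c mult_left_mono[of e "s * I \<omega>" c] by (simp add: mult.assoc)
        then have "1 \<le> exp (- c * e) * exp (c * s * I \<omega>)" by (simp add: exp_add[symmetric])
        then have "1 \<le> ennreal (exp (- c * e) * exp (c * s * I \<omega>))" by (simp add: ennreal_1[symmetric] del: ennreal_1)
        then show ?thesis by (auto simp: indicator_def ennreal_mult)
      qed auto
    qed
    also have "\<dots> = ennreal (exp (- c * e)) * (\<integral>\<^sup>+\<omega>. ennreal (exp (c * s * I \<omega>)) \<partial>M)"
      by (rule nn_integral_cmult) measurable
    also have "\<dots> \<le> ennreal (exp (- c * e)) * ennreal (exp ((c * s)\<^sup>2 * K))"
      using K by (intro mult_left_mono walsh_integral_subgaussian[OF walsh]) auto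
    also have "\<dots> = ennreal (exp (- c * e + (c * s)\<^sup>2 * K))"
      by (simp only: exp_add ennreal_mult exp_ge_zero)
    also have "- c * e + (c * s)\<^sup>2 * K = - (e\<^sup>2) / (4 * K)"
    proof -
      have "(c * s)\<^sup>2 = c\<^sup>2" by (simp add: power_mult_distrib s)
      then show ?thesis using K by (simp add: c_def field_simps power2_eq_square)
    qed
    finally show ?thesis by (simp add: emeasure_eq_measure)
  qed
  have "prob {\<omega> \<in> space M. \<bar>I \<omega>\<bar> \<ge> e} \<le> prob ({\<omega> \<in> space M. 1 * I \<omega> \<ge> e} \<union> {\<omega> \<in> space M. (-1) * I \<omega> \<ge> e})"
    by (intro finite_measure_mono) auto
  also have "\<dots> \<le> prob {\<omega> \<in> space M. 1 * I \<omega> \<ge> e} + prob {\<omega> \<in> space M. (-1) * I \<omega> \<ge> e}"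
    by (intro measure_Un_le) auto
  also have "\<dots> \<le> 2 * exp (- (e\<^sup>2) / (4 * K))" using one[of 1] one[of "-1"] by simp
  finally show ?thesis .
qed

end

section \<open>Differences of Walsh integrals\<close>

context white_noise_space begin
text \<open>The tail bound is to be applied to increments of the random field, which must first be
  recognised as Walsh integrals. The two approximating sums are concatenated, the second with its
  sign reversed.\<close>

lemma walsh_integral_diff:
  assumes "walsh_integral M J W f I" "walsh_integral M J W f' I'"
  shows "walsh_integral M J W (\<lambda>z \<omega>. f z \<omega> - f' z \<omega>) (\<lambda>\<omega>. I \<omega> - I' \<omega>)"
proof -
  from assms(1) obtain n a b B X where
    f: "(\<lambda>(z, \<omega>). f z \<omega>) \<in> borel_measurable (lborel \<Otimes>\<^sub>M M)" and I[measurable]: "I \<in> borel_measurable M"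
    and simple: "\<And>k. simple_pred M J W (n k) (a k) (b k) (B k) (X k)"
    and lim1: "(\<lambda>k. \<integral>\<^sup>+ \<omega>. (\<integral>\<^sup>+ z\<in>{0..} \<times> {0..<J}.
            ennreal ((f z \<omega> - simple_fun (n k) (a k) (b k) (B k) (X k) z \<omega>)\<^sup>2) \<partial>lborel) \<partial>M) \<longlonglongrightarrow> 0"
    and lim2: "(\<lambda>k. \<integral>\<^sup>+ \<omega>. ennreal ((I \<omega> - simple_int W (n k) (a k) (b k) (B k) (X k) \<omega>)\<^sup>2) \<partial>M) \<longlonglongrightarrow> 0"
    unfolding walsh_integral_def by blast
  from assms(2) obtain n' a' b' B' X' where
    f': "(\<lambda>(z, \<omega>). f' z \<omega>) \<in> borel_measurable (lborel \<Otimes>\<^sub>M M)" and I'[measurable]: "I' \<in> borel_measurable M"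
    and simple': "\<And>k. simple_pred M J W (n' k) (a' k) (b' k) (B' k) (X' k)"
    and lim1': "(\<lambda>k. \<integral>\<^sup>+ \<omega>. (\<integral>\<^sup>+ z\<in>{0..} \<times> {0..<J}.
            ennreal ((f' z \<omega> - simple_fun (n' k) (a' k) (b' k) (B' k) (X' k) z \<omega>)\<^sup>2) \<partial>lborel) \<partial>M) \<longlonglongrightarrow> 0"
    and lim2': "(\<lambda>k. \<integral>\<^sup>+ \<omega>. ennreal ((I' \<omega> - simple_int W (n' k) (a' k) (b' k) (B' k) (X' k) \<omega>)\<^sup>2) \<partial>M) \<longlonglongrightarrow> 0"
    unfolding walsh_integral_def by blast
  define \<phi> where "\<phi> k z \<omega> = simple_fun (n k) (a k) (b k) (B k) (X k) z \<omega>" for k z \<omega>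
  define \<phi>' where "\<phi>' k z \<omega> = simple_fun (n' k) (a' k) (b' k) (B' k) (X' k) z \<omega>" for k z \<omega>
  define S where "S k = simple_int W (n k) (a k) (b k) (B k) (X k)" for k
  define S' where "S' k = simple_int W (n' k) (a' k) (b' k) (B' k) (X' k)" for k
  have [measurable]: "S k \<in> borel_measurable M" "S' k \<in> borel_measurable M" for k
    unfolding S_def S'_def by (rule simple_int_measurable[OF simple] simple_int_measurable[OF simple'])+
  define a2 where "a2 k i = (if i < n k then a k i else a' k (i - n k))" for k i
  define b2 where "b2 k i = (if i < n k then b k i else b' k (i - n k))" for k i
  define B2 where "B2 k i = (if i < n k then B k i else B' k (i - n k))" for k i
  define X2 where "X2 k i = (if i < n k then X k i else (\<lambda>\<omega>. - X' k (i - n k) \<omega>))" for k i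
  let ?n = "\<lambda>k. n k + n' k"
  have simple2: "simple_pred M J W (?n k) (a2 k) (b2 k) (B2 k) (X2 k)" for k
    unfolding simple_pred_def
  proof (intro allI impI)
    fix i assume i: "i < ?n k"
    let ?P = "\<lambda>a b B X. 0 \<le> a \<and> a < b \<and> B \<in> sets lborel \<and> B \<subseteq> {0..<J} \<and>
        X \<in> borel_measurable (wn_filtration M J W a) \<and> (\<exists>C. \<forall>\<omega>\<in>space M. \<bar>X \<omega>\<bar> \<le> C)"
    show "?P (a2 k i) (b2 k i) (B2 k i) (X2 k i)"
    proof (cases "i < n k")
      case True
      then show ?thesis using simple[of k] by (simp add: simple_pred_def a2_def b2_def B2_def X2_def)
    next
      case False
      then have "i - n k < n' k" using i by auto
      then have "?P (a' k (i - n k)) (b' k (i - n k)) (B' k (i - n k)) (X' k (i - n k))"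
        using simple'[of k] by (simp add: simple_pred_def)
      then show ?thesis using False by (simp add: a2_def b2_def B2_def X2_def)
    qed
  qed
  have sf2: "simple_fun (?n k) (a2 k) (b2 k) (B2 k) (X2 k) z \<omega> = \<phi> k z \<omega> - \<phi>' k z \<omega>" for k z \<omega>
    unfolding simple_fun_def \<phi>_def \<phi>'_def sum_lessThan_add_split
    by (simp add: a2_def b2_def B2_def X2_def sum_negf)
  have si2: "simple_int W (?n k) (a2 k) (b2 k) (B2 k) (X2 k) \<omega> = S k \<omega> - S' k \<omega>" for k \<omega>
    unfolding simple_int_def S_def S'_def sum_lessThan_add_split
    by (simp add: a2_def b2_def B2_def X2_def sum_negf)
  define d where "d k \<omega> = (\<integral>\<^sup>+ z\<in>{0..} \<times> {0..<J}. ennreal ((f z \<omega> - \<phi> k z \<omega>)\<^sup>2) \<partial>lborel)" for k \<omega>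
  define d' where "d' k \<omega> = (\<integral>\<^sup>+ z\<in>{0..} \<times> {0..<J}. ennreal ((f' z \<omega> - \<phi>' k z \<omega>)\<^sup>2) \<partial>lborel)" for k \<omega>
  have d_m[measurable]: "d k \<in> borel_measurable M" for k
    unfolding d_def using f simple_fun_measurable[OF simple, of k]
    by (intro strip_error_measurable) (simp add: split_beta \<phi>_def)
  have d'_m[measurable]: "d' k \<in> borel_measurable M" for k
    unfolding d'_def using f' simple_fun_measurable[OF simple', of k]
    by (intro strip_error_measurable) (simp add: split_beta \<phi>'_def)
  have st: "{0..} \<times> {0..<J} \<in> sets (borel :: (real \<times> real) measure)"
    by (simp add: borel_prod[symmetric])
  have im[measurable]: "(\<lambda>z :: real \<times> real. indicator ({0..} \<times> {0..<J}) z :: ennreal) \<in> borel_measurable borel"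
    using st by (rule borel_measurable_indicator)
  have strip_le: "(\<integral>\<^sup>+ z\<in>{0..} \<times> {0..<J}. ennreal ((f z \<omega> - f' z \<omega> - (\<phi> k z \<omega> - \<phi>' k z \<omega>))\<^sup>2) \<partial>lborel)
      \<le> 2 * d k \<omega> + 2 * d' k \<omega>" if \<omega>: "\<omega> \<in> space M" for k \<omega>
  proof -
    have [measurable]: "(\<lambda>z. f z \<omega>) \<in> borel_measurable borel"
      using measurable_compose[OF _ f, of "\<lambda>z. (z, \<omega>)" lborel] \<omega> by simp
    have [measurable]: "(\<lambda>z. f' z \<omega>) \<in> borel_measurable borel"
      using measurable_compose[OF _ f', of "\<lambda>z. (z, \<omega>)" lborel] \<omega> by simp
    have [measurable]: "(\<lambda>z. \<phi> k z \<omega>) \<in> borel_measurable borel"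
      using measurable_compose[OF _ simple_fun_measurable[OF simple], of "\<lambda>z. (z, \<omega>)" lborel k] \<omega> by (simp add: \<phi>_def)
    have [measurable]: "(\<lambda>z. \<phi>' k z \<omega>) \<in> borel_measurable borel"
      using measurable_compose[OF _ simple_fun_measurable[OF simple'], of "\<lambda>z. (z, \<omega>)" lborel k] \<omega> by (simp add: \<phi>'_def)
    have "(\<integral>\<^sup>+ z\<in>{0..} \<times> {0..<J}. ennreal ((f z \<omega> - f' z \<omega> - (\<phi> k z \<omega> - \<phi>' k z \<omega>))\<^sup>2) \<partial>lborel)
      \<le> (\<integral>\<^sup>+z. 2 * (ennreal ((f z \<omega> - \<phi> k z \<omega>)\<^sup>2) * indicator ({0..} \<times> {0..<J}) z)
        + 2 * (ennreal ((f' z \<omega> - \<phi>' k z \<omega>)\<^sup>2) * indicator ({0..} \<times> {0..<J}) z) \<partial>lborel)"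
    proof (intro nn_integral_mono)
      fix z
      have eq: "f z \<omega> - f' z \<omega> - (\<phi> k z \<omega> - \<phi>' k z \<omega>) = (f z \<omega> - \<phi> k z \<omega>) - (f' z \<omega> - \<phi>' k z \<omega>)" by simp
      show "ennreal ((f z \<omega> - f' z \<omega> - (\<phi> k z \<omega> - \<phi>' k z \<omega>))\<^sup>2) * indicator ({0..} \<times> {0..<J}) z
        \<le> 2 * (ennreal ((f z \<omega> - \<phi> k z \<omega>)\<^sup>2) * indicator ({0..} \<times> {0..<J}) z)
        + 2 * (ennreal ((f' z \<omega> - \<phi>' k z \<omega>)\<^sup>2) * indicator ({0..} \<times> {0..<J}) z)"
        using ennreal_square_diff_le[of "f z \<omega> - \<phi> k z \<omega>" "f' z \<omega> - \<phi>' k z \<omega>"]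
        unfolding eq by (cases "z \<in> {0..} \<times> {0..<J}") simp_all
    qed
    also have "\<dots> = 2 * d k \<omega> + 2 * d' k \<omega>"
      unfolding d_def d'_def by (subst nn_integral_add) (auto simp: nn_integral_cmult)
    finally show ?thesis .
  qed
  have "(\<lambda>k. \<integral>\<^sup>+ \<omega>. 2 * d k \<omega> + 2 * d' k \<omega> \<partial>M) \<longlonglongrightarrow> 2 * 0 + 2 * 0"
  proof -
    have eq: "(\<integral>\<^sup>+ \<omega>. 2 * d k \<omega> + 2 * d' k \<omega> \<partial>M) = 2 * (\<integral>\<^sup>+ \<omega>. d k \<omega> \<partial>M) + 2 * (\<integral>\<^sup>+ \<omega>. d' k \<omega> \<partial>M)" for k
      by (simp add: nn_integral_add nn_integral_cmult)
    show ?thesis unfolding eq unfolding d_def d'_def \<phi>_def \<phi>'_def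
      by (intro tendsto_add ennreal_tendsto_cmult lim1 lim1' ennreal_numeral_less_top)
  qed
  then have U1: "(\<lambda>k. \<integral>\<^sup>+ \<omega>. 2 * d k \<omega> + 2 * d' k \<omega> \<partial>M) \<longlonglongrightarrow> 0"
    by (simp only: mult_zero_right add_0)
  have L1: "(\<lambda>k. \<integral>\<^sup>+ \<omega>. (\<integral>\<^sup>+ z\<in>{0..} \<times> {0..<J}. ennreal ((f z \<omega> - f' z \<omega> - (\<phi> k z \<omega> - \<phi>' k z \<omega>))\<^sup>2) \<partial>lborel) \<partial>M) \<longlonglongrightarrow> 0"
  proof (rule tendsto_sandwich[OF _ _ tendsto_const U1])
    show "\<forall>\<^sub>F k in sequentially. (\<integral>\<^sup>+ \<omega>. (\<integral>\<^sup>+ z\<in>{0..} \<times> {0..<J}.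
        ennreal ((f z \<omega> - f' z \<omega> - (\<phi> k z \<omega> - \<phi>' k z \<omega>))\<^sup>2) \<partial>lborel) \<partial>M) \<le> (\<integral>\<^sup>+ \<omega>. 2 * d k \<omega> + 2 * d' k \<omega> \<partial>M)"
      by (intro always_eventually allI nn_integral_mono strip_le)
  qed simp_all
  have "(\<lambda>k. \<integral>\<^sup>+ \<omega>. 2 * ennreal ((I \<omega> - S k \<omega>)\<^sup>2) + 2 * ennreal ((I' \<omega> - S' k \<omega>)\<^sup>2) \<partial>M) \<longlonglongrightarrow> 2 * 0 + 2 * 0"
  proof -
    have eq: "(\<integral>\<^sup>+ \<omega>. 2 * ennreal ((I \<omega> - S k \<omega>)\<^sup>2) + 2 * ennreal ((I' \<omega> - S' k \<omega>)\<^sup>2) \<partial>M)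
        = 2 * (\<integral>\<^sup>+ \<omega>. ennreal ((I \<omega> - S k \<omega>)\<^sup>2) \<partial>M) + 2 * (\<integral>\<^sup>+ \<omega>. ennreal ((I' \<omega> - S' k \<omega>)\<^sup>2) \<partial>M)" for k
      by (simp add: nn_integral_add nn_integral_cmult)
    show ?thesis unfolding eq unfolding S_def S'_def
      by (intro tendsto_add ennreal_tendsto_cmult lim2 lim2' ennreal_numeral_less_top)
  qed
  then have U2: "(\<lambda>k. \<integral>\<^sup>+ \<omega>. 2 * ennreal ((I \<omega> - S k \<omega>)\<^sup>2) + 2 * ennreal ((I' \<omega> - S' k \<omega>)\<^sup>2) \<partial>M) \<longlonglongrightarrow> 0"
    by (simp only: mult_zero_right add_0)
  have L2: "(\<lambda>k. \<integral>\<^sup>+ \<omega>. ennreal ((I \<omega> - I' \<omega> - (S k \<omega> - S' k \<omega>))\<^sup>2) \<partial>M) \<longlonglongrightarrow> 0"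
  proof (rule tendsto_sandwich[OF _ _ tendsto_const U2])
    have "ennreal ((I \<omega> - I' \<omega> - (S k \<omega> - S' k \<omega>))\<^sup>2) \<le> 2 * ennreal ((I \<omega> - S k \<omega>)\<^sup>2) + 2 * ennreal ((I' \<omega> - S' k \<omega>)\<^sup>2)" for k \<omega>
      using ennreal_square_diff_le[of "I \<omega> - S k \<omega>" "I' \<omega> - S' k \<omega>"] by (simp add: algebra_simps)
    then show "\<forall>\<^sub>F k in sequentially. (\<integral>\<^sup>+ \<omega>. ennreal ((I \<omega> - I' \<omega> - (S k \<omega> - S' k \<omega>))\<^sup>2) \<partial>M)
       \<le> (\<integral>\<^sup>+ \<omega>. 2 * ennreal ((I \<omega> - S k \<omega>)\<^sup>2) + 2 * ennreal ((I' \<omega> - S' k \<omega>)\<^sup>2) \<partial>M)"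
      by (intro always_eventually allI nn_integral_mono)
  qed simp_all
  have m: "(\<lambda>(z, \<omega>). f z \<omega> - f' z \<omega>) \<in> borel_measurable (lborel \<Otimes>\<^sub>M M)"
    using borel_measurable_diff[OF f f'] by (simp add: split_beta)
  have "(\<lambda>\<omega>. I \<omega> - I' \<omega>) \<in> borel_measurable M" by measurable
  moreover have "\<forall>k. simple_pred M J W (?n k) (a2 k) (b2 k) (B2 k) (X2 k)" using simple2 by blast
  moreover note L1[folded sf2] L2[folded si2]
  ultimately show ?thesis
    unfolding walsh_integral_def
    by - (rule conjI[OF m], rule conjI, assumption, rule exI[of _ ?n], rule exI[of _ a2], rule exI[of _ b2],
      rule exI[of _ B2], rule exI[of _ X2], intro conjI; assumption)
qed

end

section \<open>The periodised wave kernel\<close>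

text \<open>\<open>card\<close> is 0 on infinite sets, so finiteness is what makes \<open>SI\<close>
  count images and be monotone under inclusion.\<close>

lemma finite_SI_set:
  fixes J z t :: real
  assumes "J > 0"
  shows "finite {n::int. \<bar>z + of_int n * J\<bar> \<le> t}"
proof (rule finite_subset)
  show "{n::int. \<bar>z + of_int n * J\<bar> \<le> t} \<subseteq> {- \<lceil>(t + \<bar>z\<bar>) / J\<rceil>..\<lceil>(t + \<bar>z\<bar>) / J\<rceil>}"
  proof
    fix n :: int assume "n \<in> {n. \<bar>z + of_int n * J\<bar> \<le> t}"
    then have "\<bar>of_int n * J\<bar> \<le> t + \<bar>z\<bar>" by simp
    then have "\<bar>of_int n\<bar> \<le> (t + \<bar>z\<bar>) / J" using assms by (simp add: abs_mult field_simps)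
    then have "of_int \<bar>n\<bar> \<le> (t + \<bar>z\<bar>) / J" by simp
    then have "\<bar>n\<bar> \<le> \<lceil>(t + \<bar>z\<bar>) / J\<rceil>" by linarith
    then show "n \<in> {- \<lceil>(t + \<bar>z\<bar>) / J\<rceil>..\<lceil>(t + \<bar>z\<bar>) / J\<rceil>}" by auto
  qed
qed simp

lemma SI_nonneg: "SI J t z \<ge> 0"
  by (simp add: SI_def)

lemma SI_eq_0: "t < 0 \<Longrightarrow> SI J t z = 0"
proof -
  assume "t < 0"
  then have "{n::int. \<bar>z + of_int n * J\<bar> \<le> t} = {}"
    by (auto simp: not_le intro: less_le_trans)
  then show ?thesis by (simp add: SI_def)
qed

text \<open>By the triangle inequality every image seen from the inner light cone is seen from the
  outer one.\<close>

lemma SI_mono: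
  assumes "J > 0" "\<bar>z - z'\<bar> \<le> t - t'"
  shows "SI J t' z' \<le> SI J t z"
proof -
  have "card {n::int. \<bar>z' + of_int n * J\<bar> \<le> t'} \<le> card {n::int. \<bar>z + of_int n * J\<bar> \<le> t}"
    by (rule card_mono[OF finite_SI_set[OF assms(1)]]) (use assms in auto)
  then show ?thesis by (simp add: SI_def)
qed

lemma SI_ge_half:
  assumes "J > 0" "\<bar>z\<bar> \<le> t"
  shows "SI J t z \<ge> 1/2"
proof -
  have "0 \<in> {n::int. \<bar>z + of_int n * J\<bar> \<le> t}" using assms by simp
  then have "card {n::int. \<bar>z + of_int n * J\<bar> \<le> t} \<ge> 1"
    using finite_SI_set[OF assms(1)] by (metis One_nat_def Suc_leI card_gt_0_iff empty_iff)
  then show ?thesis by (simp add: SI_def)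
qed

text \<open>A range of images fixed in advance turns the count into a finite sum, which can be
  compared term by term at different points.\<close>

lemma SI_eq_sum:
  assumes "J > 0" "t + \<bar>z\<bar> \<le> of_int m * J"
  shows "SI J t z = (\<Sum>n\<in>{-m..m}. of_bool (\<bar>z + of_int n * J\<bar> \<le> t)) / 2"
proof -
  have "{n::int. \<bar>z + of_int n * J\<bar> \<le> t} = {-m..m} \<inter> {n. \<bar>z + of_int n * J\<bar> \<le> t}"
  proof safe
    fix n :: int assume "\<bar>z + of_int n * J\<bar> \<le> t"
    then have "\<bar>of_int n * J\<bar> \<le> of_int m * J" using assms by linarith
    then have "\<bar>of_int n\<bar> * J \<le> of_int m * J" using assms by (simp add: abs_mult)
    then have "of_int \<bar>n\<bar> \<le> (of_int m :: real)" using assms by (simp add: mult_le_cancel_right)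
    then have "\<bar>n\<bar> \<le> m" by linarith
    then show "n \<in> {-m..m}" by auto
  qed
  then show ?thesis by (simp add: SI_def)
qed

text \<open>The range of images depends on the point, but at each point the truncated sums are
  eventually constant.\<close>

lemma SI_measurable:
  assumes "J > 0" "p \<in> borel_measurable N" "q \<in> borel_measurable N"
  shows "(\<lambda>z. SI J (p z) (q z)) \<in> borel_measurable N"
proof (rule borel_measurable_LIMSEQ_real)
  show "(\<lambda>k. (\<Sum>n\<in>{- int k..int k}. of_bool (\<bar>q z + of_int n * J\<bar> \<le> p z)) / 2) \<longlonglongrightarrow> SI J (p z) (q z)" for z
  proof (rule tendsto_eventually, rule eventually_sequentiallyI)
    fix k assume k: "nat \<lceil>(p z + \<bar>q z\<bar>) / J\<rceil> \<le> k"
    then have "(p z + \<bar>q z\<bar>) / J \<le> of_int (int k)" by linarith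
    then have "p z + \<bar>q z\<bar> \<le> of_int (int k) * J" using assms(1) by (simp add: field_simps)
    from SI_eq_sum[OF assms(1) this]
    show "(\<Sum>n\<in>{- int k..int k}. of_bool (\<bar>q z + of_int n * J\<bar> \<le> p z)) / 2 = SI J (p z) (q z)" by simp
  qed
  have [measurable]: "p \<in> borel_measurable N" "q \<in> borel_measurable N" by fact+
  show "(\<lambda>z. (\<Sum>n\<in>{- int k..int k}. of_bool (\<bar>q z + of_int n * J\<bar> \<le> p z)) / 2 :: real) \<in> borel_measurable N" for k
    by measurable
qed

text \<open>Membership in an interval can change only when \<open>y\<close> lies between the two
  left or the two right endpoints. A flag that is off forces its interval to degenerate; a
  \<open>y\<close> counted by the other interval alone then still has an endpoint pair around
  it.\<close>

lemma interval_gap: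
  fixes y l u l' u' :: real
  assumes "\<not> P \<Longrightarrow> u \<le> l" "\<not> P' \<Longrightarrow> u' \<le> l'"
  shows "\<bar>of_bool (P \<and> l \<le> y \<and> y \<le> u) - of_bool (P' \<and> l' \<le> y \<and> y \<le> u')\<bar>
    \<le> (indicator {min l l'..max l l'} y + indicator {min u u'..max u u'} y :: real)"
  using assms by (cases P; cases P') (auto simp: indicator_def min_def max_def)

lemma average_diff_bound:
  fixes a b c :: real
  assumes "\<bar>a - a'\<bar> \<le> e" "\<bar>b - b'\<bar> \<le> e" "\<bar>c - c'\<bar> \<le> f"
  shows "\<bar>(a + b) / 2 + c - ((a' + b') / 2 + c')\<bar> \<le> e + f"
  using assms by (auto simp: abs_le_iff field_simps)

text \<open>The integer \<open>m\<close> is large enough that, up to time \<open>T\<close> and for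
  distances at most \<open>J\<close>, no image outside \<open>{-m..m}\<close> is seen.\<close>

locale wave_window =
  fixes J T :: real and m :: int
  assumes J_pos: "J > 0" and T_pos: "T > 0" and window: "T + J \<le> of_int m * J"
begin

text \<open>The number of images in the window. It serves both as a crude bound for the kernel and
  as the factor in the integral of \<open>gap\<close>.\<close>

definition \<kappa> :: real where "\<kappa> = 2 * of_int m + 1"

lemma m_pos: "m > 0"
proof -
  have "0 < of_int m * J" using window J_pos T_pos by linarith
  then show ?thesis using J_pos by (simp add: zero_less_mult_iff)
qed

lemma \<kappa>_ge_1: "\<kappa> \<ge> 1"
  using m_pos by (simp add: \<kappa>_def)

lemma SI_le:
  assumes "t \<le> T" "\<bar>z\<bar> \<le> J"
  shows "SI J t z \<le> \<kappa>"
proof -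
  have "SI J t z = (\<Sum>n\<in>{-m..m}. of_bool (\<bar>z + of_int n * J\<bar> \<le> t)) / 2"
    using assms window by (intro SI_eq_sum J_pos) linarith
  also have "\<dots> \<le> (\<Sum>n\<in>{-m..m}. 1) / 2"
    by (intro divide_right_mono sum_mono) auto
  also have "\<dots> \<le> \<kappa>" using m_pos by (simp add: \<kappa>_def)
  finally show ?thesis .
qed

text \<open>An explicit majorant for the difference of two kernels: half the number of image
  endpoints, left or right, that cross \<open>y\<close> when the first point is moved to the second.
  Its integral is linear in the distance of the points.\<close>

definition gap :: "real \<Rightarrow> real \<Rightarrow> real \<Rightarrow> real \<Rightarrow> real \<Rightarrow> real" where
  "gap t x t' x' y = (\<Sum>n\<in>{-m..m}.
      indicator {min (x - t + of_int n * J) (x' - t' + of_int n * J)..max (x - t + of_int n * J) (x' - t' + of_int n * J)} y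
    + indicator {min (x + t + of_int n * J) (x' + t' + of_int n * J)..max (x + t + of_int n * J) (x' + t' + of_int n * J)} y) / 2"

lemma gap_nonneg: "gap t x t' x' y \<ge> 0"
  by (auto simp: gap_def intro!: sum_nonneg divide_nonneg_nonneg)

text \<open>The flags cover two uses: the strict cut-off \<open>fst z < t\<close> of the stochastic
  integrand, and the plain kernel, where they are \<open>True\<close>.\<close>

lemma SI_diff_le_gap:
  assumes "t \<le> T" "t' \<le> T" "\<bar>x - y\<bar> \<le> J" "\<bar>x' - y\<bar> \<le> J" "\<not> P \<Longrightarrow> t \<le> 0" "\<not> P' \<Longrightarrow> t' \<le> 0"
  shows "\<bar>of_bool P * SI J t (x - y) - of_bool P' * SI J t' (x' - y)\<bar> \<le> gap t x t' x' y"
proof -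
  have eq: "of_bool P * SI J t (x - y) = (\<Sum>n\<in>{-m..m}. of_bool (P \<and> x - t + of_int n * J \<le> y \<and> y \<le> x + t + of_int n * J)) / 2"
    if "t \<le> T" "\<bar>x - y\<bar> \<le> J" for P t x
  proof -
    have "SI J t (x - y) = (\<Sum>n\<in>{-m..m}. of_bool (\<bar>x - y + of_int n * J\<bar> \<le> t)) / 2"
      using that window by (intro SI_eq_sum J_pos) linarith
    then have "of_bool P * SI J t (x - y) = (\<Sum>n\<in>{-m..m}. of_bool P * of_bool (\<bar>x - y + of_int n * J\<bar> \<le> t)) / 2"
      by (simp add: sum_distrib_left)
    also have "\<dots> = (\<Sum>n\<in>{-m..m}. of_bool (P \<and> x - t + of_int n * J \<le> y \<and> y \<le> x + t + of_int n * J)) / 2"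
      by (intro arg_cong2[where f = "(/)"] sum.cong refl) (auto simp: of_bool_def abs_le_iff)
    finally show ?thesis .
  qed
  show ?thesis
    unfolding eq[OF assms(1,3)] eq[OF assms(2,4)] diff_divide_distrib[symmetric] sum_subtractf[symmetric]
      abs_divide gap_def abs_numeral
    using assms(5,6)
    by (intro divide_right_mono order_trans[OF sum_abs] sum_mono interval_gap) auto
qed

lemma gap_nn_integral:
  "(\<integral>\<^sup>+y. ennreal (gap t x t' x' y) \<partial>lborel) \<le> ennreal (\<kappa> * (\<bar>t - t'\<bar> + \<bar>x - x'\<bar>))"
proof -
  have seg: "(\<integral>\<^sup>+y. ennreal (indicator {min a b..max a b} y) \<partial>lborel) = ennreal \<bar>a - b\<bar>" for a b :: real
    by (simp add: ennreal_indicator min_def max_def)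
  let ?f = "\<lambda>n::int. \<lambda>y. indicator {min (x - t + of_int n * J) (x' - t' + of_int n * J)..max (x - t + of_int n * J) (x' - t' + of_int n * J)} y :: real"
  let ?g = "\<lambda>n::int. \<lambda>y. indicator {min (x + t + of_int n * J) (x' + t' + of_int n * J)..max (x + t + of_int n * J) (x' + t' + of_int n * J)} y :: real"
  have "(\<integral>\<^sup>+y. ennreal (gap t x t' x' y) \<partial>lborel) = (\<integral>\<^sup>+y. ennreal (1/2) * (\<Sum>n\<in>{-m..m}. ennreal (?f n y) + ennreal (?g n y)) \<partial>lborel)"
  proof (intro nn_integral_cong)
    fix y
    have "gap t x t' x' y = (1/2) * (\<Sum>n\<in>{-m..m}. ?f n y + ?g n y)" by (simp add: gap_def)
    then have "ennreal (gap t x t' x' y) = ennreal (1/2) * ennreal (\<Sum>n\<in>{-m..m}. ?f n y + ?g n y)"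
      by (simp only:) (rule ennreal_mult, auto intro!: sum_nonneg)
    also have "ennreal (\<Sum>n\<in>{-m..m}. ?f n y + ?g n y) = (\<Sum>n\<in>{-m..m}. ennreal (?f n y + ?g n y))"
      by (rule sum_ennreal[symmetric]) auto
    also have "\<dots> = (\<Sum>n\<in>{-m..m}. ennreal (?f n y) + ennreal (?g n y))"
      by (intro sum.cong refl ennreal_plus) auto
    finally show "ennreal (gap t x t' x' y) = ennreal (1/2) * (\<Sum>n\<in>{-m..m}. ennreal (?f n y) + ennreal (?g n y))" .
  qed
  also have "\<dots> = ennreal (1/2) * (\<Sum>n\<in>{-m..m}. (\<integral>\<^sup>+y. ennreal (?f n y) \<partial>lborel) + (\<integral>\<^sup>+y. ennreal (?g n y) \<partial>lborel))"
    by (simp add: nn_integral_cmult nn_integral_sum nn_integral_add)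
  also have "\<dots> = ennreal (1/2) * (\<Sum>n\<in>{-m..m}. ennreal (\<bar>(x - t) - (x' - t')\<bar> + \<bar>(x + t) - (x' + t')\<bar>))"
    unfolding seg by (simp add: ennreal_plus)
  also have "\<dots> = ennreal (1/2 * (\<Sum>n\<in>{-m..m}. (\<bar>(x - t) - (x' - t')\<bar> + \<bar>(x + t) - (x' + t')\<bar>)))"
    by (subst sum_ennreal, simp, subst ennreal_mult) (auto intro!: sum_nonneg simp del: sum_constant)
  also have "\<dots> \<le> ennreal (1/2 * (\<Sum>n\<in>{-m..m}. 2 * (\<bar>t - t'\<bar> + \<bar>x - x'\<bar>)))"
  proof -
    have eq: "x - t - (x' - t') = (x - x') - (t - t')" "x + t - (x' + t') = (x - x') + (t - t')" by simp_all
    have "\<bar>(x - t) - (x' - t')\<bar> + \<bar>(x + t) - (x' + t')\<bar> \<le> 2 * (\<bar>t - t'\<bar> + \<bar>x - x'\<bar>)"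
      unfolding eq using add_mono[OF abs_triangle_ineq4[of "x - x'" "t - t'"] abs_triangle_ineq[of "x - x'" "t - t'"]]
      by (simp add: algebra_simps)
    then show ?thesis by (intro ennreal_leI mult_left_mono sum_mono) auto
  qed
  also have "1/2 * (\<Sum>n\<in>{-m..m}. 2 * (\<bar>t - t'\<bar> + \<bar>x - x'\<bar>)) = \<kappa> * (\<bar>t - t'\<bar> + \<bar>x - x'\<bar>)"
    using m_pos by (simp add: \<kappa>_def)
  finally show ?thesis .
qed

lemma gap_measurable: "(\<lambda>z. gap (t - fst z) x (t' - fst z) x' (snd z)) \<in> borel_measurable (borel :: (real \<times> real) measure)"
  unfolding gap_def indicator_def atLeastAtMost_iff borel_prod[symmetric] by measurable

lemma box_measurable: "{0..T} \<times> {0..J} \<in> sets (borel :: (real \<times> real) measure)"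
  by (simp add: borel_prod[symmetric])

text \<open>Subtracting the same time from \<open>t\<close> and \<open>t'\<close> leaves their
  difference unchanged, so every time slice obeys one bound and integration over time contributes
  the factor \<open>T\<close>.\<close>

lemma gap_nn_integral_box:
  "(\<integral>\<^sup>+z\<in>{0..T} \<times> {0..J}. ennreal (gap (t - fst z) x (t' - fst z) x' (snd z)) \<partial>lborel) \<le> ennreal (T * (\<kappa> * (\<bar>t - t'\<bar> + \<bar>x - x'\<bar>)))"
proof -
  let ?h = "\<lambda>z. ennreal (gap (t - fst z) x (t' - fst z) x' (snd z)) * indicator {0..T} (fst z)"
  have m: "?h \<in> borel_measurable (lborel \<Otimes>\<^sub>M lborel)"
  proof -
    have [measurable]: "(\<lambda>z. gap (t - fst z) x (t' - fst z) x' (snd z)) \<in> borel_measurable (borel \<Otimes>\<^sub>M borel)"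
      using gap_measurable by (simp add: borel_prod)
    have "?h \<in> borel_measurable (borel \<Otimes>\<^sub>M borel)" by measurable
    then show ?thesis by (simp add: lborel_prod borel_prod)
  qed
  have "(\<integral>\<^sup>+z\<in>{0..T} \<times> {0..J}. ennreal (gap (t - fst z) x (t' - fst z) x' (snd z)) \<partial>lborel) \<le> (\<integral>\<^sup>+z. ?h z \<partial>lborel)"
    by (intro nn_integral_mono) (auto simp: indicator_def)
  also have "\<dots> = (\<integral>\<^sup>+s. \<integral>\<^sup>+y. ?h (s, y) \<partial>lborel \<partial>lborel)"
    unfolding lborel_prod[symmetric] by (rule lborel.nn_integral_fst[OF m, symmetric])
  also have "\<dots> \<le> (\<integral>\<^sup>+s. ennreal (\<kappa> * (\<bar>t - t'\<bar> + \<bar>x - x'\<bar>)) * indicator {0..T} s \<partial>lborel)"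
  proof (intro nn_integral_mono)
    fix s
    have "(\<integral>\<^sup>+y. ennreal (gap (t - s) x (t' - s) x' y) \<partial>lborel) \<le> ennreal (\<kappa> * (\<bar>t - t'\<bar> + \<bar>x - x'\<bar>))"
      using gap_nn_integral[of "t - s" x "t' - s" x'] by simp
    then show "(\<integral>\<^sup>+y. ?h (s, y) \<partial>lborel) \<le> ennreal (\<kappa> * (\<bar>t - t'\<bar> + \<bar>x - x'\<bar>)) * indicator {0..T} s"
      by (cases "s \<in> {0..T}") auto
  qed
  also have "\<dots> = ennreal (T * (\<kappa> * (\<bar>t - t'\<bar> + \<bar>x - x'\<bar>)))"
    using T_pos \<kappa>_ge_1 by (subst nn_integral_cmult_indicator) (auto simp: ennreal_mult[symmetric] mult_ac)
  finally show ?thesis .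
qed

definition wave_kernel :: "real \<Rightarrow> real \<Rightarrow> real \<times> real \<Rightarrow> real" where
  "wave_kernel t x z = (if fst z < t then SI J (t - fst z) (x - snd z) else 0)"

text \<open>A difference bounded by both \<open>\<kappa>\<close> and \<open>gap\<close> has its
  square bounded by \<open>\<kappa>\<close> times \<open>gap\<close>. The squared norm is thus
  linear in the distance, which is why the stochastic convolution has Hoelder exponents up to
  1/2.\<close>

lemma wave_kernel_diff_sq:
  assumes "t \<in> {0..T}" "t' \<in> {0..T}" "x \<in> {0..J}" "x' \<in> {0..J}"
  shows "(\<integral>\<^sup>+z\<in>{0..} \<times> {0..<J}. ennreal ((wave_kernel t x z - wave_kernel t' x' z)\<^sup>2) \<partial>lborel)
    \<le> ennreal (\<kappa>\<^sup>2 * T * (\<bar>t - t'\<bar> + \<bar>x - x'\<bar>))"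
proof -
  have "(\<integral>\<^sup>+z\<in>{0..} \<times> {0..<J}. ennreal ((wave_kernel t x z - wave_kernel t' x' z)\<^sup>2) \<partial>lborel)
    \<le> (\<integral>\<^sup>+z. ennreal \<kappa> * (ennreal (gap (t - fst z) x (t' - fst z) x' (snd z)) * indicator ({0..T} \<times> {0..J}) z) \<partial>lborel)"
  proof (intro nn_integral_mono)
    fix z :: "real \<times> real"
    let ?d = "wave_kernel t x z - wave_kernel t' x' z"
    show "ennreal (?d\<^sup>2) * indicator ({0..} \<times> {0..<J}) z
      \<le> ennreal \<kappa> * (ennreal (gap (t - fst z) x (t' - fst z) x' (snd z)) * indicator ({0..T} \<times> {0..J}) z)"
    proof (cases "z \<in> {0..} \<times> {0..<J}")
      case z: True
      show ?thesis
      proof (cases "fst z \<le> T")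
        case True
        have y: "\<bar>x - snd z\<bar> \<le> J" "\<bar>x' - snd z\<bar> \<le> J" using z assms by auto
        have s: "t - fst z \<le> T" "t' - fst z \<le> T" using z assms by auto
        have k: "wave_kernel t x z = of_bool (fst z < t) * SI J (t - fst z) (x - snd z)" for t x
          by (simp add: wave_kernel_def)
        have g: "\<bar>?d\<bar> \<le> gap (t - fst z) x (t' - fst z) x' (snd z)"
          unfolding k by (rule SI_diff_le_gap[OF s y]) auto
        have bd: "0 \<le> wave_kernel t x z" "wave_kernel t x z \<le> \<kappa>" "0 \<le> wave_kernel t' x' z" "wave_kernel t' x' z \<le> \<kappa>"
          using SI_le[OF s(1) y(1)] SI_le[OF s(2) y(2)] \<kappa>_ge_1 by (auto simp: wave_kernel_def SI_nonneg)
        then have "\<bar>?d\<bar> \<le> \<kappa>" by linarith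
        then have "\<bar>?d\<bar> * \<bar>?d\<bar> \<le> \<kappa> * gap (t - fst z) x (t' - fst z) x' (snd z)"
          using g \<kappa>_ge_1 by (intro mult_mono) auto
        then have "?d\<^sup>2 \<le> \<kappa> * gap (t - fst z) x (t' - fst z) x' (snd z)" by (simp add: power2_eq_square)
        then have "ennreal (?d\<^sup>2) \<le> ennreal \<kappa> * ennreal (gap (t - fst z) x (t' - fst z) x' (snd z))"
          using \<kappa>_ge_1 by (subst ennreal_mult[symmetric]) (auto intro: ennreal_leI gap_nonneg)
        moreover have "z \<in> {0..T} \<times> {0..J}" using z True by auto
        ultimately show ?thesis using z by simp
      next
        case False
        then have "wave_kernel t x z = 0" "wave_kernel t' x' z = 0" using assms by (auto simp: wave_kernel_def)
        then show ?thesis by simp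
      qed
    qed simp
  qed
  also have "\<dots> = ennreal \<kappa> * (\<integral>\<^sup>+z\<in>{0..T} \<times> {0..J}. ennreal (gap (t - fst z) x (t' - fst z) x' (snd z)) \<partial>lborel)"
    using gap_measurable borel_measurable_indicator[OF box_measurable]
    by (intro nn_integral_cmult borel_measurable_times_ennreal) auto
  also have "\<dots> \<le> ennreal \<kappa> * ennreal (T * (\<kappa> * (\<bar>t - t'\<bar> + \<bar>x - x'\<bar>)))"
    by (intro mult_left_mono gap_nn_integral_box) auto
  also have "\<dots> = ennreal (\<kappa>\<^sup>2 * T * (\<bar>t - t'\<bar> + \<bar>x - x'\<bar>))"
    using \<kappa>_ge_1 T_pos by (simp add: ennreal_mult[symmetric] power2_eq_square mult_ac)
  finally show ?thesis .
qed

text \<open>The d'Alembert average inherits the modulus of \<open>u0\<close>. The velocity part is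
  Lipschitz, since the bounded \<open>u1\<close> is integrated against a kernel whose change is
  dominated by \<open>gap\<close>.\<close>

lemma wave_init_diff:
  assumes u0: "\<And>a b. \<bar>u0 a - u0 b\<bar> \<le> C * sqrt \<bar>a - b\<bar>"
    and u1: "\<And>y. y \<in> {0..J} \<Longrightarrow> \<bar>u1 y\<bar> \<le> B" "continuous_on {0..J} u1"
    and p: "t \<in> {0..T}" "t' \<in> {0..T}" "x \<in> {0..J}" "x' \<in> {0..J}"
  shows "\<bar>wave_init J u0 u1 t x - wave_init J u0 u1 t' x'\<bar>
    \<le> C * sqrt (\<bar>t - t'\<bar> + \<bar>x - x'\<bar>) + B * \<kappa> * (\<bar>t - t'\<bar> + \<bar>x - x'\<bar>)"
proof -
  define d where "d = \<bar>t - t'\<bar> + \<bar>x - x'\<bar>"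
  have C: "C \<ge> 0" using u0[of 0 1] abs_ge_zero[of "u0 0 - u0 1"] by simp
  have B: "B \<ge> 0" using u1(1)[of 0] J_pos by auto
  have 1: "\<bar>u0 (x + t) - u0 (x' + t')\<bar> \<le> C * sqrt d"
    by (rule order_trans[OF u0]) (use C in \<open>auto simp: d_def intro!: mult_left_mono\<close>)
  have 2: "\<bar>u0 (x - t) - u0 (x' - t')\<bar> \<le> C * sqrt d"
    by (rule order_trans[OF u0]) (use C in \<open>auto simp: d_def intro!: mult_left_mono\<close>)
  have int: "integrable lborel (\<lambda>y. indicator {0..J} y *\<^sub>R (SI J t (x - y) * u1 y))"
    if p: "t \<in> {0..T}" "x \<in> {0..J}" for t x
  proof (rule Bochner_Integration.integrable_bound[of _ "\<lambda>y. (\<kappa> * B) * indicator {0..J} y"])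
    show "integrable lborel (\<lambda>y. (\<kappa> * B) * indicator {0..J} y :: real)"
      using J_pos by (intro integrable_mult_right) (simp add: integrable_indicator_iff)
    have "(\<lambda>y. indicator {0..J} y *\<^sub>R u1 y) \<in> borel_measurable lborel"
      using borel_measurable_continuous_on_indicator[OF _ u1(2)] by simp
    moreover have "(\<lambda>y. SI J t (x - y)) \<in> borel_measurable lborel"
      by (intro SI_measurable J_pos) auto
    ultimately have "(\<lambda>y. SI J t (x - y) * (indicator {0..J} y *\<^sub>R u1 y)) \<in> borel_measurable lborel"
      by (rule borel_measurable_times[rotated])
    then show "(\<lambda>y. indicator {0..J} y *\<^sub>R (SI J t (x - y) * u1 y)) \<in> borel_measurable lborel"
      by (simp add: mult_ac)
    show "AE y in lborel. norm (indicator {0..J} y *\<^sub>R (SI J t (x - y) * u1 y)) \<le> norm ((\<kappa> * B) * indicator {0..J} y)"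
    proof (rule AE_I2)
      fix y
      show "norm (indicator {0..J} y *\<^sub>R (SI J t (x - y) * u1 y)) \<le> norm ((\<kappa> * B) * indicator {0..J} y)"
      proof (cases "y \<in> {0..J}")
        case True
        then have "SI J t (x - y) \<le> \<kappa>" using p by (intro SI_le) auto
        then have "\<bar>SI J t (x - y)\<bar> * \<bar>u1 y\<bar> \<le> \<kappa> * B"
          using u1(1)[OF True] \<kappa>_ge_1 by (intro mult_mono) (auto simp: SI_nonneg)
        then show ?thesis using True B \<kappa>_ge_1 by (simp add: abs_mult)
      qed simp
    qed
  qed
  have 3: "\<bar>(LINT y:{0..J}|lborel. SI J t (x - y) * u1 y) - (LINT y:{0..J}|lborel. SI J t' (x' - y) * u1 y)\<bar> \<le> B * \<kappa> * d"
  proof -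
    let ?D = "\<lambda>y. indicator {0..J} y *\<^sub>R (SI J t (x - y) * u1 y) - indicator {0..J} y *\<^sub>R (SI J t' (x' - y) * u1 y)"
    have intD: "integrable lborel ?D" using p by (intro Bochner_Integration.integrable_diff int) auto
    have "ennreal \<bar>(LINT y:{0..J}|lborel. SI J t (x - y) * u1 y) - (LINT y:{0..J}|lborel. SI J t' (x' - y) * u1 y)\<bar>
       = ennreal (norm (LINT y|lborel. ?D y))"
      unfolding set_lebesgue_integral_def
      by (subst Bochner_Integration.integral_diff[OF int[OF p(1,3)] int[OF p(2,4)]]) simp
    also have "\<dots> \<le> (\<integral>\<^sup>+y. ennreal (norm (?D y)) \<partial>lborel)"
      by (rule integral_norm_bound_ennreal[OF intD])
    also have "\<dots> \<le> (\<integral>\<^sup>+y. ennreal B * ennreal (gap t x t' x' y) \<partial>lborel)"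
    proof (intro nn_integral_mono)
      fix y
      have "norm (?D y) \<le> B * gap t x t' x' y"
      proof (cases "y \<in> {0..J}")
        case True
        have "\<bar>of_bool True * SI J t (x - y) - of_bool True * SI J t' (x' - y)\<bar> \<le> gap t x t' x' y"
          using p True by (intro SI_diff_le_gap) auto
        then have "\<bar>SI J t (x - y) - SI J t' (x' - y)\<bar> * \<bar>u1 y\<bar> \<le> gap t x t' x' y * B"
          using u1(1)[OF True] gap_nonneg by (intro mult_mono) auto
        then have "\<bar>SI J t (x - y) * u1 y - SI J t' (x' - y) * u1 y\<bar> \<le> B * gap t x t' x' y"
          unfolding abs_mult[symmetric] left_diff_distrib by (simp only: mult.commute[of _ B])
        then show ?thesis using True by simp
      qed (use B gap_nonneg in simp)
      then show "ennreal (norm (?D y)) \<le> ennreal B * ennreal (gap t x t' x' y)"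
        using B by (simp add: ennreal_mult[symmetric] gap_nonneg ennreal_leI)
    qed
    also have "\<dots> = ennreal B * (\<integral>\<^sup>+y. ennreal (gap t x t' x' y) \<partial>lborel)"
      by (rule nn_integral_cmult) (simp add: gap_def)
    also have "\<dots> \<le> ennreal B * ennreal (\<kappa> * d)"
      unfolding d_def by (intro mult_left_mono gap_nn_integral) auto
    also have "\<dots> = ennreal (B * \<kappa> * d)" using B \<kappa>_ge_1 by (simp add: ennreal_mult[symmetric] d_def mult_ac)
    finally show ?thesis using B \<kappa>_ge_1 by (subst (asm) ennreal_le_iff) (auto simp: d_def)
  qed
  show ?thesis
    unfolding wave_init_def d_def[symmetric] by (rule average_diff_bound[OF 1 2 3])
qed

section \<open>Regularity, monotonicity and growth of the drift term\<close>

definition drift :: "(real \<times> real \<Rightarrow> real) \<Rightarrow> real \<Rightarrow> real \<Rightarrow> real" where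
  "drift U t x = (LINT z:{0..t} \<times> {0..J}|lborel. SI J (t - fst z) (x - snd z) * U z)"

context
  fixes U :: "real \<times> real \<Rightarrow> real" and B :: real
  assumes U_cont: "continuous_on ({0..} \<times> {0..J}) U"
    and U_bound: "\<And>z. z \<in> {0..} \<times> {0..J} \<Longrightarrow> 0 \<le> U z \<and> U z \<le> B"
begin

lemma B_nonneg: "B \<ge> 0"
  using U_bound[of "(0, 0)"] J_pos by auto

text \<open>The domain reaches up to \<open>T\<close> for every \<open>t\<close>. The kernel
  vanishes at negative times, so the integral is the same, and drifts at different times become
  comparable pointwise.\<close>

definition drift_density :: "real \<Rightarrow> real \<Rightarrow> real \<times> real \<Rightarrow> real" where
  "drift_density t x z = indicator ({0..T} \<times> {0..J}) z *\<^sub>R (SI J (t - fst z) (x - snd z) * U z)"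

lemma drift_density_integrable:
  assumes p: "t \<in> {0..T}" "x \<in> {0..J}"
  shows "integrable lborel (drift_density t x)"
proof (rule Bochner_Integration.integrable_bound[of _ "\<lambda>z. (\<kappa> * B) * indicator ({0..T} \<times> {0..J}) z"])
  have "({0..T} \<times> {0..J}) = cbox (0, 0) (T, J)" by (auto simp: cbox_Pair_eq)
  then show "integrable lborel (\<lambda>z. (\<kappa> * B) * indicator ({0..T} \<times> {0..J}) z :: real)"
    by (intro integrable_mult_right) (simp add: integrable_indicator_iff emeasure_lborel_cbox_eq)
  have "continuous_on ({0..T} \<times> {0..J}) U" using U_cont by (rule continuous_on_subset) auto
  then have "(\<lambda>z. indicator ({0..T} \<times> {0..J}) z *\<^sub>R U z) \<in> borel_measurable lborel"
    using borel_measurable_continuous_on_indicator[OF box_measurable, of U] by simp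
  moreover have "(\<lambda>z. SI J (t - fst z) (x - snd z)) \<in> borel_measurable (lborel :: (real \<times> real) measure)"
    by (intro SI_measurable J_pos) (simp_all add: borel_prod[symmetric])
  ultimately have "(\<lambda>z. SI J (t - fst z) (x - snd z) * (indicator ({0..T} \<times> {0..J}) z *\<^sub>R U z)) \<in> borel_measurable lborel"
    by (rule borel_measurable_times[rotated])
  then show "drift_density t x \<in> borel_measurable lborel"
    unfolding drift_density_def[abs_def] by (simp add: mult_ac)
  show "AE z in lborel. norm (drift_density t x z) \<le> norm ((\<kappa> * B) * indicator ({0..T} \<times> {0..J}) z)"
  proof (rule AE_I2)
    fix z
    show "norm (drift_density t x z) \<le> norm ((\<kappa> * B) * indicator ({0..T} \<times> {0..J}) z)"
    proof (cases "z \<in> {0..T} \<times> {0..J}")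
      case True
      then have "SI J (t - fst z) (x - snd z) \<le> \<kappa>" using p by (intro SI_le) auto
      moreover have "0 \<le> U z" "U z \<le> B" using U_bound[of z] True by auto
      ultimately have "SI J (t - fst z) (x - snd z) * U z \<le> \<kappa> * B"
        using \<kappa>_ge_1 by (intro mult_mono) (auto simp: SI_nonneg)
      then show ?thesis using True B_nonneg \<kappa>_ge_1 \<open>0 \<le> U z\<close> by (simp add: drift_density_def SI_nonneg)
    qed (simp add: drift_density_def)
  qed
qed

lemma drift_eq:
  assumes "t \<in> {0..T}"
  shows "drift U t x = (LINT z|lborel. drift_density t x z)"
proof -
  have "indicator ({0..t} \<times> {0..J}) z *\<^sub>R (SI J (t - fst z) (x - snd z) * U z) = drift_density t x z" for z
  proof (cases "fst z \<le> t")
    case True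
    then show ?thesis using assms by (auto simp: drift_density_def indicator_def mem_Times_iff)
  next
    case False
    then show ?thesis using SI_eq_0[of "t - fst z" J] by (simp add: drift_density_def)
  qed
  then show ?thesis by (simp add: drift_def set_lebesgue_integral_def)
qed

lemma drift_nonneg: "drift U t x \<ge> 0"
  unfolding drift_def set_lebesgue_integral_def
  by (rule Bochner_Integration.integral_nonneg) (use U_bound in \<open>auto simp: indicator_def SI_nonneg\<close>)

text \<open>In the application \<open>B\<close> is a power of \<open>N\<close>, so this is used only
  for qualitative continuity and enters no estimate that has to be uniform in
  \<open>N\<close>.\<close>

lemma drift_lipschitz:
  assumes p: "t \<in> {0..T}" "t' \<in> {0..T}" "x \<in> {0..J}" "x' \<in> {0..J}"
  shows "\<bar>drift U t x - drift U t' x'\<bar> \<le> B * T * \<kappa> * (\<bar>t - t'\<bar> + \<bar>x - x'\<bar>)"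
proof -
  let ?D = "\<lambda>z. drift_density t x z - drift_density t' x' z"
  have intD: "integrable lborel ?D" using p by (intro Bochner_Integration.integrable_diff drift_density_integrable) auto
  have "ennreal \<bar>drift U t x - drift U t' x'\<bar> = ennreal (norm (LINT z|lborel. ?D z))"
    using p by (simp add: drift_eq drift_density_integrable)
  also have "\<dots> \<le> (\<integral>\<^sup>+z. ennreal (norm (?D z)) \<partial>lborel)"
    by (rule integral_norm_bound_ennreal[OF intD])
  also have "\<dots> \<le> (\<integral>\<^sup>+z. ennreal B * (ennreal (gap (t - fst z) x (t' - fst z) x' (snd z)) * indicator ({0..T} \<times> {0..J}) z) \<partial>lborel)"
  proof (intro nn_integral_mono)
    fix z
    show "ennreal (norm (?D z)) \<le> ennreal B * (ennreal (gap (t - fst z) x (t' - fst z) x' (snd z)) * indicator ({0..T} \<times> {0..J}) z)"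
    proof (cases "z \<in> {0..T} \<times> {0..J}")
      case True
      have "\<bar>of_bool True * SI J (t - fst z) (x - snd z) - of_bool True * SI J (t' - fst z) (x' - snd z)\<bar> \<le> gap (t - fst z) x (t' - fst z) x' (snd z)"
        using p True by (intro SI_diff_le_gap) auto
      moreover have "\<bar>U z\<bar> \<le> B" using U_bound[of z] True by auto
      ultimately have "\<bar>SI J (t - fst z) (x - snd z) - SI J (t' - fst z) (x' - snd z)\<bar> * \<bar>U z\<bar> \<le> gap (t - fst z) x (t' - fst z) x' (snd z) * B"
        using gap_nonneg by (intro mult_mono) auto
      then have "norm (?D z) \<le> B * gap (t - fst z) x (t' - fst z) x' (snd z)"
        using True by (simp add: drift_density_def abs_mult[symmetric] left_diff_distrib mult.commute[of _ B])
      then show ?thesis using True B_nonneg by (simp add: ennreal_mult[symmetric] gap_nonneg ennreal_leI)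
    qed (simp add: drift_density_def)
  qed
  also have "\<dots> = ennreal B * (\<integral>\<^sup>+z\<in>{0..T} \<times> {0..J}. ennreal (gap (t - fst z) x (t' - fst z) x' (snd z)) \<partial>lborel)"
    using gap_measurable borel_measurable_indicator[OF box_measurable]
    by (intro nn_integral_cmult borel_measurable_times_ennreal) auto
  also have "\<dots> \<le> ennreal B * ennreal (T * (\<kappa> * (\<bar>t - t'\<bar> + \<bar>x - x'\<bar>)))"
    by (intro mult_left_mono gap_nn_integral_box) auto
  also have "\<dots> = ennreal (B * T * \<kappa> * (\<bar>t - t'\<bar> + \<bar>x - x'\<bar>))"
    using B_nonneg \<kappa>_ge_1 T_pos by (simp add: ennreal_mult[symmetric] mult_ac)
  finally show ?thesis using B_nonneg \<kappa>_ge_1 T_pos by (subst (asm) ennreal_le_iff) auto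
qed

text \<open>Backward light cones are nested along forward ones, and the density is
  nonnegative.\<close>

lemma drift_mono:
  assumes p: "t \<in> {0..T}" "t' \<in> {0..T}" "x \<in> {0..J}" "x' \<in> {0..J}" and cone: "\<bar>x - x'\<bar> \<le> t - t'"
  shows "drift U t' x' \<le> drift U t x"
  unfolding drift_eq[OF p(1)] drift_eq[OF p(2)]
proof (rule integral_mono)
  show "integrable lborel (drift_density t' x')" "integrable lborel (drift_density t x)"
    using p by (auto intro: drift_density_integrable)
  fix z
  have "SI J (t' - fst z) (x' - snd z) \<le> SI J (t - fst z) (x - snd z)"
    by (rule SI_mono[OF J_pos]) (use cone in simp)
  then show "drift_density t' x' z \<le> drift_density t x z"
    using U_bound[of z] by (auto simp: drift_density_def indicator_def intro!: mult_right_mono)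
qed

text \<open>The box of times \<open>{t - 3*r/4..t - r/2}\<close> and width \<open>r/2\<close> lies
  in the backward cone of \<open>(t, x)\<close>, where the kernel is at least 1/2, and strictly
  after time \<open>t - r\<close>, so the earlier drift does not see it. Its area is
  \<open>r\<^sup>2 / 8\<close>, whence the factor 1/16. The left end \<open>c\<close> is a parameter
  so that the box can be kept inside \<open>{0..J}\<close>.\<close>

lemma drift_gain:
  assumes t: "t \<in> {0..T}" "r > 0" "t - r \<ge> 0" and x: "x \<in> {0..J}"
    and c: "0 \<le> c" "c + r/2 \<le> J" "c \<le> x" "x \<le> c + r/2"
    and \<beta>: "\<beta> \<ge> 0" "\<And>s y. s \<in> {t - 3*r/4..t - r/2} \<Longrightarrow> y \<in> {c..c + r/2} \<Longrightarrow> \<beta> \<le> U (s, y)"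
  shows "drift U (t - r) x + \<beta> * r\<^sup>2 / 16 \<le> drift U t x"
proof -
  define Q where "Q = cbox (t - 3*r/4, c) (t - r/2, c + r/2)"
  have Q: "measure lborel Q = r/4 * (r/2)"
    using t(2) unfolding Q_def by (subst content_Pair) (simp add: field_simps)
  have intQ: "integrable lborel (\<lambda>z. \<beta>/2 * indicator Q z :: real)"
    unfolding Q_def by (intro integrable_mult_right) (simp add: integrable_indicator_iff emeasure_lborel_cbox_eq)
  have p: "t - r \<in> {0..T}" using t by auto
  have "(LINT z|lborel. drift_density (t - r) x z + \<beta>/2 * indicator Q z) \<le> (LINT z|lborel. drift_density t x z)"
  proof (rule integral_mono)
    show "integrable lborel (\<lambda>z. drift_density (t - r) x z + \<beta>/2 * indicator Q z)"
      using intQ drift_density_integrable[OF p x] by (rule Bochner_Integration.integrable_add[rotated])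
    show "integrable lborel (drift_density t x)" by (rule drift_density_integrable[OF t(1) x])
    fix z
    show "drift_density (t - r) x z + \<beta>/2 * indicator Q z \<le> drift_density t x z"
    proof (cases "z \<in> Q")
      case True
      then have z: "fst z \<in> {t - 3*r/4..t - r/2}" "snd z \<in> {c..c + r/2}"
        unfolding Q_def by (cases z, auto simp: cbox_Pair_eq)+
      then have zb: "z \<in> {0..T} \<times> {0..J}" using t c by (auto simp: mem_Times_iff)
      have "SI J (t - r - fst z) (x - snd z) = 0" using z t(2) by (intro SI_eq_0) auto
      moreover have "1/2 \<le> SI J (t - fst z) (x - snd z)" using z c by (intro SI_ge_half J_pos) auto
      moreover have "\<beta> \<le> U z" using \<beta>(2)[OF z] by simp
      ultimately have "SI J (t - r - fst z) (x - snd z) = 0" "1/2 * \<beta> \<le> SI J (t - fst z) (x - snd z) * U z"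
        using \<beta>(1) mult_mono[of "1/2" "SI J (t - fst z) (x - snd z)" \<beta> "U z"] by (simp_all add: SI_nonneg)
      then show ?thesis using True zb by (simp add: drift_density_def)
    next
      case False
      have "SI J (t - r - fst z) (x - snd z) \<le> SI J (t - fst z) (x - snd z)"
        by (rule SI_mono[OF J_pos]) (use t in simp)
      then show ?thesis using False
        using U_bound[of z] by (auto simp: drift_density_def indicator_def intro!: mult_right_mono)
    qed
  qed
  also have "(LINT z|lborel. drift_density (t - r) x z + \<beta>/2 * indicator Q z)
      = (LINT z|lborel. drift_density (t - r) x z) + \<beta>/2 * measure lborel Q"
    using intQ drift_density_integrable[OF p x] by (subst Bochner_Integration.integral_add) auto
  finally show ?thesis unfolding drift_eq[OF t(1)] drift_eq[OF p] Q by (simp add: power2_eq_square)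
qed

end
end

section \<open>Chaining on dyadic grids\<close>

lemma nat_floor_double:
  fixes z :: real
  assumes "z \<ge> 0"
  shows "nat \<lfloor>2 * z\<rfloor> = 2 * nat \<lfloor>z\<rfloor> \<or> nat \<lfloor>2 * z\<rfloor> = Suc (2 * nat \<lfloor>z\<rfloor>)"
proof -
  have "\<lfloor>2 * z\<rfloor> = 2 * \<lfloor>z\<rfloor> \<or> \<lfloor>2 * z\<rfloor> = 2 * \<lfloor>z\<rfloor> + 1" by linarith
  moreover have "\<lfloor>z\<rfloor> \<ge> 0" using assms by simp
  ultimately show ?thesis by linarith
qed

text \<open>Each point is approached by its dyadic floors. Passing to the next level costs at most
  one step per coordinate, so by continuity a point is within \<open>2 * q^k / (1 - q)\<close> of
  its floor at level \<open>k\<close>. Two points account for the term 4 in the constant; the term 2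
  joins their floors at level \<open>k\<close>.\<close>

lemma dyadic_chaining:
  fixes F :: "real \<times> real \<Rightarrow> real" and q :: real
  assumes q: "0 < q" "q < 1"
    and cont: "continuous_on ({0..1} \<times> {0..1}) F"
    and hor: "\<And>j i l. k \<le> j \<Longrightarrow> i < 2^j \<Longrightarrow> l \<le> 2^j \<Longrightarrow>
        \<bar>F (real (Suc i) / 2^j, real l / 2^j) - F (real i / 2^j, real l / 2^j)\<bar> \<le> q^j"
    and ver: "\<And>j i l. k \<le> j \<Longrightarrow> i \<le> 2^j \<Longrightarrow> l < 2^j \<Longrightarrow>
        \<bar>F (real i / 2^j, real (Suc l) / 2^j) - F (real i / 2^j, real l / 2^j)\<bar> \<le> q^j"
    and p: "a \<in> {0..1}" "b \<in> {0..1}" "a' \<in> {0..1}" "b' \<in> {0..1}"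
    and close: "\<bar>a - a'\<bar> \<le> 1 / 2^k" "\<bar>b - b'\<bar> \<le> 1 / 2^k"
  shows "\<bar>F (a, b) - F (a', b')\<bar> \<le> (2 + 4 / (1 - q)) * q^k"
proof -
  define ix where "ix j a = nat \<lfloor>a * 2^j\<rfloor>" for j :: nat and a :: real
  define fl where "fl j a b = (real (ix j a) / 2^j, real (ix j b) / 2^j)" for j and a b :: real
  have ix_le: "ix j a \<le> 2^j" if "a \<in> {0..1}" for j a
  proof -
    have "a * 2^j \<le> 2^j" using that by (simp add: mult_le_cancel_right1)
    then have "\<lfloor>a * 2^j\<rfloor> \<le> \<lfloor>(2::real)^j\<rfloor>" by (rule floor_mono)
    also have "\<lfloor>(2::real)^j\<rfloor> = 2^j" using floor_of_int[of "2^j", where 'a = real] by simp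
    finally show ?thesis by (simp add: ix_def nat_le_iff)
  qed
  have ix_bounds: "real (ix j a) \<le> a * 2^j" "a * 2^j < real (ix j a) + 1" if "a \<in> {0..1}" for j a
    using that unfolding ix_def by (auto simp: of_nat_nat)
  have hor1: "\<bar>F (real i / 2^j, real l / 2^j) - F (real i' / 2^j, real l / 2^j)\<bar> \<le> q^j"
    if h: "k \<le> j" "i \<le> 2^j" "i' \<le> 2^j" "l \<le> 2^j" "i \<le> Suc i'" "i' \<le> Suc i" for j i i' l
  proof -
    consider "i = i'" | "i = Suc i'" | "i' = Suc i" using h(5,6) by linarith
    then show ?thesis
      using h hor[of j i' l] hor[of j i l] q by cases (auto simp: abs_minus_commute)
  qed
  have ver1: "\<bar>F (real i / 2^j, real l / 2^j) - F (real i / 2^j, real l' / 2^j)\<bar> \<le> q^j"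
    if h: "k \<le> j" "l \<le> 2^j" "l' \<le> 2^j" "i \<le> 2^j" "l \<le> Suc l'" "l' \<le> Suc l" for j i l l'
  proof -
    consider "l = l'" | "l = Suc l'" | "l' = Suc l" using h(5,6) by linarith
    then show ?thesis
      using h ver[of j i l'] ver[of j i l] q by cases (auto simp: abs_minus_commute)
  qed
  have near: "\<bar>F (real i / 2^j, real l / 2^j) - F (real i' / 2^j, real l' / 2^j)\<bar> \<le> 2 * q^j"
    if "k \<le> j" "i \<le> 2^j" "i' \<le> 2^j" "l \<le> 2^j" "l' \<le> 2^j"
      "i \<le> Suc i'" "i' \<le> Suc i" "l \<le> Suc l'" "l' \<le> Suc l" for j i i' l l'
    using hor1[of j i i' l] ver1[of j l l' i'] that by linarith
  have step: "\<bar>F (fl (Suc j) a b) - F (fl j a b)\<bar> \<le> 2 * q^Suc j"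
    if "k \<le> j" "a \<in> {0..1}" "b \<in> {0..1}" for j a b
  proof -
    \<comment> \<open>A floor at the next level is one of the two children of the present one, so
      each coordinate moves by at most one cell of the finer grid.\<close>
    have two: "ix (Suc j) a = 2 * ix j a \<or> ix (Suc j) a = Suc (2 * ix j a)" if "a \<in> {0..1}" for a
      using nat_floor_double[of "a * 2^j"] that by (simp add: ix_def mult_ac)
    have eq: "fl j a b = (real (2 * ix j a) / 2^Suc j, real (2 * ix j b) / 2^Suc j)"
      by (simp add: fl_def)
    show ?thesis
      unfolding eq unfolding fl_def
      using that two[of a] two[of b] ix_le[of a j] ix_le[of b j] ix_le[of a "Suc j"] ix_le[of b "Suc j"]
      by (intro near) auto
  qed
  have chain: "\<bar>F (fl (k + n) a b) - F (fl k a b)\<bar> \<le> 2 * q^k * (q - q^Suc n) / (1 - q)"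
    if "a \<in> {0..1}" "b \<in> {0..1}" for n a b
  proof (induction n)
    case (Suc n)
    have "\<bar>F (fl (k + Suc n) a b) - F (fl k a b)\<bar> \<le> 2 * q^k * (q - q^Suc n) / (1 - q) + 2 * q^Suc (k + n)"
      using Suc step[of "k + n" a b] that by simp
    also have "\<dots> = 2 * q^k * (q - q^Suc (Suc n)) / (1 - q)"
      using q by (simp add: field_simps power_add)
    finally show ?case .
  qed simp
  have chain': "\<bar>F (fl (k + n) a b) - F (fl k a b)\<bar> \<le> 2 * q^k / (1 - q)"
    if "a \<in> {0..1}" "b \<in> {0..1}" for n a b
  proof -
    have "q - q^Suc n \<le> 1" using q by (smt (verit) zero_le_power)
    then have "2 * q^k * (q - q^Suc n) / (1 - q) \<le> 2 * q^k * 1 / (1 - q)"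
      using q by (intro divide_right_mono mult_left_mono) auto
    then show ?thesis using chain[OF that, of n] by simp
  qed
  have lim: "(\<lambda>n. F (fl (k + n) a b)) \<longlonglongrightarrow> F (a, b)" if ab: "a \<in> {0..1}" "b \<in> {0..1}" for a b
  proof (rule continuous_on_tendsto_compose[OF cont])
    have lim1: "(\<lambda>n. real (ix (k + n) a) / 2^(k + n)) \<longlonglongrightarrow> a" if "a \<in> {0..1}" for a
    proof (rule tendsto_sandwich)
      have "(\<lambda>n. (1/2)^(n + k) :: real) \<longlonglongrightarrow> 0" by (intro LIMSEQ_ignore_initial_segment LIMSEQ_power_zero) simp
      from tendsto_diff[OF tendsto_const[of a] this]
      show "(\<lambda>n. a - (1/2)^(n + k)) \<longlonglongrightarrow> a" by simp
      show "\<forall>\<^sub>F n in sequentially. a - (1/2)^(n + k) \<le> real (ix (k + n) a) / 2^(k + n)"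
      proof (rule always_eventually, rule allI)
        fix n
        have "a * 2^(k + n) - 1 \<le> real (ix (k + n) a)" using ix_bounds(2)[OF that, of "k + n"] by linarith
        then have "(a * 2^(k + n) - 1) / 2^(k + n) \<le> real (ix (k + n) a) / 2^(k + n)"
          by (rule divide_right_mono) simp
        then show "a - (1/2)^(n + k) \<le> real (ix (k + n) a) / 2^(k + n)"
          by (simp add: diff_divide_distrib power_divide add.commute)
      qed
      show "\<forall>\<^sub>F n in sequentially. real (ix (k + n) a) / 2^(k + n) \<le> a"
        using ix_bounds(1)[OF that] by (auto simp: field_simps)
    qed simp
    show "(\<lambda>n. fl (k + n) a b) \<longlonglongrightarrow> (a, b)"
      unfolding fl_def by (intro tendsto_Pair lim1 ab)
    show "(a, b) \<in> {0..1} \<times> {0..1}" using ab by auto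
    show "\<forall>\<^sub>F n in sequentially. fl (k + n) a b \<in> {0..1} \<times> {0..1}"
    proof (rule always_eventually, rule allI)
      fix n
      have "real (ix (k + n) a) \<le> real (2^(k + n))" "real (ix (k + n) b) \<le> real (2^(k + n))"
        using ix_le ab by (simp_all only: of_nat_le_iff)
      then show "fl (k + n) a b \<in> {0..1} \<times> {0..1}" by (auto simp: fl_def)
    qed
  qed
  have far: "\<bar>F (a, b) - F (fl k a b)\<bar> \<le> 2 * q^k / (1 - q)" if "a \<in> {0..1}" "b \<in> {0..1}" for a b
    by (rule LIMSEQ_le_const2[OF tendsto_rabs[OF tendsto_diff[OF lim[OF that] tendsto_const]]])
       (use chain'[OF that] in auto)
  have ix_close: "ix k a \<le> Suc (ix k a')" if "a \<in> {0..1}" "a' \<in> {0..1}" "\<bar>a - a'\<bar> \<le> 1 / 2^k" for a a'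
  proof -
    have "a - a' \<le> 1 / 2^k" using that by simp
    then have "(a - a') * 2^k \<le> 1" by (simp add: field_simps)
    then have "a * 2^k \<le> a' * 2^k + 1" by (simp add: algebra_simps)
    then have "real (ix k a) < real (ix k a') + 2"
      using ix_bounds[OF that(1), of k] ix_bounds[OF that(2), of k] by linarith
    then show ?thesis by linarith
  qed
  \<comment> \<open>Points at distance at most one cell have floors that differ by at most one index
    in each coordinate.\<close>
  have "\<bar>F (fl k a b) - F (fl k a' b')\<bar> \<le> 2 * q^k"
    unfolding fl_def using p close ix_le ix_close by (intro near) (auto simp: abs_minus_commute)
  then have "\<bar>F (a, b) - F (a', b')\<bar> \<le> 2 * (2 * q^k / (1 - q)) + 2 * q^k"
    using far[OF p(1,2)] far[OF p(3,4)] by linarith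
  also have "\<dots> = (2 + 4 / (1 - q)) * q^k" by (simp add: algebra_simps)
  finally show ?thesis .
qed

text \<open>The decay is doubly exponential for any ratio above 1. The inequality
  \<open>exp (- x) \<le> 1 / (x / n)^n\<close> with \<open>n\<close> so large that
  \<open>\<rho>^n > 8\<close> reduces the series to a geometric one of ratio below 1/2.\<close>

lemma summable_grid_tail:
  fixes \<rho> c :: real
  assumes "\<rho> > 1" "c > 0"
  shows "summable (\<lambda>j. 4 * (2^j + 1)\<^sup>2 * exp (- (\<rho>^j / c)))"
proof -
  obtain n where n: "\<rho>^n > 8" using real_arch_pow[OF assms(1)] by blast
  then have "n > 0" by (cases n) auto
  have bound: "4 * (2^j + 1)\<^sup>2 * exp (- (\<rho>^j / c)) \<le> (16 * (c * n)^n) * (4 / \<rho>^n)^j" for j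
  proof -
    have "(2^j + 1 :: real)\<^sup>2 \<le> (2 * 2^j)\<^sup>2" by (intro power_mono) auto
    also have "\<dots> = 4 * 4^j" by (simp add: power_mult_distrib power2_eq_square power_mult[symmetric] flip: power_mult_distrib)
    finally have 1: "4 * (2^j + 1 :: real)\<^sup>2 \<le> 16 * 4^j" by simp
    define x where "x = \<rho>^j / c"
    have x: "x > 0" using assms by (simp add: x_def)
    have "(x / n)^n \<le> (exp (x / n))^n"
    proof (intro power_mono)
      show "x / n \<le> exp (x / n)" using exp_ge_add_one_self[of "x / n"] by linarith
    qed (use x in simp)
    also have "\<dots> = exp x" using \<open>n > 0\<close> by (simp add: exp_of_nat_mult[symmetric])
    finally have "exp (- x) \<le> 1 / (x / n)^n"
      using x \<open>n > 0\<close> by (simp add: exp_minus field_simps)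
    also have "\<dots> = (c * n)^n / (\<rho>^n)^j"
      using assms by (simp add: x_def power_divide power_mult_distrib power_mult[symmetric] mult.commute)
    finally have 2: "exp (- (\<rho>^j / c)) \<le> (c * n)^n / (\<rho>^n)^j" by (simp add: x_def)
    have "4 * (2^j + 1)\<^sup>2 * exp (- (\<rho>^j / c)) \<le> 16 * 4^j * ((c * n)^n / (\<rho>^n)^j)"
      by (rule mult_mono[OF 1 2]) auto
    then show ?thesis by (simp add: power_divide mult_ac)
  qed
  have "summable (\<lambda>j. (16 * (c * n)^n) * (4 / \<rho>^n)^j)"
    using n by (intro summable_mult summable_geometric) auto
  then show ?thesis
    by (rule summable_comparison_test'[where N = 0]) (use bound in auto)
qed

lemma grid_point_mem:
  fixes T :: real
  assumes "T > 0" "i \<le> 2^j"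
  shows "T * (real i / 2^j) \<in> {0..T}"
proof -
  have "real i \<le> real (2^j)" using assms(2) by (simp only: of_nat_le_iff)
  then have "real i / 2^j \<le> 1" by simp
  then show ?thesis using assms(1) mult_left_le[of "real i / 2^j" T] by auto
qed

text \<open>A union bound over fewer than \<open>2 * (2^j + 1)\<^sup>2\<close> edges of the grid.
  Edges have length at most \<open>(T + J) / 2^j\<close>, so the exponent
  \<open>(q^j)\<^sup>2 / (c * d)\<close> becomes a multiple of \<open>(2 * q\<^sup>2)^j\<close>,
  which grows exactly when \<open>q\<^sup>2\<close> exceeds 1/2.\<close>

lemma (in prob_space) grid_bad_event:
  fixes X :: "real \<Rightarrow> real \<Rightarrow> 'a \<Rightarrow> real" and T J q c :: real
  assumes TJ: "T > 0" "J > 0" and q: "0 < q"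
    and X[measurable]: "\<And>t x. t \<in> {0..T} \<Longrightarrow> x \<in> {0..J} \<Longrightarrow> X t x \<in> borel_measurable M"
    and tail: "\<And>t x t' x' d. t \<in> {0..T} \<Longrightarrow> x \<in> {0..J} \<Longrightarrow> t' \<in> {0..T} \<Longrightarrow> x' \<in> {0..J} \<Longrightarrow> d > 0 \<Longrightarrow>
      \<bar>t - t'\<bar> + \<bar>x - x'\<bar> \<le> d \<Longrightarrow> prob {\<omega> \<in> space M. \<bar>X t x \<omega> - X t' x' \<omega>\<bar> \<ge> q^j} \<le> 2 * exp (- ((q^j)\<^sup>2) / (c * d))"
  defines "bad \<equiv> {\<omega> \<in> space M.
      (\<exists>i<2^j. \<exists>l\<le>2^j. \<bar>X (T * (real (Suc i) / 2^j)) (J * (real l / 2^j)) \<omega> - X (T * (real i / 2^j)) (J * (real l / 2^j)) \<omega>\<bar> \<ge> q^j) \<or>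
      (\<exists>i\<le>2^j. \<exists>l<2^j. \<bar>X (T * (real i / 2^j)) (J * (real (Suc l) / 2^j)) \<omega> - X (T * (real i / 2^j)) (J * (real l / 2^j)) \<omega>\<bar> \<ge> q^j)}"
  shows "bad \<in> sets M" "prob bad \<le> 4 * (2^j + 1)\<^sup>2 * exp (- ((2 * q\<^sup>2)^j / (c * (T + J))))"
proof -
  note rng = grid_point_mem[OF TJ(1)] grid_point_mem[OF TJ(2)]
  define E where "E t x t' x' = {\<omega> \<in> space M. \<bar>X t x \<omega> - X t' x' \<omega>\<bar> \<ge> q^j}" for t x t' x'
  have E_sets: "E t x t' x' \<in> sets M" if "t \<in> {0..T}" "x \<in> {0..J}" "t' \<in> {0..T}" "x' \<in> {0..J}" for t x t' x'
    using X[OF that(1,2)] X[OF that(3,4)] unfolding E_def by measurable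
  define d where "d = (T + J) / 2^j"
  have d: "d > 0" using TJ by (simp add: d_def)
  define e where "e = 2 * exp (- ((2 * q\<^sup>2)^j / (c * (T + J))))"
  have e_eq: "2 * exp (- ((q^j)\<^sup>2) / (c * d)) = e"
    by (simp add: e_def d_def power_mult_distrib power_mult[symmetric] mult_ac)
  define I where "I = {..(2::nat)^j}"
  define I' where "I' = {..<(2::nat)^j}"
  define H where "H = (\<lambda>(i, l). E (T * (real (Suc i) / 2^j)) (J * (real l / 2^j)) (T * (real i / 2^j)) (J * (real l / 2^j)))"
  define V where "V = (\<lambda>(i, l). E (T * (real i / 2^j)) (J * (real (Suc l) / 2^j)) (T * (real i / 2^j)) (J * (real l / 2^j)))"
  have dT: "\<bar>T * (real (Suc i) / 2^j) - T * (real i / 2^j)\<bar> \<le> d" for i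
    using TJ by (simp add: d_def right_diff_distrib[symmetric] diff_divide_distrib[symmetric] divide_right_mono)
  have dJ: "\<bar>J * (real (Suc i) / 2^j) - J * (real i / 2^j)\<bar> \<le> d" for i
    using TJ by (simp add: d_def right_diff_distrib[symmetric] diff_divide_distrib[symmetric] divide_right_mono)
  have H: "H z \<in> sets M" "prob (H z) \<le> e" if "z \<in> I' \<times> I" for z
  proof -
    obtain i l where "z = (i, l)" by (cases z)
    then have z: "z = (i, l)" "i < 2^j" "l \<le> 2^j" using that by (auto simp: I_def I'_def)
    note r = rng(1)[of "Suc i" j] rng(1)[of i j] rng(2)[of l j]
    show "H z \<in> sets M" unfolding z H_def prod.case using z by (intro E_sets r) auto
    show "prob (H z) \<le> e" unfolding z H_def prod.case E_def e_eq[symmetric]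
      using z d dT[of i] by (intro tail r) auto
  qed
  have V: "V z \<in> sets M" "prob (V z) \<le> e" if "z \<in> I \<times> I'" for z
  proof -
    obtain i l where "z = (i, l)" by (cases z)
    then have z: "z = (i, l)" "i \<le> 2^j" "l < 2^j" using that by (auto simp: I_def I'_def)
    note r = rng(2)[of "Suc l" j] rng(1)[of i j] rng(2)[of l j]
    show "V z \<in> sets M" unfolding z V_def prod.case using z by (intro E_sets r) auto
    show "prob (V z) \<le> e" unfolding z V_def prod.case E_def e_eq[symmetric]
      using z d dJ[of l] by (intro tail r) auto
  qed
  have fin: "finite (I' \<times> I)" "finite (I \<times> I')" by (auto simp: I_def I'_def)
  have bad: "bad = (\<Union>z\<in>I' \<times> I. H z) \<union> (\<Union>z\<in>I \<times> I'. V z)"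
    by (auto simp: bad_def H_def V_def E_def I_def I'_def)
  have HS: "(\<Union>z\<in>I' \<times> I. H z) \<in> sets M" "(\<Union>z\<in>I \<times> I'. V z) \<in> sets M"
    using H V fin by (auto intro!: sets.finite_UN)
  then show "bad \<in> sets M" unfolding bad by auto
  have "prob (\<Union>z\<in>I' \<times> I. H z) \<le> (\<Sum>z\<in>I' \<times> I. prob (H z))"
    using H fin by (intro measure_UNION_le) auto
  also have "\<dots> \<le> (\<Sum>z\<in>I' \<times> I. e)" by (intro sum_mono H)
  also have "\<dots> = real (2^j * (2^j + 1)) * e" by (simp add: I_def I'_def card_cartesian_product)
  also have "\<dots> \<le> (2^j + 1)\<^sup>2 * e"
    by (intro mult_right_mono) (auto simp: power2_eq_square e_def algebra_simps)
  finally have 1: "prob (\<Union>z\<in>I' \<times> I. H z) \<le> (2^j + 1)\<^sup>2 * e" .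
  have "prob (\<Union>z\<in>I \<times> I'. V z) \<le> (\<Sum>z\<in>I \<times> I'. prob (V z))"
    using V fin by (intro measure_UNION_le) auto
  also have "\<dots> \<le> (\<Sum>z\<in>I \<times> I'. e)" by (intro sum_mono V)
  also have "\<dots> = real (2^j * (2^j + 1)) * e" by (simp add: I_def I'_def card_cartesian_product)
  also have "\<dots> \<le> (2^j + 1)\<^sup>2 * e"
    by (intro mult_right_mono) (auto simp: power2_eq_square e_def algebra_simps)
  finally have 2: "prob (\<Union>z\<in>I \<times> I'. V z) \<le> (2^j + 1)\<^sup>2 * e" .
  have "prob bad \<le> prob (\<Union>z\<in>I' \<times> I. H z) + prob (\<Union>z\<in>I \<times> I'. V z)"
    unfolding bad using HS by (intro measure_Un_le)
  then have "prob bad \<le> 2 * ((2^j + 1)\<^sup>2 * e)" using 1 2 by linarith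
  then show "prob bad \<le> 4 * (2^j + 1)\<^sup>2 * exp (- ((2 * q\<^sup>2)^j / (c * (T + J))))"
    by (simp add: e_def)
qed

section \<open>The path argument\<close>

context wave_window
begin

lemma drift_at_0:
  shows "drift U 0 x = 0"
proof -
  have "emeasure lborel ({0..0::real} \<times> {0..J}) = (0 :: ennreal)"
  proof -
    have "{0..0::real} \<times> {0..J} = cbox (0, 0) (0, J)" by (auto simp: cbox_Pair_eq)
    moreover have "measure lborel (cbox (0, 0) (0::real, J)) = 0" by (subst content_Pair) simp
    ultimately show ?thesis by (simp add: emeasure_eq_measure2)
  qed
  moreover have "{0..0::real} \<times> {0..J} \<in> sets (lborel :: (real \<times> real) measure)" by (simp add: borel_prod[symmetric])
  ultimately have "{0..0::real} \<times> {0..J} \<in> null_sets (lborel :: (real \<times> real) measure)" by auto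
  from AE_not_in[OF this] show ?thesis
    unfolding drift_def set_lebesgue_integral_def
    by (intro integral_eq_zero_AE) (auto simp: indicator_def)
qed

text \<open>At the first point where the path reaches 1/N, the drift accumulated in the backward light cone at
  scale r exceeds the oscillation a of the remaining terms; going back by r would make the path
  negative.\<close>

lemma path_stays_above:
  fixes v :: "real \<Rightarrow> real \<Rightarrow> real" and N :: nat and a C \<alpha> c0 r :: real
  defines "U \<equiv> \<lambda>z. (max (v (fst z) (snd z)) (1 / real N)) powr (- \<alpha>)"
  assumes v: "continuous_on ({0..} \<times> {0..J}) (\<lambda>(t, x). v t x)"
    and N: "N > 0" "1 / real N \<le> a" and \<alpha>: "\<alpha> > 0" and C: "C \<ge> 0" and r: "0 < r" "r \<le> J"
    and osc: "\<And>t x t' x'. t \<in> {0..T} \<Longrightarrow> t' \<in> {0..T} \<Longrightarrow> x \<in> {0..J} \<Longrightarrow> x' \<in> {0..J} \<Longrightarrow>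
        \<bar>t - t'\<bar> \<le> r \<Longrightarrow> \<bar>x - x'\<bar> \<le> r \<Longrightarrow>
        \<bar>(v t x - drift U t x) - (v t' x' - drift U t' x')\<bar> \<le> C * a"
    and init: "\<And>x. x \<in> {0..J} \<Longrightarrow> c0 \<le> v 0 x"
    and small: "(C + 1) * a < c0" "(C + 1) * a \<le> ((C + 1) * a) powr (- \<alpha>) * r\<^sup>2 / 16"
    and tx: "t \<in> {0..T}" "x \<in> {0..J}"
  shows "v t x > 1 / real N"
proof (rule ccontr)
  assume "\<not> v t x > 1 / real N"
  then have le: "v t x \<le> 1 / real N" by simp
  \<comment> \<open>The set of low points is compact, so the time coordinate attains its minimum on
    it; this provides the first contact point.\<close>
  define S where "S = {z \<in> {0..T} \<times> {0..J}. v (fst z) (snd z) \<le> 1 / real N}"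
  have a_pos: "a > 0" using N by (meson divide_pos_pos less_le_trans of_nat_0_less_iff zero_less_one)
  have v': "continuous_on ({0..} \<times> {0..J}) (\<lambda>z. v (fst z) (snd z))" using v by (simp add: split_beta)
  have "closed ({0..T} \<times> {0..J} \<inter> (\<lambda>z. v (fst z) (snd z)) -` {..1 / real N})"
    by (rule continuous_closed_preimage[OF continuous_on_subset[OF v']]) (auto intro: closed_Times)
  moreover have "S = {0..T} \<times> {0..J} \<inter> (\<lambda>z. v (fst z) (snd z)) -` {..1 / real N}" by (auto simp: S_def)
  moreover have "compact ({0..T} \<times> {0..J})" by (intro compact_Times compact_Icc)
  ultimately have "compact S" by (metis compact_Int_closed inf.absorb_iff2 inf_le1)
  moreover have "S \<noteq> {}" using tx le by (auto simp: S_def)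
  ultimately obtain z where z: "z \<in> S" "\<And>z'. z' \<in> S \<Longrightarrow> fst z \<le> fst z'"
    using continuous_attains_inf[of S fst] continuous_on_fst[OF continuous_on_id] by blast
  define t1 x1 where "t1 = fst z" and "x1 = snd z"
  have p1: "t1 \<in> {0..T}" "x1 \<in> {0..J}" and v1: "v t1 x1 \<le> 1 / real N"
    using z(1) by (auto simp: S_def t1_def x1_def)
  have before: "v s y > 1 / real N" if "s \<in> {0..T}" "y \<in> {0..J}" "s < t1" for s y
  proof (rule ccontr)
    assume "\<not> v s y > 1 / real N"
    then have "(s, y) \<in> S" using that by (simp add: S_def)
    from z(2)[OF this] that show False by (simp add: t1_def)
  qed
  have U_cont: "continuous_on ({0..} \<times> {0..J}) U"
  proof -
    have "max (v (fst z) (snd z)) (1 / real N) \<noteq> 0" for z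
      using N(1) by (metis less_irrefl less_max_iff_disj of_nat_0_less_iff zero_less_divide_1_iff)
    then show ?thesis unfolding U_def by (intro continuous_intros v') auto
  qed
  have U_bound: "0 \<le> U z \<and> U z \<le> (1 / real N) powr (- \<alpha>)" for z
    unfolding U_def using N \<alpha> by (auto intro!: powr_mono2')
  show False
  proof (cases "t1 < r")
    \<comment> \<open>There is no room to go back by \<open>r\<close>. The oscillation bound instead
      compares directly with time 0, where the drift vanishes and the path is at least
      \<open>c0\<close>.\<close>
    case True
    have "\<bar>(v t1 x1 - drift U t1 x1) - (v 0 x1 - drift U 0 x1)\<bar> \<le> C * a"
      using p1 True T_pos r by (intro osc) auto
    moreover have "drift U t1 x1 \<ge> 0" by (rule drift_nonneg[OF U_cont U_bound])
    ultimately have "c0 \<le> 1 / real N + C * a" using v1 init[OF p1(2)] by (simp add: drift_at_0)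
    then show False using small(1) N by (simp add: distrib_right)
  next
    case False
    \<comment> \<open>The path at \<open>(s, y)\<close> exceeds its value at the contact point by at
      most the oscillation, because the drift difference has the favourable sign inside the
      cone.\<close>
    have near: "v s y \<le> (C + 1) * a"
      if "s \<in> {0..T}" "y \<in> {0..J}" "\<bar>x1 - y\<bar> \<le> t1 - s" "t1 - s \<le> r" for s y
    proof -
      have "\<bar>(v t1 x1 - drift U t1 x1) - (v s y - drift U s y)\<bar> \<le> C * a"
        using p1 that by (intro osc) auto
      moreover have "drift U s y \<le> drift U t1 x1"
        using p1 that by (intro drift_mono[OF U_cont U_bound]) auto
      ultimately show ?thesis using v1 N by (simp add: distrib_right)
    qed
    \<comment> \<open>The box is laid to the right of \<open>x1\<close> when it fits and to the left
      otherwise; \<open>r \<le> J\<close> ensures that one of the two stays in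
      \<open>{0..J}\<close>.\<close>
    define c where "c = (if x1 + r/2 \<le> J then x1 else x1 - r/2)"
    have c: "0 \<le> c" "c + r/2 \<le> J" "c \<le> x1" "x1 \<le> c + r/2"
      using p1 r by (auto simp: c_def)
    let ?\<beta> = "((C + 1) * a) powr (- \<alpha>)"
    have "drift U (t1 - r) x1 + ?\<beta> * r\<^sup>2 / 16 \<le> drift U t1 x1"
    proof (rule drift_gain[OF U_cont U_bound])
      fix s y assume s: "s \<in> {t1 - 3 * r / 4..t1 - r / 2}" and y: "y \<in> {c..c + r / 2}"
      have "v s y \<le> (C + 1) * a"
        using s y c p1 r False by (intro near) auto
      moreover have "1 / real N \<le> (C + 1) * a" using N C a_pos by (simp add: distrib_right add_increasing)
      ultimately show "?\<beta> \<le> U (s, y)"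
        unfolding U_def using N \<alpha> by (intro powr_mono2') (auto simp: less_max_iff_disj)
    qed (use p1 r c False in auto)
    moreover have "\<bar>(v t1 x1 - drift U t1 x1) - (v (t1 - r) x1 - drift U (t1 - r) x1)\<bar> \<le> C * a"
      using p1 False r by (intro osc) auto
    \<comment> \<open>The drift gained since time \<open>t1 - r\<close> outweighs the oscillation
      and the contact value together, so at that earlier time the path would have to be at most 0,
      contrary to \<open>before\<close>.\<close>
    ultimately have "v (t1 - r) x1 \<le> 1 / real N + C * a - ?\<beta> * r\<^sup>2 / 16" using v1 by linarith
    also have "\<dots> \<le> 0" using small(2) N by (simp add: distrib_right)
    finally have "v (t1 - r) x1 \<le> 0" .
    moreover have "v (t1 - r) x1 > 1 / real N" using p1 False r by (intro before) auto
    ultimately show False using N by (smt (verit) divide_nonneg_nonneg of_nat_0_le_iff)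
  qed
qed

end

section \<open>Moduli of continuity, choice of scales and hitting times\<close>

lemma modulus_continuous_on:
  fixes f :: "real \<times> real \<Rightarrow> real"
  assumes "\<And>z z'. z \<in> A \<Longrightarrow> z' \<in> A \<Longrightarrow>
    \<bar>f z - f z'\<bar> \<le> C * sqrt (\<bar>fst z - fst z'\<bar> + \<bar>snd z - snd z'\<bar>) + D * (\<bar>fst z - fst z'\<bar> + \<bar>snd z - snd z'\<bar>)"
  shows "continuous_on A f"
  unfolding continuous_on_def
proof
  fix z' assume z': "z' \<in> A"
  let ?h = "\<lambda>z. C * sqrt (\<bar>fst z - fst z'\<bar> + \<bar>snd z - snd z'\<bar>) + D * (\<bar>fst z - fst z'\<bar> + \<bar>snd z - snd z'\<bar>)"
  have "(?h \<longlongrightarrow> ?h z') (at z' within A)" by (intro tendsto_intros)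
  then have "(?h \<longlongrightarrow> 0) (at z' within A)" by simp
  moreover have "\<forall>\<^sub>F z in at z' within A. norm (f z - f z') \<le> ?h z"
    using assms z' by (auto simp: eventually_at_filter)
  ultimately have "((\<lambda>z. f z - f z') \<longlongrightarrow> 0) (at z' within A)" by (rule Lim_null_comparison[rotated])
  then show "(f \<longlongrightarrow> f z') (at z' within A)" by (simp add: Lim_null[symmetric])
qed

lemma holder_half_continuous_on:
  fixes f :: "real \<Rightarrow> real"
  assumes "\<And>x y. \<bar>f x - f y\<bar> \<le> C * sqrt \<bar>x - y\<bar>"
  shows "continuous_on A f"
proof -
  have "continuous_on (A \<times> {0::real}) (\<lambda>z. f (fst z))"
    by (rule modulus_continuous_on[where C = C and D = 0]) (use assms in auto)
  moreover have "continuous_on A (\<lambda>x. (x, 0::real))" by (intro continuous_intros)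
  ultimately have "continuous_on A (\<lambda>x. f (fst (x, 0::real)))"
    by (rule continuous_on_compose2) auto
  then show ?thesis by simp
qed

lemma suminf_tail_tendsto_0:
  fixes f :: "nat \<Rightarrow> real"
  assumes "summable f"
  shows "(\<lambda>k. \<Sum>n. f (n + k)) \<longlonglongrightarrow> 0"
proof -
  have "(\<Sum>n. f (n + k)) = suminf f - (\<Sum>i<k. f i)" for k
    using suminf_split_initial_segment[OF assms, of k] by simp
  moreover have "(\<lambda>k. suminf f - (\<Sum>i<k. f i)) \<longlonglongrightarrow> suminf f - suminf f"
    by (intro tendsto_intros summable_LIMSEQ assms)
  ultimately show ?thesis by simp
qed

text \<open>This is where the assumption on the exponent enters: q is 2 to the power -h, with h between
  2/(alpha+1) and 1/2.\<close>

lemma chaining_ratio_exists: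
  fixes \<alpha> :: real
  assumes "\<alpha> > 3"
  obtains q where "0 < q" "q < 1" "1/2 < q\<^sup>2" "4 * q powr (\<alpha> + 1) < 1"
proof -
  have "2 / (\<alpha> + 1) < 1/2" using assms by (simp add: field_simps)
  then obtain h where h: "2 / (\<alpha> + 1) < h" "h < 1/2" using dense by blast
  have h0: "h > 0" using h(1) assms by (smt (verit) divide_pos_pos)
  define q :: real where "q = 2 powr (- h)"
  have "2 powr (-1) < (2 :: real) powr (- h * 2)" using h by (intro powr_less_mono) auto
  moreover have "q\<^sup>2 = 2 powr (- h * 2)" unfolding q_def by (subst powr_power) (auto simp: mult.commute)
  ultimately have "1/2 < q\<^sup>2" by (simp only: powr_minus) simp
  moreover have "q powr (\<alpha> + 1) < 1/4"
  proof -
    have "h * (\<alpha> + 1) > 2" using h(1) assms by (simp add: field_simps)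
    then have "(2 :: real) powr (- h * (\<alpha> + 1)) < 2 powr (- 2)" by (intro powr_less_mono) auto
    also have "(2 :: real) powr (- 2) = 1/4" by (simp add: powr_minus)
    finally show ?thesis by (simp only: q_def powr_powr)
  qed
  moreover have "q < 1" using h0 by (simp add: q_def powr_less_one)
  ultimately show thesis using that[of q] by (simp add: q_def)
qed

text \<open>Multiplied by \<open>(C * q^k) powr \<alpha>\<close> and by \<open>4^k\<close>, the
  second inequality bounds \<open>C powr (\<alpha> + 1) * (4 * q powr (\<alpha> + 1))^k\<close> by
  \<open>\<delta>\<^sup>2 / 16\<close>; the bounded quantity tends to 0.\<close>

lemma eventually_scales:
  fixes C C' q \<alpha> \<delta> c0 :: real
  assumes q: "0 < q" "q < 1" "4 * q powr (\<alpha> + 1) < 1" and C: "C > 0" and \<delta>: "\<delta> > 0" and c0: "c0 > 0"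
  shows "\<forall>\<^sub>F k in sequentially. C' * q^k < c0 \<and>
    C * q^k \<le> (C * q^k) powr (- \<alpha>) * (\<delta> / 2^k)\<^sup>2 / 16"
proof -
  have "(\<lambda>k. C' * q^k) \<longlonglongrightarrow> C' * 0" using q by (intro tendsto_intros LIMSEQ_power_zero) auto
  then have 1: "\<forall>\<^sub>F k in sequentially. C' * q^k < c0" using c0 by (intro order_tendstoD(2)) auto
  have "(\<lambda>k. C powr (\<alpha> + 1) * (4 * q powr (\<alpha> + 1))^k) \<longlonglongrightarrow> C powr (\<alpha> + 1) * 0"
    using q by (intro tendsto_intros LIMSEQ_power_zero) auto
  then have 2: "\<forall>\<^sub>F k in sequentially. C powr (\<alpha> + 1) * (4 * q powr (\<alpha> + 1))^k < \<delta>\<^sup>2 / 16"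
    using \<delta> by (intro order_tendstoD(2)) auto
  show ?thesis using 1 2
  proof eventually_elim
    case (elim k)
    have pos: "C * q^k > 0" using C q by simp
    have "(C * q^k) powr (\<alpha> + 1) = C powr (\<alpha> + 1) * (q powr (\<alpha> + 1))^k"
      using C q by (simp add: powr_mult powr_power powr_realpow[symmetric] powr_powr mult.commute)
    then have "(C * q^k) powr (\<alpha> + 1) * 4^k < \<delta>\<^sup>2 / 16"
      using elim(2) by (simp add: power_mult_distrib mult_ac)
    then have le: "(C * q^k) powr (\<alpha> + 1) \<le> \<delta>\<^sup>2 / 16 / 4^k"
      by (simp add: field_simps)
    have "C * q^k = (C * q^k) powr (- \<alpha>) * (C * q^k) powr (\<alpha> + 1)"
      using pos by (simp add: powr_add[symmetric])
    also have "\<dots> \<le> (C * q^k) powr (- \<alpha>) * (\<delta>\<^sup>2 / 16 / 4^k)"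
      by (intro mult_left_mono le) auto
    also have "\<dots> = (C * q^k) powr (- \<alpha>) * (\<delta> / 2^k)\<^sup>2 / 16"
    proof -
      have "(4::real)^k = (2^k)\<^sup>2" by (simp add: power_mult[symmetric] power2_eq_square power_mult_distrib[symmetric])
      then show ?thesis by (simp add: power_divide)
    qed
    finally show ?case using elim(1) by blast
  qed
qed

text \<open>Continuity on a compact interval makes the spatial infimum a minimum, so a time counted
  by \<open>hit_time\<close> has an actual low point and must lie after \<open>T\<close>.\<close>

lemma hit_time_ge:
  assumes "J > 0" and cont: "continuous_on ({0..} \<times> {0..J}) (\<lambda>(t, x). v t x \<omega>)"
    and above: "\<And>t x. t \<in> {0..T} \<Longrightarrow> x \<in> {0..J} \<Longrightarrow> v t x \<omega> > 1 / real N"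
  shows "ereal T \<le> hit_time J v N \<omega>"
  unfolding hit_time_def
proof (rule Inf_greatest, clarify)
  fix t :: real assume t: "t > 0" "(INF x\<in>{0..J}. v t x \<omega>) \<le> 1 / real N"
  have "continuous_on {0..J} (\<lambda>x. v t x \<omega>)"
  proof -
    have "continuous_on {0..J} (\<lambda>x. (t, x))" by (intro continuous_intros)
    then have "continuous_on {0..J} (\<lambda>x. case (t, x) of (t, x) \<Rightarrow> v t x \<omega>)"
      by (rule continuous_on_compose2[OF cont]) (use t(1) in auto)
    then show ?thesis by simp
  qed
  then obtain x0 where x0: "x0 \<in> {0..J}" "\<And>x. x \<in> {0..J} \<Longrightarrow> v t x0 \<omega> \<le> v t x \<omega>"
    using continuous_attains_inf[of "{0..J}" "\<lambda>x. v t x \<omega>"] assms(1) by auto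
  have "v t x0 \<omega> \<le> (INF x\<in>{0..J}. v t x \<omega>)"
    using x0 by (intro cINF_greatest) auto
  then have "\<not> v t x0 \<omega> > 1 / real N" using t(2) by simp
  then have "t > T" using above[of t x0] t(1) x0(1) by (meson atLeastAtMost_iff less_imp_le not_le)
  then show "ereal T \<le> ereal t" by simp
qed

section \<open>The stochastic convolution on a finite time window\<close>

locale wave_model = white_noise_space M J W + wave_window J T m
  for M :: "'a measure" and J :: real and W :: "(real \<times> real) set \<Rightarrow> 'a \<Rightarrow> real" and T :: real and m :: int
begin

text \<open>At time 0 the kernel is nonzero only on the translates of \<open>x\<close> by multiples
  of \<open>J\<close>, a countable and hence null set.\<close>

lemma wave_init_at_0: "wave_init J u0 u1 0 x = u0 x"
proof -
  have "countable (range (\<lambda>n::int. x + of_int n * J))" by simp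
  then have "AE y in lborel. y \<notin> range (\<lambda>n::int. x + of_int n * J)"
    by (intro AE_not_in countable_imp_null_set_lborel)
  then have "(LINT y:{0..J}|lborel. SI J 0 (x - y) * u1 y) = 0"
    unfolding set_lebesgue_integral_def
  proof (intro integral_eq_zero_AE, eventually_elim)
    case (elim y)
    have "{n::int. \<bar>x - y + of_int n * J\<bar> \<le> 0} = {}" using elim by (auto simp: algebra_simps)
    then show ?case by (simp add: SI_def)
  qed
  then show ?thesis by (simp add: wave_init_def)
qed

context
  fixes g :: "real \<Rightarrow> real" and v :: "real \<Rightarrow> real \<Rightarrow> 'a \<Rightarrow> real" and X :: "real \<Rightarrow> real \<Rightarrow> 'a \<Rightarrow> real" and Cg :: real
  assumes walsh: "\<And>t x. t \<in> {0..T} \<Longrightarrow> x \<in> {0..J} \<Longrightarrow>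
      walsh_integral M J W (\<lambda>(s, y) \<omega>. if s < t then SI J (t - s) (x - y) * g (v s y \<omega>) else 0) (X t x)"
    and g: "\<And>y. \<bar>g y\<bar> \<le> Cg" "Cg > 0"
begin

lemma walsh_kernel:
  assumes "t \<in> {0..T}" "x \<in> {0..J}"
  shows "walsh_integral M J W (\<lambda>z \<omega>. wave_kernel t x z * g (v (fst z) (snd z) \<omega>)) (X t x)"
proof -
  have "(\<lambda>(s, y) \<omega>. if s < t then SI J (t - s) (x - y) * g (v s y \<omega>) else 0)
      = (\<lambda>z \<omega>. wave_kernel t x z * g (v (fst z) (snd z) \<omega>))"
    by (auto simp: wave_kernel_def fun_eq_iff)
  then show ?thesis using walsh[OF assms] by simp
qed

lemma walsh_field_measurable: "t \<in> {0..T} \<Longrightarrow> x \<in> {0..J} \<Longrightarrow> X t x \<in> borel_measurable M"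
  using walsh by (auto simp: walsh_integral_def)

text \<open>The bound \<open>Cg\<close> holds for \<open>g\<close> along any field, so the tail does
  not depend on \<open>v\<close>. This is the source of uniformity in \<open>N\<close>.\<close>

lemma walsh_increment_tail:
  assumes p: "t \<in> {0..T}" "x \<in> {0..J}" "t' \<in> {0..T}" "x' \<in> {0..J}"
    and d: "d > 0" "\<bar>t - t'\<bar> + \<bar>x - x'\<bar> \<le> d" and e: "e \<ge> 0"
  shows "prob {\<omega> \<in> space M. \<bar>X t x \<omega> - X t' x' \<omega>\<bar> \<ge> e} \<le> 2 * exp (- (e\<^sup>2) / ((4 * (Cg\<^sup>2 * \<kappa>\<^sup>2 * T)) * d))"
proof -
  let ?K = "Cg\<^sup>2 * (\<kappa>\<^sup>2 * T * d)"
  have "prob {\<omega> \<in> space M. \<bar>X t x \<omega> - X t' x' \<omega>\<bar> \<ge> e} \<le> 2 * exp (- (e\<^sup>2) / (4 * ?K))"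
  proof (rule walsh_integral_tail[OF walsh_integral_diff[OF walsh_kernel[OF p(1,2)] walsh_kernel[OF p(3,4)]] _ _ e])
    show "?K > 0" using g(2) \<kappa>_ge_1 T_pos d(1) by simp
    fix \<omega> assume "\<omega> \<in> space M"
    let ?w = "\<lambda>z. (wave_kernel t x z - wave_kernel t' x' z)\<^sup>2"
    have km: "wave_kernel t x \<in> borel_measurable borel" for t x
    proof -
      have "{z \<in> space borel. fst z < t} \<in> sets (borel :: (real \<times> real) measure)" by (simp add: borel_prod[symmetric])
      then show ?thesis unfolding wave_kernel_def[abs_def]
        by (intro measurable_If SI_measurable J_pos) (simp_all add: borel_prod[symmetric])
    qed
    have im: "(\<lambda>z. indicator ({0..} \<times> {0..<J}) z :: ennreal) \<in> borel_measurable (borel :: (real \<times> real) measure)"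
      by (intro borel_measurable_indicator) (simp add: borel_prod[symmetric])
    have "(\<integral>\<^sup>+z\<in>{0..} \<times> {0..<J}. ennreal ((wave_kernel t x z * g (v (fst z) (snd z) \<omega>) - wave_kernel t' x' z * g (v (fst z) (snd z) \<omega>))\<^sup>2) \<partial>lborel)
      \<le> (\<integral>\<^sup>+z. ennreal (Cg\<^sup>2) * (ennreal (?w z) * indicator ({0..} \<times> {0..<J}) z) \<partial>lborel)"
    proof (intro nn_integral_mono)
      fix z
      have "(g (v (fst z) (snd z) \<omega>))\<^sup>2 \<le> Cg\<^sup>2" using g by (simp add: abs_le_square_iff[symmetric])
      then have "(wave_kernel t x z * g (v (fst z) (snd z) \<omega>) - wave_kernel t' x' z * g (v (fst z) (snd z) \<omega>))\<^sup>2 \<le> Cg\<^sup>2 * ?w z"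
        unfolding left_diff_distrib[symmetric] power_mult_distrib by (subst mult.commute) (rule mult_right_mono, auto)
      then have "ennreal ((wave_kernel t x z * g (v (fst z) (snd z) \<omega>) - wave_kernel t' x' z * g (v (fst z) (snd z) \<omega>))\<^sup>2) \<le> ennreal (Cg\<^sup>2) * ennreal (?w z)"
        by (subst ennreal_mult[symmetric]) (auto intro: ennreal_leI)
      then show "ennreal ((wave_kernel t x z * g (v (fst z) (snd z) \<omega>) - wave_kernel t' x' z * g (v (fst z) (snd z) \<omega>))\<^sup>2) * indicator ({0..} \<times> {0..<J}) z
        \<le> ennreal (Cg\<^sup>2) * (ennreal (?w z) * indicator ({0..} \<times> {0..<J}) z)"
        by (cases "z \<in> {0..} \<times> {0..<J}") simp_all
    qed
    also have "\<dots> = ennreal (Cg\<^sup>2) * (\<integral>\<^sup>+z\<in>{0..} \<times> {0..<J}. ennreal (?w z) \<partial>lborel)"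
    proof (rule nn_integral_cmult)
      have [measurable]: "wave_kernel t x \<in> borel_measurable lborel" "wave_kernel t' x' \<in> borel_measurable lborel"
        using km by simp_all
      have "(\<lambda>z. ennreal (?w z)) \<in> borel_measurable lborel" by measurable
      moreover have "(\<lambda>z :: real \<times> real. indicator ({0..} \<times> {0..<J}) z :: ennreal) \<in> borel_measurable lborel"
        using im by simp
      ultimately show "(\<lambda>z. ennreal (?w z) * indicator ({0..} \<times> {0..<J}) z) \<in> borel_measurable lborel"
        by (rule borel_measurable_times_ennreal)
    qed
    also have "\<dots> \<le> ennreal (Cg\<^sup>2) * ennreal (\<kappa>\<^sup>2 * T * d)"
      by (intro mult_left_mono order_trans[OF wave_kernel_diff_sq] ennreal_leI) (use p d T_pos in auto)
    also have "\<dots> = ennreal ?K" using T_pos d by (simp add: ennreal_mult[symmetric])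
    finally show "(\<integral>\<^sup>+z\<in>{0..} \<times> {0..<J}. ennreal ((wave_kernel t x z * g (v (fst z) (snd z) \<omega>) - wave_kernel t' x' z * g (v (fst z) (snd z) \<omega>))\<^sup>2) \<partial>lborel)
      \<le> ennreal ?K" .
  qed
  then show ?thesis by (simp add: mult_ac)
qed

text \<open>The integrand vanishes, but the tail bound asks for a positive variance proxy; it is
  applied with arbitrarily small ones.\<close>

lemma walsh_at_0:
  assumes "x \<in> {0..J}"
  shows "AE \<omega> in M. X 0 x \<omega> = 0"
proof -
  have p: "0 \<in> {0..T}" using T_pos by simp
  have [measurable]: "X 0 x \<in> borel_measurable M" by (rule walsh_field_measurable[OF p assms])
  have null: "(\<integral>\<^sup>+z\<in>{0..} \<times> {0..<J}. ennreal ((wave_kernel 0 x z * g (v (fst z) (snd z) \<omega>))\<^sup>2) \<partial>lborel) = 0" for \<omega>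
  proof -
    have "ennreal ((wave_kernel 0 x z * g (v (fst z) (snd z) \<omega>))\<^sup>2) * indicator ({0..} \<times> {0..<J}) z = 0" for z
      by (auto simp: wave_kernel_def indicator_def mem_Times_iff)
    then show ?thesis by (simp only: nn_integral_const mult_zero_left)
  qed
  have "prob {\<omega> \<in> space M. \<bar>X 0 x \<omega>\<bar> \<ge> e} = 0" if e: "e > 0" for e
  proof -
    have "prob {\<omega> \<in> space M. \<bar>X 0 x \<omega>\<bar> \<ge> e} \<le> 2 * exp (- real n)" for n
    proof (cases "n = 0")
      case True
      have "prob {\<omega> \<in> space M. \<bar>X 0 x \<omega>\<bar> \<ge> e} \<le> 1" by (rule prob_le_1)
      also have "\<dots> \<le> 2 * exp (- real n)" using True by simp
      finally show ?thesis .
    next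
      case False
      \<comment> \<open>The proxy \<open>e\<^sup>2 / (4 * real n)\<close> is chosen so that the
        exponent becomes \<open>- real n\<close>.\<close>
      have "prob {\<omega> \<in> space M. \<bar>X 0 x \<omega>\<bar> \<ge> e} \<le> 2 * exp (- (e\<^sup>2) / (4 * (e\<^sup>2 / (4 * real n))))"
        using e False by (intro walsh_integral_tail[OF walsh_kernel[OF p assms]]) (auto simp: null)
      then show ?thesis using e False by simp
    qed
    then have "\<exists>N. \<forall>n\<ge>N. prob {\<omega> \<in> space M. \<bar>X 0 x \<omega>\<bar> \<ge> e} \<le> 2 * exp (- real n)" by blast
    moreover have "(\<lambda>n. 2 * exp (- real n)) \<longlonglongrightarrow> 2 * 0"
      by (intro tendsto_intros filterlim_compose[OF exp_at_bot] filterlim_uminus_at_bot_at_top[THEN filterlim_compose] filterlim_real_sequentially)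
    ultimately have "prob {\<omega> \<in> space M. \<bar>X 0 x \<omega>\<bar> \<ge> e} \<le> 2 * 0"
      by (rule LIMSEQ_le_const[rotated])
    then show ?thesis using measure_nonneg[of M "{\<omega> \<in> space M. \<bar>X 0 x \<omega>\<bar> \<ge> e}"] by linarith
  qed
  then have "AE \<omega> in M. \<omega> \<notin> {\<omega> \<in> space M. \<bar>X 0 x \<omega>\<bar> \<ge> 1 / real (Suc n)}" for n
    by (intro AE_not_in) (auto simp: null_sets_def emeasure_eq_measure)
  then have "AE \<omega> in M. \<forall>n. \<omega> \<notin> {\<omega> \<in> space M. \<bar>X 0 x \<omega>\<bar> \<ge> 1 / real (Suc n)}"
    by (simp add: AE_all_countable)
  then show ?thesis using AE_space
  proof eventually_elim
    case (elim \<omega>)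
    show ?case
    proof (rule ccontr)
      assume "X 0 x \<omega> \<noteq> 0"
      then obtain n where "1 / real (Suc n) < \<bar>X 0 x \<omega>\<bar>"
        using reals_Archimedean[of "\<bar>X 0 x \<omega>\<bar>"] by (auto simp: inverse_eq_divide)
      then show False using elim by (auto simp: not_le dest: spec[of _ n])
    qed
  qed
qed

end
end

section \<open>The solution stays positive\<close>

text \<open>For different \<open>k\<close> the events may be unrelated. If every \<open>k\<close>
  from \<open>k0\<close> on fails, the outcome lies in each union \<open>B k\<close>, whose
  probability is at most the tail of the summable \<open>b\<close> from \<open>k\<close> on and so
  tends to 0.\<close>

lemma (in prob_space) AE_exists_avoiding:
  fixes b :: "nat \<Rightarrow> real"
  assumes E: "\<And>k j. E k j \<in> sets M" "\<And>k j. prob (E k j) \<le> b j" and b: "summable b"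
  shows "AE \<omega> in M. \<exists>k\<ge>k0. \<forall>j\<ge>k. \<omega> \<notin> E k j"
proof -
  define B where "B k = (\<Union>n. E k (n + k))" for k
  have B: "B k \<in> sets M" for k using E(1) by (auto simp: B_def)
  have sum: "summable (\<lambda>n. b (n + k))" for k using b by (simp add: summable_iff_shift)
  have prob_B: "prob (B k) \<le> (\<Sum>n. b (n + k))" for k
  proof -
    have s: "summable (\<lambda>n. prob (E k (n + k)))"
      by (rule summable_comparison_test'[OF sum[of k], where N = 0]) (use E(2) in auto)
    have "prob (B k) \<le> (\<Sum>n. prob (E k (n + k)))"
      unfolding B_def using E(1) s by (intro finite_measure_subadditive_countably) auto
    also have "\<dots> \<le> (\<Sum>n. b (n + k))" by (intro suminf_le E(2) s sum)
    finally show ?thesis .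
  qed
  define I where "I = (\<Inter>k\<in>{k0..}. B k)"
  have I: "I \<in> sets M" unfolding I_def using B by (intro sets.countable_INT') auto
  have "prob I \<le> 0"
  proof (rule LIMSEQ_le_const[OF suminf_tail_tendsto_0[OF b]], intro exI allI impI)
    fix k assume "k0 \<le> k"
    then have "prob I \<le> prob (B k)" unfolding I_def using B by (intro finite_measure_mono) auto
    then show "prob I \<le> (\<Sum>n. b (n + k))" using prob_B[of k] by linarith
  qed
  then have "prob I = 0" using measure_nonneg[of M I] by linarith
  then have "I \<in> null_sets M" using I by (auto simp: null_sets_def emeasure_eq_measure)
  from AE_not_in[OF this] show ?thesis
  proof eventually_elim
    case (elim \<omega>)
    then obtain k where k: "k0 \<le> k" "\<omega> \<notin> B k" by (auto simp: I_def)
    have "\<omega> \<notin> E k j" if "k \<le> j" for j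
      using k(2) that by (auto simp: B_def dest: spec[of _ "j - k"])
    then show ?case using k(1) by blast
  qed
qed

context wave_model
begin

text \<open>The index \<open>N\<close> may depend on the outcome, since the supremum of the hitting
  times dominates each of them. All constants are fixed before \<open>N\<close> is chosen.\<close>

lemma solution_stays_above:
  fixes \<alpha> :: real and u0 u1 g :: "real \<Rightarrow> real" and u :: "nat \<Rightarrow> real \<Rightarrow> real \<Rightarrow> 'a \<Rightarrow> real"
  assumes \<alpha>: "\<alpha> > 3"
    and u0: "\<And>x y. \<bar>u0 x - u0 y\<bar> \<le> C0 * sqrt \<bar>x - y\<bar>" "\<And>x. c0 \<le> u0 x" "c0 > 0"
    and u1: "\<And>x y. \<bar>u1 x - u1 y\<bar> \<le> C1 * sqrt \<bar>x - y\<bar>"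
    and g: "\<And>y. \<bar>g y\<bar> \<le> Cg" "Cg > 0"
    and sol: "\<And>N. N \<ge> 1 \<Longrightarrow> strong_solution M J W \<alpha> u0 u1 g N (u N)"
  shows "AE \<omega> in M. \<exists>N\<ge>1. \<forall>t\<in>{0..T}. \<forall>x\<in>{0..J}. u N t x \<omega> > 1 / real N"
proof -
  obtain q where q: "0 < q" "q < 1" "1/2 < q\<^sup>2" "4 * q powr (\<alpha> + 1) < 1"
    using chaining_ratio_exists[OF \<alpha>] .
  \<comment> \<open>With \<open>N = 2^k\<close> this makes the level \<open>1 / real N\<close> at
    most \<open>q^k\<close>, the order of the oscillation.\<close>
  have q_half: "1/2 \<le> q" using q by (smt (verit) mult_left_le power2_eq_square)
  define U where "U N \<omega> z = (max (u N (fst z) (snd z) \<omega>) (1 / real N)) powr (- \<alpha>)" for N \<omega> and z :: "real \<times> real"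
  \<comment> \<open>The range conditions stand inside \<open>P\<close> so that a noise term can be
    chosen for all arguments at once; the exceptional null set of the mild equation still depends on
    the point.\<close>
  define P where "P N t x I \<longleftrightarrow> (N \<ge> 1 \<longrightarrow> t \<in> {0..T} \<longrightarrow> x \<in> {0..J} \<longrightarrow>
      walsh_integral M J W (\<lambda>(s, y) \<omega>. if s < t then SI J (t - s) (x - y) * g (u N s y \<omega>) else 0) I \<and>
      (AE \<omega> in M. u N t x \<omega> = wave_init J u0 u1 t x + drift (U N \<omega>) t x + I \<omega>))" for N t x I
  have "\<forall>N t x. \<exists>I. P N t x I"
  proof (intro allI)
    fix N t x
    show "\<exists>I. P N t x I"
    proof (cases "N \<ge> 1 \<and> t \<in> {0..T} \<and> x \<in> {0..J}")
      case True
      then have "strong_solution M J W \<alpha> u0 u1 g N (u N)" "t \<ge> 0" using sol by auto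
      then show ?thesis using True unfolding strong_solution_def P_def drift_def U_def by blast
    qed (auto simp: P_def)
  qed
  then obtain X where "\<forall>N t x. P N t x (X N t x)" by metis
  then have X: "\<And>N t x. N \<ge> 1 \<Longrightarrow> t \<in> {0..T} \<Longrightarrow> x \<in> {0..J} \<Longrightarrow>
      walsh_integral M J W (\<lambda>(s, y) \<omega>. if s < t then SI J (t - s) (x - y) * g (u N s y \<omega>) else 0) (X N t x)"
    and mild: "\<And>N t x. N \<ge> 1 \<Longrightarrow> t \<in> {0..T} \<Longrightarrow> x \<in> {0..J} \<Longrightarrow>
      AE \<omega> in M. u N t x \<omega> = wave_init J u0 u1 t x + drift (U N \<omega>) t x + X N t x \<omega>"
    unfolding P_def by blast+

  have u1_cont: "continuous_on {0..J} u1" by (rule holder_half_continuous_on[OF u1])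
  obtain B1 where "\<forall>y\<in>{0..J}. \<bar>u1 y\<bar> \<le> B1"
    using compact_imp_bounded[OF compact_continuous_image[OF u1_cont compact_Icc]]
    by (auto simp: bounded_iff)
  then have B1: "\<And>y. y \<in> {0..J} \<Longrightarrow> \<bar>u1 y\<bar> \<le> B1" by blast
  have B1_nonneg: "B1 \<ge> 0" using B1[of 0] J_pos by auto
  have C0_nonneg: "C0 \<ge> 0" using u0(1)[of 0 1] by simp
  note init_diff = wave_init_diff[OF u0(1) B1 u1_cont]

  \<comment> \<open>The minimum keeps \<open>\<delta> / 2^k\<close> within one grid cell in both
    coordinates after rescaling to the unit square.\<close>
  define \<delta> where "\<delta> = min T J"
  have \<delta>: "\<delta> > 0" "\<delta> \<le> T" "\<delta> \<le> J" using T_pos J_pos by (auto simp: \<delta>_def)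
  define Cc where "Cc = 2 + 4 / (1 - q)"
  \<comment> \<open>The three terms are the chaining constant of the noise, the Hoelder modulus of
    \<open>u0\<close> and the Lipschitz bound for the velocity part, each at scale
    \<open>\<delta> / 2^k\<close> and compared with \<open>q^k\<close>.\<close>
  define C where "C = Cc + C0 * sqrt (2 * \<delta>) + B1 * \<kappa> * (2 * \<delta>)"
  have Cc: "Cc > 0" using q by (simp add: Cc_def add_pos_pos)
  have C: "C > 0" unfolding C_def using Cc C0_nonneg B1_nonneg \<kappa>_ge_1 \<delta> by (intro add_pos_nonneg) auto
  \<comment> \<open>The additional \<open>Cc\<close> pays for the loss in the lower bound for the
    path at time 0.\<close>
  obtain k0 where k0: "\<And>k. k \<ge> k0 \<Longrightarrow> (C + 1 + Cc) * q^k < c0 \<and>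
      (C + 1) * q^k \<le> ((C + 1) * q^k) powr (- \<alpha>) * (\<delta> / 2^k)\<^sup>2 / 16"
    using eventually_scales[OF q(1,2,4), of "C + 1" \<delta> c0 "C + 1 + Cc"] C \<delta> u0(3)
    by (auto simp: eventually_sequentially)

  define c where "c = 4 * (Cg\<^sup>2 * \<kappa>\<^sup>2 * T)"
  define b where "b j = 4 * (2^j + 1)\<^sup>2 * exp (- ((2 * q\<^sup>2)^j / (c * (T + J))))" for j :: nat
  define bad where "bad N j = {\<omega> \<in> space M.
      (\<exists>i<2^j. \<exists>l\<le>2^j. \<bar>X N (T * (real (Suc i) / 2^j)) (J * (real l / 2^j)) \<omega> - X N (T * (real i / 2^j)) (J * (real l / 2^j)) \<omega>\<bar> \<ge> q^j) \<or>
      (\<exists>i\<le>2^j. \<exists>l<2^j. \<bar>X N (T * (real i / 2^j)) (J * (real (Suc l) / 2^j)) \<omega> - X N (T * (real i / 2^j)) (J * (real l / 2^j)) \<omega>\<bar> \<ge> q^j)}"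
    for N and j :: nat
  have bad: "bad N j \<in> sets M" "prob (bad N j) \<le> b j" if N: "N \<ge> 1" for N j
  proof -
    have tail: "prob {\<omega> \<in> space M. \<bar>X N t x \<omega> - X N t' x' \<omega>\<bar> \<ge> q^j} \<le> 2 * exp (- ((q^j)\<^sup>2) / (c * d))"
      if "t \<in> {0..T}" "x \<in> {0..J}" "t' \<in> {0..T}" "x' \<in> {0..J}" "d > 0" "\<bar>t - t'\<bar> + \<bar>x - x'\<bar> \<le> d" for t x t' x' d
      unfolding c_def
      by (rule walsh_increment_tail[where v = "u N" and g = g])
         (assumption | rule X[OF N] g that zero_le_power less_imp_le[OF q(1)])+
    have meas: "X N t x \<in> borel_measurable M" if "t \<in> {0..T}" "x \<in> {0..J}" for t x
      by (rule walsh_field_measurable[where v = "u N" and g = g])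
         (assumption | rule X[OF N] g that)+
    show "bad N j \<in> sets M" "prob (bad N j) \<le> b j"
      unfolding bad_def b_def
      by (rule grid_bad_event[OF T_pos J_pos q(1) meas tail]; assumption)+
  qed
  have "summable b"
    unfolding b_def
  proof (rule summable_grid_tail)
    show "1 < 2 * q\<^sup>2" using q(3) by simp
    show "0 < c * (T + J)" using g(2) \<kappa>_ge_1 T_pos J_pos by (simp add: c_def)
  qed
  \<comment> \<open>The solution index and the coarsest grid level are tied together as
    \<open>2^k\<close> and \<open>k\<close>; the bound \<open>b\<close> depends on neither.\<close>
  then have ae_good: "AE \<omega> in M. \<exists>k\<ge>k0. \<forall>j\<ge>k. \<omega> \<notin> bad (2^k) j"
    using bad by (intro AE_exists_avoiding) auto
  \<comment> \<open>A countable set of grid points allows the exceptional null sets to be collected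
    into one.\<close>
  have ae_mild: "AE \<omega> in M. \<forall>k j i l. i \<le> 2^j \<longrightarrow> l \<le> 2^j \<longrightarrow>
      u (2^k) (T * (real i / 2^j)) (J * (real l / 2^j)) \<omega> = wave_init J u0 u1 (T * (real i / 2^j)) (J * (real l / 2^j))
        + drift (U (2^k) \<omega>) (T * (real i / 2^j)) (J * (real l / 2^j)) + X (2^k) (T * (real i / 2^j)) (J * (real l / 2^j)) \<omega>"
  proof -
    have "AE \<omega> in M. i \<le> 2^j \<longrightarrow> l \<le> 2^j \<longrightarrow>
      u (2^k) (T * (real i / 2^j)) (J * (real l / 2^j)) \<omega> = wave_init J u0 u1 (T * (real i / 2^j)) (J * (real l / 2^j))
        + drift (U (2^k) \<omega>) (T * (real i / 2^j)) (J * (real l / 2^j)) + X (2^k) (T * (real i / 2^j)) (J * (real l / 2^j)) \<omega>"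
      for k j i l :: nat
    proof (cases "i \<le> 2^j \<and> l \<le> 2^j")
      case True
      then show ?thesis using mild[of "2^k", OF _ grid_point_mem[OF T_pos, of i j] grid_point_mem[OF J_pos, of l j]] by auto
    qed auto
    then show ?thesis by (simp only: AE_all_countable) blast
  qed
  have ae_cont: "AE \<omega> in M. \<forall>k. continuous_on ({0..} \<times> {0..J}) (\<lambda>(t, x). u (2^k) t x \<omega>)"
    unfolding AE_all_countable
  proof
    fix k :: nat
    show "AE \<omega> in M. continuous_on ({0..} \<times> {0..J}) (\<lambda>(t, x). u (2^k) t x \<omega>)"
      using sol[of "2^k"] by (auto simp: strong_solution_def)
  qed
  have ae_zero: "AE \<omega> in M. \<forall>k j l. l \<le> 2^j \<longrightarrow> X (2^k) 0 (J * (real l / 2^j)) \<omega> = 0"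
  proof -
    have "AE \<omega> in M. l \<le> 2^j \<longrightarrow> X (2^k) 0 (J * (real l / 2^j)) \<omega> = 0" for k j l :: nat
    proof (cases "l \<le> 2^j")
      case True
      have N: "(2::nat)^k \<ge> 1" by simp
      have "AE \<omega> in M. X (2^k) 0 (J * (real l / 2^j)) \<omega> = 0"
        by (rule walsh_at_0[where v = "u (2^k)" and g = g])
           (assumption | rule X[OF N] g grid_point_mem[OF J_pos True])+
      then show ?thesis by auto
    qed auto
    then show ?thesis by (simp only: AE_all_countable) blast
  qed
  from ae_good ae_mild ae_cont ae_zero AE_space show ?thesis
  proof eventually_elim
    case (elim \<omega>)
    then obtain k where k: "k \<ge> k0" "\<And>j. j \<ge> k \<Longrightarrow> \<omega> \<notin> bad (2^k) j" by blast
    define N :: nat where "N = 2^k"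
    define v where "v t x = u N t x \<omega>" for t x
    define Uk where "Uk = (\<lambda>z. (max (v (fst z) (snd z)) (1 / real N)) powr (- \<alpha>))"
    have Uk: "Uk = U N \<omega>" by (auto simp: Uk_def U_def v_def)
    have N: "N > 0" by (simp add: N_def)
    have cont: "continuous_on ({0..} \<times> {0..J}) (\<lambda>(t, x). v t x)"
      using elim(3) by (simp add: v_def N_def)
    have cont': "continuous_on ({0..} \<times> {0..J}) (\<lambda>z. v (fst z) (snd z))"
      using cont by (simp add: split_beta)
    have Uk_cont: "continuous_on ({0..} \<times> {0..J}) Uk"
    proof -
      have "max (v (fst z) (snd z)) (1 / real N) \<noteq> 0" for z
        using N by (metis less_irrefl less_max_iff_disj of_nat_0_less_iff zero_less_divide_1_iff)
      then show ?thesis unfolding Uk_def by (intro continuous_intros cont') auto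
    qed
    have Uk_bound: "0 \<le> Uk z \<and> Uk z \<le> (1 / real N) powr (- \<alpha>)" for z
      unfolding Uk_def using N \<alpha> by (auto intro!: powr_mono2')
    \<comment> \<open>A continuous function of the point that agrees with the Walsh field on the
      grid; it replaces that field off the grid.\<close>
    define R where "R z = v (fst z) (snd z) - wave_init J u0 u1 (fst z) (snd z) - drift Uk (fst z) (snd z)" for z
    have R_cont: "continuous_on ({0..T} \<times> {0..J}) R"
      unfolding R_def
    proof (intro continuous_on_diff)
      show "continuous_on ({0..T} \<times> {0..J}) (\<lambda>z. v (fst z) (snd z))"
        by (rule continuous_on_subset[OF cont']) auto
      show "continuous_on ({0..T} \<times> {0..J}) (\<lambda>z. wave_init J u0 u1 (fst z) (snd z))"
        by (rule modulus_continuous_on, rule init_diff) auto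
      show "continuous_on ({0..T} \<times> {0..J}) (\<lambda>z. drift Uk (fst z) (snd z))"
      proof (rule modulus_continuous_on)
        fix z z' assume "z \<in> {0..T} \<times> {0..J}" "z' \<in> {0..T} \<times> {0..J}"
        then show "\<bar>drift Uk (fst z) (snd z) - drift Uk (fst z') (snd z')\<bar> \<le> 0 * sqrt (\<bar>fst z - fst z'\<bar> + \<bar>snd z - snd z'\<bar>)
            + ((1 / real N) powr (- \<alpha>) * T * \<kappa>) * (\<bar>fst z - fst z'\<bar> + \<bar>snd z - snd z'\<bar>)"
          using drift_lipschitz[OF Uk_cont Uk_bound, of "fst z" "fst z'" "snd z" "snd z'"] by auto
      qed
    qed
    define F where "F = (\<lambda>z. R (T * fst z, J * snd z))"
    have F_cont: "continuous_on ({0..1} \<times> {0..1}) F"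
      unfolding F_def
    proof (rule continuous_on_compose2[OF R_cont])
      show "continuous_on ({0..1} \<times> {0..1}) (\<lambda>z. (T * fst z, J * snd z))" by (intro continuous_intros)
      show "(\<lambda>z. (T * fst z, J * snd z)) ` ({0..1} \<times> {0..1}) \<subseteq> {0..T} \<times> {0..J}"
        using T_pos J_pos by (auto simp: mult_left_le)
    qed
    have F_grid: "F (real i / 2^j, real l / 2^j) = X N (T * (real i / 2^j)) (J * (real l / 2^j)) \<omega>"
      if "i \<le> 2^j" "l \<le> 2^j" for i j l
    proof -
      have "v (T * (real i / 2^j)) (J * (real l / 2^j)) = wave_init J u0 u1 (T * (real i / 2^j)) (J * (real l / 2^j))
        + drift Uk (T * (real i / 2^j)) (J * (real l / 2^j)) + X N (T * (real i / 2^j)) (J * (real l / 2^j)) \<omega>"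
        using elim(2)[rule_format, OF that, of k] unfolding Uk N_def v_def .
      then show ?thesis by (simp add: F_def R_def)
    qed
    have good: "\<omega> \<notin> bad N j" if "k \<le> j" for j using k(2)[OF that] by (simp add: N_def)
    have osc_F: "\<bar>F (a, b) - F (a', b')\<bar> \<le> Cc * q^k"
      if "a \<in> {0..1}" "b \<in> {0..1}" "a' \<in> {0..1}" "b' \<in> {0..1}" "\<bar>a - a'\<bar> \<le> 1 / 2^k" "\<bar>b - b'\<bar> \<le> 1 / 2^k" for a b a' b'
      unfolding Cc_def
    proof (rule dyadic_chaining[OF q(1,2) F_cont _ _ that])
      fix j i l :: nat assume j: "k \<le> j"
      show "\<bar>F (real (Suc i) / 2^j, real l / 2^j) - F (real i / 2^j, real l / 2^j)\<bar> \<le> q^j" if il: "i < 2^j" "l \<le> 2^j"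
      proof -
        have "\<not> \<bar>X N (T * (real (Suc i) / 2^j)) (J * (real l / 2^j)) \<omega> - X N (T * (real i / 2^j)) (J * (real l / 2^j)) \<omega>\<bar> \<ge> q^j"
          using good[OF j] elim(5) il unfolding bad_def by blast
        then show ?thesis using F_grid[of "Suc i" j l] F_grid[of i j l] il by simp
      qed
      show "\<bar>F (real i / 2^j, real (Suc l) / 2^j) - F (real i / 2^j, real l / 2^j)\<bar> \<le> q^j" if il: "i \<le> 2^j" "l < 2^j"
      proof -
        have "\<not> \<bar>X N (T * (real i / 2^j)) (J * (real (Suc l) / 2^j)) \<omega> - X N (T * (real i / 2^j)) (J * (real l / 2^j)) \<omega>\<bar> \<ge> q^j"
          using good[OF j] elim(5) il unfolding bad_def by blast
        then show ?thesis using F_grid[of i j "Suc l"] F_grid[of i j l] il by simp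
      qed
    qed
    define r where "r = \<delta> / 2^k"
    have r: "r > 0" "r \<le> T / 2^k" "r \<le> J / 2^k" using \<delta> by (auto simp: r_def divide_right_mono)
    have "J / 2^k \<le> J" using J_pos by (simp add: divide_le_eq)
    then have rJ: "r \<le> J" using r by linarith
    have pow_half: "1 / 2^k \<le> q^k"
      using power_mono[OF q_half, of k] by (simp add: power_divide)
    have unit: "t / T \<in> {0..1}" "x / J \<in> {0..1}" "T * (t / T) = t" "J * (x / J) = x" if "t \<in> {0..T}" "x \<in> {0..J}" for t x
      using that T_pos J_pos by auto
    have R_F: "R (t, x) = F (t / T, x / J)" if "t \<in> {0..T}" "x \<in> {0..J}" for t x
      using unit[OF that] by (simp add: F_def)
    have osc: "\<bar>(v t x - drift Uk t x) - (v t' x' - drift Uk t' x')\<bar> \<le> C * q^k"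
      if p: "t \<in> {0..T}" "t' \<in> {0..T}" "x \<in> {0..J}" "x' \<in> {0..J}" and close: "\<bar>t - t'\<bar> \<le> r" "\<bar>x - x'\<bar> \<le> r" for t x t' x'
    proof -
      have "\<bar>t / T - t' / T\<bar> = \<bar>t - t'\<bar> / T" using T_pos by (simp add: diff_divide_distrib[symmetric])
      also have "\<dots> \<le> (T / 2^k) / T" using close r T_pos by (intro divide_right_mono) auto
      finally have c1: "\<bar>t / T - t' / T\<bar> \<le> 1 / 2^k" using T_pos by simp
      have "\<bar>x / J - x' / J\<bar> = \<bar>x - x'\<bar> / J" using J_pos by (simp add: diff_divide_distrib[symmetric])
      also have "\<dots> \<le> (J / 2^k) / J" using close r J_pos by (intro divide_right_mono) auto
      finally have c2: "\<bar>x / J - x' / J\<bar> \<le> 1 / 2^k" using J_pos by simp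
      have 1: "\<bar>R (t, x) - R (t', x')\<bar> \<le> Cc * q^k"
        unfolding R_F[OF p(1,3)] R_F[OF p(2,4)]
        by (rule osc_F) (use unit[OF p(1,3)] unit[OF p(2,4)] c1 c2 in auto)
      define d where "d = \<bar>t - t'\<bar> + \<bar>x - x'\<bar>"
      have d: "0 \<le> d" "d \<le> 2 * \<delta> * (1 / 2^k)" using close by (auto simp: d_def r_def)
      \<comment> \<open>The square-root modulus of \<open>u0\<close> at scale \<open>2^(-k)\<close>
        fits under \<open>q^k\<close> because \<open>q\<^sup>2\<close> exceeds 1/2.\<close>
      have sq: "sqrt (1 / 2^k) \<le> q^k"
      proof (rule real_le_lsqrt)
        show "0 \<le> q^k" using q by simp
        have "(1/2)^k \<le> (q\<^sup>2)^k" using q(3) by (intro power_mono) auto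
        then show "1 / 2^k \<le> (q^k)\<^sup>2" by (simp add: power_divide power_mult[symmetric] mult.commute)
      qed
      have "sqrt d \<le> sqrt (2 * \<delta>) * sqrt (1 / 2^k)"
        using d by (simp only: real_sqrt_mult[symmetric] real_sqrt_le_iff)
      also have "\<dots> \<le> sqrt (2 * \<delta>) * q^k" using sq \<delta> by (intro mult_left_mono) auto
      finally have s1: "C0 * sqrt d \<le> C0 * (sqrt (2 * \<delta>) * q^k)" by (rule mult_left_mono[OF _ C0_nonneg])
      have "d \<le> 2 * \<delta> * q^k" using d pow_half \<delta> by (meson mult_left_mono order_trans less_imp_le mult_pos_pos zero_less_numeral)
      then have s2: "B1 * \<kappa> * d \<le> B1 * \<kappa> * (2 * \<delta> * q^k)"
        using B1_nonneg \<kappa>_ge_1 by (intro mult_left_mono) auto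
      have "\<bar>wave_init J u0 u1 t x - wave_init J u0 u1 t' x'\<bar> \<le> C0 * sqrt d + B1 * \<kappa> * d"
        unfolding d_def using p by (intro init_diff) auto
      then have 2: "\<bar>wave_init J u0 u1 t x - wave_init J u0 u1 t' x'\<bar> \<le> C0 * (sqrt (2 * \<delta>) * q^k) + B1 * \<kappa> * (2 * \<delta> * q^k)"
        using s1 s2 by linarith
      have "(v t x - drift Uk t x) - (v t' x' - drift Uk t' x') = (R (t, x) - R (t', x')) + (wave_init J u0 u1 t x - wave_init J u0 u1 t' x')"
        by (simp add: R_def)
      then have "\<bar>(v t x - drift Uk t x) - (v t' x' - drift Uk t' x')\<bar> \<le> Cc * q^k + (C0 * (sqrt (2 * \<delta>) * q^k) + B1 * \<kappa> * (2 * \<delta> * q^k))"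
        using 1 2 by linarith
      also have "\<dots> = C * q^k" by (simp add: C_def algebra_simps)
      finally show ?thesis .
    qed
    \<comment> \<open>At time 0 the noise term is known to vanish only at grid points, so an
      arbitrary \<open>x\<close> is compared with a neighbouring grid point, at the cost of the
      chaining bound.\<close>
    have init: "c0 - Cc * q^k \<le> v 0 x" if x: "x \<in> {0..J}" for x
    proof -
      define l where "l = nat \<lfloor>x / J * 2^k\<rfloor>"
      have x01: "0 \<le> x / J" "x / J \<le> 1" using x J_pos by auto
      then have "0 \<le> x / J * 2^k" by (intro mult_nonneg_nonneg) auto
      then have l: "real l \<le> x / J * 2^k" "x / J * 2^k < real l + 1"
        unfolding l_def by linarith+
      moreover have "x / J * 2^k \<le> 1 * 2^k" using x01 by (intro mult_right_mono) auto
      ultimately have l_le: "real l \<le> 2^k" by linarith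
      then have "real l \<le> real (2^k)" by simp
      then have l_le': "l \<le> 2^k" by (simp only: of_nat_le_iff)
      have "\<bar>x / J - real l / 2^k\<bar> \<le> 1 / 2^k"
      proof -
        have "x / J - real l / 2^k = (x / J * 2^k - real l) / 2^k" by (simp add: diff_divide_distrib)
        moreover have "\<bar>x / J * 2^k - real l\<bar> \<le> 1" using l by linarith
        ultimately show ?thesis by (simp add: divide_right_mono)
      qed
      then have "\<bar>F (0, x / J) - F (0, real l / 2^k)\<bar> \<le> Cc * q^k"
        using x01 l_le by (intro osc_F) auto
      moreover have "F (0, real l / 2^k) = 0"
        using F_grid[of 0 k l] l_le' elim(4)[rule_format, of l k k] by (simp add: N_def)
      moreover have "F (0, x / J) = v 0 x - u0 x"
        using J_pos by (simp add: F_def R_def wave_init_at_0 drift_at_0)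
      ultimately show ?thesis using u0(2)[of x] by linarith
    qed
    have small: "(C + 1) * q^k < c0 - Cc * q^k" "(C + 1) * q^k \<le> ((C + 1) * q^k) powr (- \<alpha>) * r\<^sup>2 / 16"
      using k0[OF k(1)] by (auto simp: r_def algebra_simps)
    have "\<forall>t\<in>{0..T}. \<forall>x\<in>{0..J}. v t x > 1 / real N"
    proof (intro ballI)
      fix t x assume tx: "t \<in> {0..T}" "x \<in> {0..J}"
      show "v t x > 1 / real N"
        by (rule path_stays_above[OF cont N _ _ _ r(1) rJ osc[unfolded Uk_def] init small tx])
           (use pow_half \<alpha> C in \<open>auto simp: N_def\<close>)
    qed
    then show ?case using N by (intro exI[of _ N]) (simp add: v_def)
  qed
qed

end

theorem theorem1p1:
  fixes M :: "'a measure" and J \<alpha> :: real and u0 u1 g :: "real \<Rightarrow> real"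
    and W :: "(real \<times> real) set \<Rightarrow> 'a \<Rightarrow> real"
    and u :: "nat \<Rightarrow> real \<Rightarrow> real \<Rightarrow> 'a \<Rightarrow> real"
  assumes "prob_space M"
    and "J > 0"
    and "\<alpha> > 3"
    and "white_noise M J W"
    and "holder_half_periodic J u0"
    and "\<exists>c0 C0. 0 < c0 \<and> c0 < C0 \<and> (\<forall>x. c0 \<le> u0 x \<and> u0 x \<le> C0)"
    and "holder_half_periodic J u1"
    and "\<exists>cg Cg. 0 < cg \<and> cg < Cg \<and> (\<forall>y. cg \<le> g y \<and> g y \<le> Cg)"
    and "\<exists>L. \<forall>a b. \<bar>g a - g b\<bar> \<le> L * \<bar>a - b\<bar>"
    and "\<forall>N\<ge>1. strong_solution M J W \<alpha> u0 u1 g N (u N)"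
  shows "AE \<omega> in M. (SUP N\<in>{1..}. hit_time J (u N) N \<omega>) = \<infinity>"
proof -
  interpret white_noise_space M J W
    using assms(1,4) by (simp add: white_noise_space_def white_noise_space_axioms_def)
  obtain C0 where C0: "\<And>x y. \<bar>u0 x - u0 y\<bar> \<le> C0 * sqrt \<bar>x - y\<bar>"
    using assms(5) by (auto simp: holder_half_periodic_def)
  obtain C1 where C1: "\<And>x y. \<bar>u1 x - u1 y\<bar> \<le> C1 * sqrt \<bar>x - y\<bar>"
    using assms(7) by (auto simp: holder_half_periodic_def)
  obtain c0 where c0: "c0 > 0" "\<And>x. c0 \<le> u0 x" using assms(6) by blast
  obtain cg Cg where cg: "0 < cg" "cg < Cg" "\<And>y. cg \<le> g y \<and> g y \<le> Cg" using assms(8) by blast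
  have g: "\<bar>g y\<bar> \<le> Cg" for y using cg(1) cg(3)[of y] by linarith
  have "AE \<omega> in M. ereal (real n) \<le> (SUP N\<in>{1..}. hit_time J (u N) N \<omega>)" for n :: nat
  proof -
    \<comment> \<open>The successor keeps the horizon positive for \<open>n = 0\<close>, and
      \<open>m\<close> is the least number of periods that covers the window.\<close>
    define T where "T = real (Suc n)"
    define m where "m = \<lceil>(T + J) / J\<rceil>"
    have "(T + J) / J \<le> of_int m" unfolding m_def by (rule le_of_int_ceiling)
    then have m: "T + J \<le> of_int m * J" using assms(2) by (simp add: pos_divide_le_eq)
    interpret wave_model M J W T m
      using assms(2) m by unfold_locales (auto simp: T_def)
    have "AE \<omega> in M. \<exists>N\<ge>1. \<forall>t\<in>{0..T}. \<forall>x\<in>{0..J}. u N t x \<omega> > 1 / real N"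
      using cg assms(10) by (intro solution_stays_above[OF assms(3) C0 c0(2,1) C1 g]) auto
    moreover have "AE \<omega> in M. \<forall>N. 1 \<le> N \<longrightarrow> continuous_on ({0..} \<times> {0..J}) (\<lambda>(t, x). u N t x \<omega>)"
      unfolding AE_all_countable
    proof
      fix N :: nat
      show "AE \<omega> in M. 1 \<le> N \<longrightarrow> continuous_on ({0..} \<times> {0..J}) (\<lambda>(t, x). u N t x \<omega>)"
        using assms(10) by (cases "1 \<le> N") (auto simp: strong_solution_def)
    qed
    ultimately show ?thesis
    proof eventually_elim
      case (elim \<omega>)
      then obtain N where N: "N \<ge> 1" "\<And>t x. t \<in> {0..T} \<Longrightarrow> x \<in> {0..J} \<Longrightarrow> u N t x \<omega> > 1 / real N" by blast
      \<comment> \<open>The \<open>N\<close> found for this outcome and horizon already pushes the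
        supremum beyond \<open>T\<close>.\<close>
      have "ereal T \<le> hit_time J (u N) N \<omega>"
        using elim(2) N by (intro hit_time_ge assms(2)) auto
      also have "\<dots> \<le> (SUP N\<in>{1..}. hit_time J (u N) N \<omega>)" using N(1) by (intro SUP_upper) auto
      finally show ?case by (rule order_trans[rotated]) (simp add: T_def)
    qed
  qed
  then have "AE \<omega> in M. \<forall>n::nat. ereal (real n) \<le> (SUP N\<in>{1..}. hit_time J (u N) N \<omega>)"
    by (simp add: AE_all_countable)
  then show ?thesis
  proof eventually_elim
    case (elim \<omega>)
    show ?case
    proof (rule ereal_top)
      fix B :: real
      obtain n :: nat where "B \<le> real n" using real_arch_simple by blast
      then have "ereal B \<le> ereal (real n)" by simp
      then show "ereal B \<le> (SUP N\<in>{1..}. hit_time J (u N) N \<omega>)"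
        by (rule order_trans) (rule elim[rule_format])
    qed
  qed
qed

end
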